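(* Let $1/2<\alpha<1$, $\beta\in[-1,1]$, $\{\varepsilon_n\}_{n\ge1}\subset[0,1]$, and let $\{S_n\}$ be the elephant random walk with parameters $\alpha,\beta,\{\varepsilon_n\}$ (as defined in the context). Assume that $\lim_{n\to\infty}\varepsilon_n=\varepsilon$ with $\varepsilon\in[0,1)$. Let $W$ be the a.s. and $L^2$ limit of $(S_n-E[S_n])/a_n$ as $n\to\infty$. Then $$\frac{S_n-E[S_n]-W\cdot a_n}{\sqrt{\frac{1-\varepsilon^2}{2\alpha-1}\,n}}\xrightarrow{d}N(0,1),$$ and, for each choice of sign, $$\limsup_{n\to\infty}\pm\frac{S_n-E[S_n]-W\cdot a_n}{a_n\cdot\widehat{\phi}\left(\frac{1-\varepsilon^2}{2\alpha-1}\cdot\frac{n}{(a_n)^2}\right)}=1\quad\text{a.s.,}$$ where $\widehat{\phi}(t):=\sqrt{2t\log|\log t|}$.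
   Context: Elephant random walk with parameters $\alpha\in[0,1)$, $\beta\in[-1,1]$, $\{\varepsilon_n\}_{n\ge1}\subset[0,1]$: $\{X_n\}_{n\ge1}$ is a sequence of $\{+1,-1\}$-valued random variables on a probability space such that $P(X_1=+1)=q$ and $P(X_1=-1)=1-q$ with $q=(1+\beta)/2$ (so $E[X_1]=\beta$), and, with $\mathcal{F}_n$ the $\sigma$-algebra generated by $X_1,\dots,X_n$, for every $n\ge1$, $$P(X_{n+1}=\pm1\mid\mathcal{F}_n)=\alpha\cdot\frac{\#\{i=1,\dots,n: X_i=\pm1\}}{n}+(1-\alpha)\cdot\frac{1\pm\varepsilon_n}{2}.$$ The walk is $S_0:=0$, $S_n:=\sum_{i=1}^nX_i$ for $n\ge1$. The scaling sequence is $a_0:=1$ and $a_n:=\prod_{k=1}^{n-1}\left(1+\frac{\alpha}{k}\right)=\frac{\Gamma(n+\alpha)}{\Gamma(n)\Gamma(\alpha+1)}$ for $n\ge1$. Under the stated hypotheses with $1/2<\alpha<1$, the limit $W=\lim_{n\to\infty}(S_n-E[S_n])/a_n$ exists a.s. and in $L^2$ and has positive variance. $\xrightarrow{d}$ denotes convergence in distribution as $n\to\infty$, and $N(0,1)$ is the standard normal distribution. *)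

theory Defs
  imports "HOL-Probability.Probability"
begin

definition natural_sigma :: "'a measure \<Rightarrow> (nat \<Rightarrow> 'a \<Rightarrow> real) \<Rightarrow> nat \<Rightarrow> 'a measure" where
  "natural_sigma M X n =
     sigma (space M) {X i -` A \<inter> space M | i A. i \<in> {1..n} \<and> A \<in> sets borel}"

text \<open>
  The sequences \<open>X\<close> and \<open>eps\<close> are indexed from 1; their values at index 0 are irrelevant.
  In \<open>step\<close>, the sign \<open>s\<close> stands for the plus-minus sign of the transition rule. The
  conditional probability given the first \<open>n\<close> steps is the conditional expectation of the
  indicator.
\<close>
locale elephant_random_walk = prob_space M
  for M :: "'a measure" and X :: "nat \<Rightarrow> 'a \<Rightarrow> real"
    and \<alpha> \<beta> :: real and eps :: "nat \<Rightarrow> real" +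
  assumes alpha_range: "0 \<le> \<alpha>" "\<alpha> < 1"
    and beta_range: "-1 \<le> \<beta>" "\<beta> \<le> 1"
    and eps_range: "\<And>n. n \<ge> 1 \<Longrightarrow> 0 \<le> eps n \<and> eps n \<le> 1"
    and X_measurable: "\<And>n. n \<ge> 1 \<Longrightarrow> X n \<in> borel_measurable M"
    and X_values: "\<And>n \<omega>. n \<ge> 1 \<Longrightarrow> \<omega> \<in> space M \<Longrightarrow> X n \<omega> \<in> {1, -1}"
    and initial_plus: "prob {\<omega> \<in> space M. X 1 \<omega> = 1} = (1 + \<beta>) / 2"
    and initial_minus: "prob {\<omega> \<in> space M. X 1 \<omega> = -1} = 1 - (1 + \<beta>) / 2"
    and step: "\<And>n s. n \<ge> 1 \<Longrightarrow> s \<in> {1, -1} \<Longrightarrow>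
      AE \<omega> in M.
        real_cond_exp M (natural_sigma M X n)
          (indicator {\<omega>' \<in> space M. X (Suc n) \<omega>' = s}) \<omega>
        = \<alpha> * (real (card {i \<in> {1..n}. X i \<omega> = s}) / real n)
          + (1 - \<alpha>) * ((1 + s * eps n) / 2)"

definition walk :: "(nat \<Rightarrow> 'a \<Rightarrow> real) \<Rightarrow> nat \<Rightarrow> 'a \<Rightarrow> real" where
  "walk X n \<omega> = (\<Sum>i = 1..n. X i \<omega>)"

definition scaling :: "real \<Rightarrow> nat \<Rightarrow> real" where
  "scaling \<alpha> n = (\<Prod>k \<in> {1..<n}. 1 + \<alpha> / real k)"

definition phi_hat :: "real \<Rightarrow> real" where
  "phi_hat t = sqrt (2 * t * ln \<bar>ln t\<bar>)"

definition L2_limit :: "'a measure \<Rightarrow> (nat \<Rightarrow> 'a \<Rightarrow> real) \<Rightarrow> ('a \<Rightarrow> real) \<Rightarrow> bool" where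
  "L2_limit M Y Z \<longleftrightarrow>
     (\<forall>n. Y n \<in> borel_measurable M \<and> integrable M (\<lambda>\<omega>. (Y n \<omega>)\<^sup>2)) \<and>
     Z \<in> borel_measurable M \<and> integrable M (\<lambda>\<omega>. (Z \<omega>)\<^sup>2) \<and>
     (\<lambda>n. integral\<^sup>L M (\<lambda>\<omega>. (Y n \<omega> - Z \<omega>)\<^sup>2)) \<longlonglongrightarrow> 0"

end

theory Submission
  imports Defs
begin

text \<open>
  Put \<open>M\<^sub>n = (S\<^sub>n - E S\<^sub>n) / a\<^sub>n\<close>. The transition rule makes \<open>M\<close> a martingale: its increments
  are \<open>(X\<^sub>n\<^sub>+\<^sub>1 - \<mu>\<^sub>n) / a\<^sub>n\<^sub>+\<^sub>1\<close> with \<open>\<mu>\<^sub>n = \<alpha> S\<^sub>n / n + (1 - \<alpha>) \<epsilon>\<^sub>n\<close>, they are bounded by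
  \<open>2 / a\<^sub>n\<^sub>+\<^sub>1\<close>, and their conditional variances \<open>(1 - \<mu>\<^sub>n\<^sup>2) / a\<^sub>n\<^sub>+\<^sub>1\<^sup>2\<close> become deterministic,
  since \<open>S\<^sub>n / n\<close> tends to \<open>\<epsilon>\<close> almost surely. The exact identity
  \<open>n / a\<^sub>n\<^sup>2 - (n + 1) / a\<^sub>n\<^sub>+\<^sub>1\<^sup>2 = (2 \<alpha> - 1 + \<alpha>\<^sup>2 / n) / a\<^sub>n\<^sub>+\<^sub>1\<^sup>2\<close> shows that they are asymptotic to the
  increments \<open>V\<^sub>n - V\<^sub>n\<^sub>+\<^sub>1\<close> of \<open>V\<^sub>n = (1 - \<epsilon>\<^sup>2) / (2 \<alpha> - 1) * n / a\<^sub>n\<^sup>2\<close>, which decreases to 0. So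
  \<open>V\<^sub>n\<close> is the variance scale of the remainder \<open>W - M\<^sub>n\<close>, and both claims say that this
  remainder behaves like a Brownian motion at time \<open>V\<^sub>n\<close>, for small times. They are proved for
  every convergent martingale with bounded increments of this kind (locale
  \<open>tail_martingale\<close>).

  The central limit theorem (\<open>tail_clt\<close>) replaces the increments one at a time by Gaussian ones in
  the characteristic function; the conditional variances converge in mean because they are
  dominated, and this keeps the total error small uniformly in the number of increments.

  The law of the iterated logarithm (\<open>tail_lil\<close>) is studied along the times at which \<open>V\<close> passes
  the levels \<open>r\<close> to the power \<open>-k\<close>. Conditional variances are only close to their limits after a random
  time, so in both directions the increments are altered, in a predictable way, wherever the
  conditional variance is not yet typical; almost surely only finitely many are altered. In the upper
  bound, atypical increments are dropped, an exponential supermartingale gives a Gaussian maximal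
  inequality, and the Borel-Cantelli lemma applies with \<open>r\<close> close to 1. In the lower bound, \<open>r\<close> is
  large, so that the block sums \<open>M\<^sub>m - M\<^sub>n\<close> dominate the remainders after them. Kolmogorov's
  argument, which compares the exponential moment at three nearby parameters, bounds the
  conditional probability of a large block sum from below by a multiple of \<open>1 / k\<close>
  (\<open>block_lower_tail\<close>). Iterating this conditional estimate shows that large block sums occur
  infinitely often.
\<close>

section \<open>Second-order estimates for the exponential\<close>

lemma exp_second_order:
  fixes z :: real
  assumes "\<bar>z\<bar> \<le> 1"
  shows "\<bar>exp z - (1 + z + z\<^sup>2 / 2)\<bar> \<le> z\<^sup>2 / 2 * \<bar>z\<bar>"
proof -
  obtain t where t: "\<bar>t\<bar> \<le> \<bar>z\<bar>" "exp z = (\<Sum>m<3. z ^ m / fact m) + exp t / fact 3 * z ^ 3"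
    using Maclaurin_exp_le[of z 3] by blast
  have "exp t \<le> exp 1" using t(1) assms by simp
  also have "\<dots> \<le> 3" by (rule exp_le)
  finally have e: "exp t / 6 \<le> 1 / 2" by simp
  have "exp z - (1 + z + z\<^sup>2 / 2) = exp t / 6 * z ^ 3"
    using t(2) by (simp add: eval_nat_numeral fact_numeral)
  then have "\<bar>exp z - (1 + z + z\<^sup>2 / 2)\<bar> = exp t / 6 * \<bar>z\<bar> ^ 3"
    by (simp only: abs_mult power_abs) simp
  also have "\<dots> \<le> 1 / 2 * \<bar>z\<bar> ^ 3"
    by (rule mult_right_mono[OF e]) simp
  also have "\<dots> = z\<^sup>2 / 2 * \<bar>z\<bar>"
    by (simp add: power3_eq_cube power2_eq_square abs_mult_self_eq)
  finally show ?thesis .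
qed

lemma exp_minus_second_order:
  fixes u :: real
  assumes "0 \<le> u"
  shows "\<bar>1 - u - exp (- u)\<bar> \<le> u\<^sup>2 / 2"
proof -
  have 1: "1 - u \<le> exp (- u)" using exp_ge_add_one_self[of "- u"] by simp
  obtain t where t: "\<bar>t\<bar> \<le> \<bar>- u\<bar>" "exp (- u) = (\<Sum>m<3. (- u) ^ m / fact m) + exp t / fact 3 * (- u) ^ 3"
    using Maclaurin_exp_le[of "- u" 3] by blast
  have "exp t / 6 * (- u) ^ 3 \<le> 0" using assms
    by (intro mult_nonneg_nonpos) (auto simp: power3_eq_cube mult_nonneg_nonneg)
  then have "exp (- u) \<le> 1 - u + u\<^sup>2 / 2"
    using t(2) by (simp add: eval_nat_numeral fact_numeral)
  then show ?thesis using 1 by auto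
qed

section \<open>Bounded martingale differences\<close>

text \<open>
  The variable \<open>s n\<close> is the conditional variance of the increment \<open>\<xi> n\<close> given \<open>F n\<close>. The
  bounds \<open>c n\<close> hold at every point, so that exponentials of finite sums of increments are bounded and
  their integrability is automatic.
\<close>

locale bounded_martingale_differences = prob_space M
  for M :: "'a measure" and F :: "nat \<Rightarrow> 'a measure" and \<xi> s :: "nat \<Rightarrow> 'a \<Rightarrow> real"
    and c :: "nat \<Rightarrow> real" +
  assumes subalg: "\<And>n. subalgebra M (F n)"
    and filtration: "\<And>m n. m \<le> n \<Longrightarrow> sets (F m) \<subseteq> sets (F n)"
    and incr_meas: "\<And>n. \<xi> n \<in> borel_measurable (F (Suc n))"
    and var_meas: "\<And>n. s n \<in> borel_measurable (F n)"
    and incr_bound: "\<And>n w. w \<in> space M \<Longrightarrow> \<bar>\<xi> n w\<bar> \<le> c n"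
    and centred: "\<And>n. AE w in M. real_cond_exp M (F n) (\<xi> n) w = 0"
    and cond_var: "\<And>n. AE w in M. real_cond_exp M (F n) (\<lambda>w. (\<xi> n w)\<^sup>2) w = s n w"
begin

text \<open>
  The test functions for the conditional statements: a conditional inequality is always expressed
  by integrating against an arbitrary function of this kind, which depends on the past only.
\<close>

definition bounded_adapted :: "nat \<Rightarrow> ('a \<Rightarrow> real) \<Rightarrow> bool" where
  "bounded_adapted n g \<longleftrightarrow>
     g \<in> borel_measurable (F n) \<and> (\<exists>B. \<forall>w\<in>space M. \<bar>g w\<bar> \<le> B)"

lemma space_F [simp]: "space (F n) = space M"
  using subalg[of n] by (simp add: subalgebra_def)

lemma sets_F_in_M: "A \<in> sets (F n) \<Longrightarrow> A \<in> sets M"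
  using subalg[of n] by (auto simp: subalgebra_def)

lemma meas_F_mono:
  "m \<le> n \<Longrightarrow> g \<in> borel_measurable (F m) \<Longrightarrow> g \<in> borel_measurable (F n)"
  by (rule measurable_from_subalg[of "F n" "F m"]) (auto simp: subalgebra_def dest: filtration)

lemma meas_F_M: "g \<in> borel_measurable (F n) \<Longrightarrow> g \<in> borel_measurable M"
  by (rule measurable_from_subalg[OF subalg])

lemma incr_meas_M [measurable]: "\<xi> n \<in> borel_measurable M"
  using incr_meas meas_F_M by blast

lemma var_meas_M [measurable]: "s n \<in> borel_measurable M"
  using var_meas meas_F_M by blast

lemma bounded_adaptedI:
  "g \<in> borel_measurable (F n) \<Longrightarrow> (\<And>w. w \<in> space M \<Longrightarrow> \<bar>g w\<bar> \<le> B) \<Longrightarrow> bounded_adapted n g"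
  by (auto simp: bounded_adapted_def)

lemma bounded_adapted_meas: "bounded_adapted n g \<Longrightarrow> g \<in> borel_measurable (F n)"
  by (simp add: bounded_adapted_def)

lemma bounded_adapted_meas_M: "bounded_adapted n g \<Longrightarrow> g \<in> borel_measurable M"
  by (auto simp: bounded_adapted_def intro: meas_F_M)

lemma bounded_adapted_integrable:
  assumes "bounded_adapted n g"
  shows "integrable M g"
proof -
  obtain B where "\<And>w. w \<in> space M \<Longrightarrow> \<bar>g w\<bar> \<le> B"
    using assms by (auto simp: bounded_adapted_def)
  then show ?thesis
    by (intro integrable_const_bound[of _ B] bounded_adapted_meas_M[OF assms]) auto
qed

lemma bounded_adapted_mono:
  "bounded_adapted m g \<Longrightarrow> m \<le> n \<Longrightarrow> bounded_adapted n g"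
  by (auto simp: bounded_adapted_def intro: meas_F_mono)

lemma bounded_adapted_const: "bounded_adapted n (\<lambda>_. k)"
  by (rule bounded_adaptedI[of _ _ "\<bar>k\<bar>"]) auto

lemma bounded_adapted_add:
  assumes "bounded_adapted n f" "bounded_adapted n g"
  shows "bounded_adapted n (\<lambda>w. f w + g w)"
proof -
  obtain A B where "\<And>w. w \<in> space M \<Longrightarrow> \<bar>f w\<bar> \<le> A" "\<And>w. w \<in> space M \<Longrightarrow> \<bar>g w\<bar> \<le> B"
    using assms by (auto simp: bounded_adapted_def)
  then show ?thesis
    using assms[THEN bounded_adapted_meas]
    by (intro bounded_adaptedI[of _ _ "A + B"])
       (auto intro: order_trans[OF abs_triangle_ineq] add_mono)
qed

lemma bounded_adapted_mult:
  assumes "bounded_adapted n f" "bounded_adapted n g"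
  shows "bounded_adapted n (\<lambda>w. f w * g w)"
proof -
  obtain A B where "\<And>w. w \<in> space M \<Longrightarrow> \<bar>f w\<bar> \<le> A" "\<And>w. w \<in> space M \<Longrightarrow> \<bar>g w\<bar> \<le> B"
    using assms by (auto simp: bounded_adapted_def)
  then show ?thesis
    using assms[THEN bounded_adapted_meas]
    by (intro bounded_adaptedI[of _ _ "\<bar>A\<bar> * \<bar>B\<bar>"])
       (auto simp: abs_mult intro!: mult_mono intro: order_trans[OF _ abs_ge_self])
qed

lemma bounded_adapted_exp:
  assumes "bounded_adapted n f"
  shows "bounded_adapted n (\<lambda>w. exp (f w))"
proof -
  obtain A where "\<And>w. w \<in> space M \<Longrightarrow> \<bar>f w\<bar> \<le> A"
    using assms by (auto simp: bounded_adapted_def)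
  then show ?thesis
    using assms[THEN bounded_adapted_meas]
    by (intro bounded_adaptedI[of _ _ "exp A"]) (auto dest: abs_le_D1)
qed

lemma bounded_adapted_if:
  assumes "{w \<in> space M. P w} \<in> sets (F n)" "bounded_adapted n f" "bounded_adapted n g"
  shows "bounded_adapted n (\<lambda>w. if P w then f w else g w)"
proof -
  obtain A B where "\<And>w. w \<in> space M \<Longrightarrow> \<bar>f w\<bar> \<le> A" "\<And>w. w \<in> space M \<Longrightarrow> \<bar>g w\<bar> \<le> B"
    using assms(2,3) by (auto simp: bounded_adapted_def)
  then show ?thesis
    using assms(2,3)[THEN bounded_adapted_meas] assms(1)
    by (intro bounded_adaptedI[of _ _ "max A B"] measurable_If) (auto simp: le_max_iff_disj)
qed

lemma bounded_adapted_incr: "n < m \<Longrightarrow> bounded_adapted m (\<xi> n)"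
  by (rule bounded_adapted_mono[of "Suc n"])
     (auto intro!: bounded_adaptedI[of _ _ "c n"] incr_meas incr_bound)

lemma bounded_adapted_sum:
  assumes "\<And>i. i \<in> I \<Longrightarrow> bounded_adapted n (f i)"
  shows "bounded_adapted n (\<lambda>w. \<Sum>i\<in>I. f i w)"
  using assms
  by (induction I rule: infinite_finite_induct)
     (auto intro: bounded_adapted_const bounded_adapted_add)

lemmas bounded_adapted_intros =
  bounded_adapted_const bounded_adapted_add bounded_adapted_mult bounded_adapted_exp
  bounded_adapted_if bounded_adapted_incr bounded_adapted_sum

lemma c_nonneg: "0 \<le> c n"
proof -
  obtain w where "w \<in> space M" using not_empty by auto
  then show ?thesis using incr_bound[of w n] by linarith
qed

lemma finite_subalgebra: "finite_measure_subalgebra M (F n)"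
  using subalg by (unfold_locales) auto

lemma incr_sq_le: "w \<in> space M \<Longrightarrow> (\<xi> n w)\<^sup>2 \<le> (c n)\<^sup>2"
  using incr_bound[of w n] c_nonneg[of n] by (metis abs_le_square_iff abs_of_nonneg)

lemma integrable_incr_sq: "integrable M (\<lambda>w. (\<xi> n w)\<^sup>2)"
  by (rule bounded_adapted_integrable[of "Suc n"])
     (auto simp: power2_eq_square intro!: bounded_adapted_intros)

lemma integral_mult_incr:
  assumes "bounded_adapted n g"
  shows "(\<integral>w. g w * \<xi> n w \<partial>M) = 0"
proof -
  interpret sub: finite_measure_subalgebra M "F n" by (rule finite_subalgebra)
  have "bounded_adapted (Suc n) (\<lambda>w. g w * \<xi> n w)"
    by (intro bounded_adapted_intros bounded_adapted_mono[OF assms]) auto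
  then have "(\<integral>w. g w * \<xi> n w \<partial>M) = (\<integral>w. g w * real_cond_exp M (F n) (\<xi> n) w \<partial>M)"
    using assms by (intro sub.real_cond_exp_intg(2)[symmetric])
      (auto intro: bounded_adapted_integrable bounded_adapted_meas)
  also have "\<dots> = (\<integral>w. 0 \<partial>M)"
    using centred[of n] bounded_adapted_meas_M[OF assms]
    by (intro integral_cong_AE) auto
  finally show ?thesis by simp
qed

lemma mult_incr_sq:
  assumes "bounded_adapted n g"
  shows "integrable M (\<lambda>w. g w * s n w)"
    "(\<integral>w. g w * (\<xi> n w)\<^sup>2 \<partial>M) = (\<integral>w. g w * s n w \<partial>M)"
proof -
  interpret sub: finite_measure_subalgebra M "F n" by (rule finite_subalgebra)
  have "bounded_adapted (Suc n) (\<lambda>w. g w * (\<xi> n w * \<xi> n w))"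
    by (intro bounded_adapted_intros bounded_adapted_mono[OF assms]) auto
  then have i: "integrable M (\<lambda>w. g w * (\<xi> n w)\<^sup>2)"
    by (auto simp: power2_eq_square intro: bounded_adapted_integrable)
  have [measurable]: "g \<in> borel_measurable M" by (rule bounded_adapted_meas_M[OF assms])
  note * = sub.real_cond_exp_intg[OF i bounded_adapted_meas[OF assms]]
  have eq: "AE w in M. g w * real_cond_exp M (F n) (\<lambda>w. (\<xi> n w)\<^sup>2) w = g w * s n w"
    using cond_var[of n] by auto
  show "integrable M (\<lambda>w. g w * s n w)"
    by (rule integrable_cong_AE_imp[OF *(1)]) (use eq in auto)
  show "(\<integral>w. g w * (\<xi> n w)\<^sup>2 \<partial>M) = (\<integral>w. g w * s n w \<partial>M)"
    by (subst *(2)[symmetric]) (auto intro!: integral_cong_AE eq)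
qed

lemma var_integrable: "integrable M (s n)"
  using mult_incr_sq(1)[OF bounded_adapted_const[of n 1]] by simp

lemma var_bounds: "AE w in M. 0 \<le> s n w \<and> s n w \<le> (c n)\<^sup>2"
proof -
  interpret sub: finite_measure_subalgebra M "F n" by (rule finite_subalgebra)
  have "AE w in M. real_cond_exp M (F n) (\<lambda>w. (\<xi> n w)\<^sup>2) w \<ge> 0"
    by (intro sub.real_cond_exp_pos) auto
  moreover have "AE w in M. real_cond_exp M (F n) (\<lambda>w. (\<xi> n w)\<^sup>2) w \<le> (c n)\<^sup>2"
    by (intro sub.real_cond_exp_le_c integrable_incr_sq) (auto intro: incr_sq_le)
  ultimately show ?thesis using cond_var[of n] by auto
qed

text \<open>
  By the second-order expansion, \<open>exp (\<theta> \<xi>)\<close> is at most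
  \<open>1 + \<theta> \<xi> + \<theta>\<^sup>2 \<xi>\<^sup>2 (1 + y) / 2\<close>; the linear term has conditional mean 0 and \<open>\<xi>\<^sup>2\<close> may be replaced
  by \<open>s n\<close>. The bound on \<open>s n\<close> is required only where the test function does not vanish: this is how
  atypical conditional variances are excluded later.
\<close>

lemma exp_incr_upper:
  assumes g: "bounded_adapted n g" "\<And>w. w \<in> space M \<Longrightarrow> 0 \<le> g w"
    and \<sigma>: "\<And>w. w \<in> space M \<Longrightarrow> g w \<noteq> 0 \<Longrightarrow> s n w \<le> \<sigma>"
    and y: "\<bar>\<theta>\<bar> * c n \<le> y" "y \<le> 1"
  shows "(\<integral>w. g w * exp (\<theta> * \<xi> n w) \<partial>M) \<le> exp (\<theta>\<^sup>2 / 2 * (1 + y) * \<sigma>) * (\<integral>w. g w \<partial>M)"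
proof -
  have "0 \<le> \<bar>\<theta>\<bar> * c n" using c_nonneg[of n] by simp
  then have y0: "0 \<le> y" using y by linarith
  have g1: "bounded_adapted (Suc n) g" using g(1) by (rule bounded_adapted_mono) simp
  define k where "k = \<theta>\<^sup>2 / 2 * (1 + y)"
  have k0: "0 \<le> k" using y0 by (simp add: k_def)
  have sq: "integrable M (\<lambda>w. g w * (\<xi> n w)\<^sup>2)"
    by (rule bounded_adapted_integrable[of "Suc n"])
       (auto simp: power2_eq_square intro!: bounded_adapted_intros g1)
  have gx: "integrable M (\<lambda>w. g w * \<xi> n w)"
    by (rule bounded_adapted_integrable[of "Suc n"])
       (auto intro!: bounded_adapted_intros g1)
  have ge: "integrable M (\<lambda>w. g w * exp (\<theta> * \<xi> n w))"
    by (rule bounded_adapted_integrable[of "Suc n"])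
       (auto intro!: bounded_adapted_intros g1)
  have gi: "integrable M g" by (rule bounded_adapted_integrable[OF g(1)])
  have "(\<integral>w. g w * exp (\<theta> * \<xi> n w) \<partial>M)
      \<le> (\<integral>w. g w + \<theta> * (g w * \<xi> n w) + k * (g w * (\<xi> n w)\<^sup>2) \<partial>M)"
  proof (rule integral_mono[OF ge])
    fix w assume w: "w \<in> space M"
    let ?z = "\<theta> * \<xi> n w"
    have z: "\<bar>?z\<bar> \<le> y"
      using mult_left_mono[OF incr_bound[OF w, of n], of "\<bar>\<theta>\<bar>"] y(1) by (simp add: abs_mult)
    then have "exp ?z - (1 + ?z + ?z\<^sup>2 / 2) \<le> ?z\<^sup>2 / 2 * \<bar>?z\<bar>"
      using exp_second_order[of ?z] y(2) by linarith
    also have "\<dots> \<le> ?z\<^sup>2 / 2 * y" using z by (intro mult_left_mono) auto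
    finally have "exp ?z \<le> 1 + ?z + k * (\<xi> n w)\<^sup>2"
      by (simp add: k_def power_mult_distrib field_simps)
    from mult_left_mono[OF this g(2)[OF w]]
    show "g w * exp ?z \<le> g w + \<theta> * (g w * \<xi> n w) + k * (g w * (\<xi> n w)\<^sup>2)"
      by (simp add: algebra_simps)
  qed (use gi gx sq in auto)
  also have "\<dots> = (\<integral>w. g w \<partial>M) + k * (\<integral>w. g w * s n w \<partial>M)"
    using gi gx sq by (simp add: integral_mult_incr[OF g(1)] mult_incr_sq(2)[OF g(1)])
  also have "\<dots> \<le> (\<integral>w. g w \<partial>M) + k * (\<integral>w. g w * \<sigma> \<partial>M)"
  proof (intro add_left_mono mult_left_mono[OF _ k0] integral_mono mult_incr_sq(1)[OF g(1)])
    show "g w * s n w \<le> g w * \<sigma>" if "w \<in> space M" for w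
      using \<sigma>[OF that] g(2)[OF that] by (cases "g w = 0") (auto intro: mult_left_mono)
  qed (use gi in auto)
  also have "\<dots> = (1 + k * \<sigma>) * (\<integral>w. g w \<partial>M)" by (simp add: algebra_simps)
  also have "\<dots> \<le> exp (k * \<sigma>) * (\<integral>w. g w \<partial>M)"
    using g(2) by (intro mult_right_mono exp_ge_add_one_self Bochner_Integration.integral_nonneg) auto
  finally show ?thesis by (simp add: k_def)
qed

text \<open>
  The counterpart of the preceding bound. One factor \<open>1 - y\<close> comes from the expansion of the
  exponential and one from turning \<open>1 + u\<close> into \<open>exp (u - u\<^sup>2)\<close>.
\<close>

lemma exp_incr_lower:
  assumes g: "bounded_adapted n g" "\<And>w. w \<in> space M \<Longrightarrow> 0 \<le> g w"
    and \<sigma>: "\<And>w. w \<in> space M \<Longrightarrow> g w \<noteq> 0 \<Longrightarrow> \<sigma> \<le> s n w" "0 \<le> \<sigma>"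
    and y: "\<bar>\<theta>\<bar> * c n \<le> y" "\<theta>\<^sup>2 / 2 * \<sigma> \<le> y" "y \<le> 1"
  shows "exp (\<theta>\<^sup>2 / 2 * (1 - 2 * y) * \<sigma>) * (\<integral>w. g w \<partial>M) \<le> (\<integral>w. g w * exp (\<theta> * \<xi> n w) \<partial>M)"
proof -
  have "0 \<le> \<bar>\<theta>\<bar> * c n" using c_nonneg[of n] by simp
  then have y0: "0 \<le> y" using y by linarith
  have g1: "bounded_adapted (Suc n) g" using g(1) by (rule bounded_adapted_mono) simp
  define k where "k = \<theta>\<^sup>2 / 2 * (1 - y)"
  have k0: "0 \<le> k" using y(3) by (simp add: k_def)
  have sq: "integrable M (\<lambda>w. g w * (\<xi> n w)\<^sup>2)"
    by (rule bounded_adapted_integrable[of "Suc n"])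
       (auto simp: power2_eq_square intro!: bounded_adapted_intros g1)
  have gx: "integrable M (\<lambda>w. g w * \<xi> n w)"
    by (rule bounded_adapted_integrable[of "Suc n"])
       (auto intro!: bounded_adapted_intros g1)
  have ge: "integrable M (\<lambda>w. g w * exp (\<theta> * \<xi> n w))"
    by (rule bounded_adapted_integrable[of "Suc n"])
       (auto intro!: bounded_adapted_intros g1)
  have gi: "integrable M g" by (rule bounded_adapted_integrable[OF g(1)])
  define u where "u = k * \<sigma>"
  have u0: "0 \<le> u" using k0 \<sigma>(2) by (simp add: u_def)
  have "u \<le> \<theta>\<^sup>2 / 2 * \<sigma>" unfolding u_def k_def using y0 \<sigma>(2)
    by (intro mult_right_mono) (auto simp: algebra_simps)
  then have uy: "u \<le> y" using y(2) by simp
  have "\<theta>\<^sup>2 / 2 * (1 - 2 * y) * \<sigma> \<le> (1 - y) * u"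
  proof -
    have "\<theta>\<^sup>2 / 2 * \<sigma> * (1 - 2 * y) \<le> \<theta>\<^sup>2 / 2 * \<sigma> * (1 - y)\<^sup>2"
      using \<sigma>(2) by (intro mult_left_mono) (auto simp: power2_eq_square algebra_simps)
    then show ?thesis by (simp add: u_def k_def power2_eq_square mult_ac)
  qed
  also have "\<dots> \<le> u - u\<^sup>2" using mult_left_mono[OF uy u0] by (simp add: algebra_simps power2_eq_square)
  also have "\<dots> \<le> ln (1 + u)" using u0 uy y(3) by (intro ln_one_plus_pos_lower_bound) auto
  finally have "exp (\<theta>\<^sup>2 / 2 * (1 - 2 * y) * \<sigma>) \<le> 1 + u"
    using u0 by (subst (asm) ln_ge_iff) auto
  then have "exp (\<theta>\<^sup>2 / 2 * (1 - 2 * y) * \<sigma>) * (\<integral>w. g w \<partial>M) \<le> (1 + k * \<sigma>) * (\<integral>w. g w \<partial>M)"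
    unfolding u_def using g(2) by (intro mult_right_mono Bochner_Integration.integral_nonneg) auto
  also have "\<dots> = (\<integral>w. g w \<partial>M) + k * (\<integral>w. g w * \<sigma> \<partial>M)" by (simp add: algebra_simps)
  also have "\<dots> \<le> (\<integral>w. g w \<partial>M) + k * (\<integral>w. g w * s n w \<partial>M)"
  proof (intro add_left_mono mult_left_mono[OF _ k0] integral_mono mult_incr_sq(1)[OF g(1)])
    show "g w * \<sigma> \<le> g w * s n w" if "w \<in> space M" for w
      using \<sigma>(1)[OF that] g(2)[OF that] by (cases "g w = 0") (auto intro: mult_left_mono)
  qed (use gi in auto)
  also have "\<dots> = (\<integral>w. g w + \<theta> * (g w * \<xi> n w) + k * (g w * (\<xi> n w)\<^sup>2) \<partial>M)"
    using gi gx sq by (simp add: integral_mult_incr[OF g(1)] mult_incr_sq(2)[OF g(1)])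
  also have "\<dots> \<le> (\<integral>w. g w * exp (\<theta> * \<xi> n w) \<partial>M)"
  proof (rule integral_mono[OF _ ge])
    fix w assume w: "w \<in> space M"
    let ?z = "\<theta> * \<xi> n w"
    have z: "\<bar>?z\<bar> \<le> y"
      using mult_left_mono[OF incr_bound[OF w, of n], of "\<bar>\<theta>\<bar>"] y(1) by (simp add: abs_mult)
    then have "(1 + ?z + ?z\<^sup>2 / 2) - exp ?z \<le> ?z\<^sup>2 / 2 * \<bar>?z\<bar>"
      using exp_second_order[of ?z] y(3) by linarith
    also have "\<dots> \<le> ?z\<^sup>2 / 2 * y" using z by (intro mult_left_mono) auto
    finally have "1 + ?z + k * (\<xi> n w)\<^sup>2 \<le> exp ?z"
      by (simp add: k_def power_mult_distrib field_simps)
    from mult_left_mono[OF this g(2)[OF w]]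
    show "g w + \<theta> * (g w * \<xi> n w) + k * (g w * (\<xi> n w)\<^sup>2) \<le> g w * exp ?z"
      by (simp add: algebra_simps)
  qed (use gi gx sq in auto)
  finally show ?thesis .
qed

text \<open>
  One step of Lindeberg's replacement argument: in the characteristic function, a martingale
  increment is exchanged for a Gaussian of variance \<open>v\<close>. The error has a third-moment part,
  a part from the deviation of the conditional variance from \<open>v\<close> and a fourth-order
  part.
\<close>

lemma iexp_incr:
  fixes h :: "'a \<Rightarrow> complex"
  assumes h: "bounded_adapted n (\<lambda>w. Re (h w))" "bounded_adapted n (\<lambda>w. Im (h w))"
    and h1: "\<And>w. w \<in> space M \<Longrightarrow> cmod (h w) \<le> 1"
    and v: "0 \<le> v"
  defines "e \<equiv> (\<integral>w. \<bar>s n w - v\<bar> \<partial>M)"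
  shows "cmod ((\<integral>w. h w * iexp (\<tau> * \<xi> n w) \<partial>M) - complex_of_real (exp (- (\<tau>\<^sup>2 * v / 2))) * (\<integral>w. h w \<partial>M))
    \<le> \<bar>\<tau>\<bar> ^ 3 * c n * (v + e) + \<tau>\<^sup>2 * e + \<tau> ^ 4 * v\<^sup>2"
proof -
  have [measurable]: "(\<lambda>w. Re (h w)) \<in> borel_measurable M" "(\<lambda>w. Im (h w)) \<in> borel_measurable M"
    using h by (auto intro: bounded_adapted_meas_M)
  have [measurable]: "h \<in> borel_measurable M"
    by (subst borel_measurable_complex_iff) auto
  have hi: "integrable M h"
    by (rule integrable_const_bound[of _ 1]) (use h1 in auto)
  have hX: "integrable M (\<lambda>w. h w * \<xi> n w)" "(\<integral>w. h w * \<xi> n w \<partial>M) = 0"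
  proof -
    show i: "integrable M (\<lambda>w. h w * \<xi> n w)"
    proof (rule integrable_const_bound[of _ "1 * c n"])
      show "AE w in M. cmod (h w * \<xi> n w) \<le> 1 * c n"
        by (rule AE_I2) (use mult_mono[OF h1 incr_bound[where n=n]] in \<open>auto simp: norm_mult\<close>)
    qed auto
    show "(\<integral>w. h w * \<xi> n w \<partial>M) = 0"
      using integral_mult_incr[OF h(1)] integral_mult_incr[OF h(2)]
      by (intro complex_eqI) (simp_all add: integral_Re[OF i, symmetric] integral_Im[OF i, symmetric])
  qed
  have hS: "integrable M (\<lambda>w. h w * s n w)"
    by (rule Bochner_Integration.integrable_bound[OF var_integrable[of n]])
       (use h1 in \<open>auto simp: norm_mult intro!: mult_left_le_one_le\<close>)
  have hX2: "integrable M (\<lambda>w. h w * (\<xi> n w)\<^sup>2)" "(\<integral>w. h w * (\<xi> n w)\<^sup>2 \<partial>M) = (\<integral>w. h w * s n w \<partial>M)"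
  proof -
    show i: "integrable M (\<lambda>w. h w * (\<xi> n w)\<^sup>2)"
    proof (rule integrable_const_bound[of _ "1 * (c n)\<^sup>2"])
      show "AE w in M. cmod (h w * (\<xi> n w)\<^sup>2) \<le> 1 * (c n)\<^sup>2"
        by (rule AE_I2) (use mult_mono[OF h1 incr_sq_le[where n=n]] in \<open>auto simp: norm_mult norm_power\<close>)
    qed auto
    show "(\<integral>w. h w * (\<xi> n w)\<^sup>2 \<partial>M) = (\<integral>w. h w * s n w \<partial>M)"
      using mult_incr_sq(2)[OF h(1)] mult_incr_sq(2)[OF h(2)]
      by (intro complex_eqI)
         (simp_all add: integral_Re[OF i, symmetric] integral_Im[OF i, symmetric]
            integral_Re[OF hS, symmetric] integral_Im[OF hS, symmetric] flip: of_real_power)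
  qed
  have hE: "integrable M (\<lambda>w. h w * iexp (\<tau> * \<xi> n w))"
    by (rule integrable_const_bound[of _ 1]) (use h1 in \<open>auto simp: norm_mult\<close>)
  have ei: "integrable M (\<lambda>w. \<bar>s n w - v\<bar>)" using var_integrable[of n] by auto
  have e0: "0 \<le> e" unfolding e_def by (rule Bochner_Integration.integral_nonneg) auto
  define R where "R w = iexp (\<tau> * \<xi> n w) - (1 + \<i> * \<tau> * \<xi> n w - \<tau>\<^sup>2 / 2 * (\<xi> n w)\<^sup>2)" for w
  have R: "cmod (R w) \<le> \<bar>\<tau>\<bar> ^ 3 * c n * (\<xi> n w)\<^sup>2" if w: "w \<in> space M" for w
  proof -
    have "(\<Sum>k\<le>2. (\<i> * complex_of_real (\<tau> * \<xi> n w)) ^ k / fact k)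
        = 1 + \<i> * \<tau> * \<xi> n w - \<tau>\<^sup>2 / 2 * (\<xi> n w)\<^sup>2"
      by (simp add: eval_nat_numeral fact_numeral algebra_simps)
    then have "cmod (R w) \<le> \<bar>\<tau> * \<xi> n w\<bar> ^ 3 / fact 3"
      using iexp_approx1[of "\<tau> * \<xi> n w" 2] by (simp add: R_def numeral_3_eq_3)
    also have "\<dots> \<le> \<bar>\<tau> * \<xi> n w\<bar> ^ 3" using zero_le_power[of "\<bar>\<tau> * \<xi> n w\<bar>" 3] by (simp add: fact_numeral)
    also have "\<dots> = \<bar>\<tau>\<bar> ^ 3 * (\<bar>\<xi> n w\<bar> * (\<xi> n w)\<^sup>2)"
      by (simp only: abs_mult power_mult_distrib) (simp add: eval_nat_numeral)
    also have "\<dots> \<le> \<bar>\<tau>\<bar> ^ 3 * (c n * (\<xi> n w)\<^sup>2)"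
      using incr_bound[OF w] by (intro mult_left_mono mult_right_mono) auto
    finally show ?thesis by (simp add: mult_ac)
  qed
  have [measurable]: "R \<in> borel_measurable M" unfolding R_def by measurable
  have hR_i: "integrable M (\<lambda>w. h w * R w)"
  proof -
    have "(\<lambda>w. h w * R w) = (\<lambda>w. h w * iexp (\<tau> * \<xi> n w) - (h w + \<i> * \<tau> * (h w * \<xi> n w)
       - \<tau>\<^sup>2 / 2 * (h w * (\<xi> n w)\<^sup>2)))" by (auto simp: R_def algebra_simps)
    then show ?thesis using hi hX hX2 hE by auto
  qed
  have hR: "cmod (\<integral>w. h w * R w \<partial>M) \<le> \<bar>\<tau>\<bar> ^ 3 * c n * (v + e)"
  proof -
    have "cmod (\<integral>w. h w * R w \<partial>M) \<le> (\<integral>w. \<bar>\<tau>\<bar> ^ 3 * c n * (\<xi> n w)\<^sup>2 \<partial>M)"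
    proof (rule order_trans[OF integral_norm_bound integral_mono])
      show "cmod (h w * R w) \<le> \<bar>\<tau>\<bar> ^ 3 * c n * (\<xi> n w)\<^sup>2" if "w \<in> space M" for w
        using mult_mono[OF h1[OF that] R[OF that]] c_nonneg[of n] by (simp add: norm_mult)
    qed (use hR_i integrable_incr_sq in auto)
    then have 1: "cmod (\<integral>w. h w * R w \<partial>M) \<le> \<bar>\<tau>\<bar> ^ 3 * c n * (\<integral>w. s n w \<partial>M)"
      using mult_incr_sq(2)[OF bounded_adapted_const[of n 1]] by simp
    have "(\<integral>w. s n w \<partial>M) \<le> (\<integral>w. v + \<bar>s n w - v\<bar> \<partial>M)"
      using var_integrable[of n] by (intro integral_mono) auto
    also have "\<dots> = v + e" using ei by (simp add: e_def prob_space)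
    finally have "(\<integral>w. s n w \<partial>M) \<le> v + e" .
    then show ?thesis
      using c_nonneg[of n] by (intro order_trans[OF 1] mult_left_mono) auto
  qed
  have hV: "cmod (\<integral>w. h w * of_real (s n w - v) \<partial>M) \<le> e"
    unfolding e_def
  proof (rule order_trans[OF integral_norm_bound integral_mono])
    have "(\<lambda>w. h w * of_real (s n w - v)) = (\<lambda>w. h w * s n w - h w * v)"
      by (auto simp: algebra_simps)
    then show "integrable M (\<lambda>w. cmod (h w * of_real (s n w - v)))" using hi hS by auto
    show "cmod (h w * of_real (s n w - v)) \<le> \<bar>s n w - v\<bar>" if "w \<in> space M" for w
      using h1[OF that] by (simp add: norm_mult mult_left_le_one_le del: of_real_diff)
  qed (use ei in auto)
  have hI: "cmod (\<integral>w. h w \<partial>M) \<le> 1"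
    using order_trans[OF integral_norm_bound integral_mono[of M "\<lambda>w. cmod (h w)" "\<lambda>_. 1"]] hi h1
    by (simp add: prob_space)
  define q where "q = 1 - \<tau>\<^sup>2 * v / 2 - exp (- (\<tau>\<^sup>2 * v / 2))"
  have "\<bar>q\<bar> \<le> (\<tau>\<^sup>2 * v / 2)\<^sup>2 / 2"
    unfolding q_def using v by (intro exp_minus_second_order) auto
  also have "\<dots> \<le> (\<tau>\<^sup>2 * v)\<^sup>2" by (simp add: power_divide)
  also have "\<dots> = \<tau> ^ 4 * v\<^sup>2" by (simp add: power_mult_distrib flip: power_mult)
  finally have q: "\<bar>q\<bar> \<le> \<tau> ^ 4 * v\<^sup>2" .
  have "(\<integral>w. h w * iexp (\<tau> * \<xi> n w) \<partial>M)
     = (\<integral>w. h w * R w + (h w + \<i> * \<tau> * (h w * \<xi> n w) - \<tau>\<^sup>2 / 2 * (h w * (\<xi> n w)\<^sup>2)) \<partial>M)"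
    by (auto simp: R_def algebra_simps intro!: Bochner_Integration.integral_cong)
  also have "\<dots> = (\<integral>w. h w * R w \<partial>M) + ((\<integral>w. h w \<partial>M) - \<tau>\<^sup>2 / 2 * (\<integral>w. h w * s n w \<partial>M))"
    using hR_i hi hX hX2 by simp
  also have "(\<integral>w. h w * s n w \<partial>M) = (\<integral>w. h w * of_real (s n w - v) \<partial>M) + (\<integral>w. h w \<partial>M) * v"
  proof -
    have "(\<integral>w. h w * s n w \<partial>M) = (\<integral>w. (h w * s n w - h w * v) + h w * v \<partial>M)" by simp
    also have "\<dots> = (\<integral>w. h w * s n w - h w * v \<partial>M) + (\<integral>w. h w * v \<partial>M)"
      by (rule Bochner_Integration.integral_add) (use hS hi in auto)
    finally show ?thesis by (simp add: algebra_simps)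
  qed
  finally have eq: "(\<integral>w. h w * iexp (\<tau> * \<xi> n w) \<partial>M) - complex_of_real (exp (- (\<tau>\<^sup>2 * v / 2))) * (\<integral>w. h w \<partial>M)
     = (\<integral>w. h w * R w \<partial>M) - of_real (\<tau>\<^sup>2 / 2) * (\<integral>w. h w * of_real (s n w - v) \<partial>M)
       + of_real q * (\<integral>w. h w \<partial>M)" (is "?L = ?A - ?B + ?C")
    unfolding q_def by (simp add: algebra_simps del: of_real_exp)
  have B: "cmod ?B \<le> \<tau>\<^sup>2 * e"
  proof -
    have "cmod ?B \<le> \<tau>\<^sup>2 / 2 * e"
      unfolding norm_mult using hV by (intro mult_mono) (auto simp: norm_power)
    also have "\<dots> \<le> \<tau>\<^sup>2 * e" using e0 by simp
    finally show ?thesis .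
  qed
  have C: "cmod ?C \<le> \<tau> ^ 4 * v\<^sup>2"
    using mult_mono[OF q hI] by (simp add: norm_mult)
  show ?thesis
    unfolding eq using hR B C norm_triangle_ineq[of "?A - ?B" ?C] norm_triangle_ineq4[of ?A ?B]
    by linarith
qed

end

section \<open>A maximal inequality with truncated conditional variances\<close>

context bounded_martingale_differences
begin

text \<open>
  Dropping an increment whenever its conditional variance exceeds \<open>\<sigma> j\<close> is a predictable operation, so
  the sum remains a martingale, now with a deterministic bound on the conditional variances.
\<close>

definition truncated :: "(nat \<Rightarrow> real) \<Rightarrow> nat \<Rightarrow> 'a \<Rightarrow> real" where
  "truncated \<sigma> j w = (if s j w \<le> \<sigma> j then \<xi> j w else 0)"

lemma var_level_set: "{w \<in> space M. s j w \<le> k} \<in> sets (F j)"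
  using var_meas[of j] by (auto simp: borel_measurable_iff_le)

lemma truncated_adapted: "j < n \<Longrightarrow> bounded_adapted n (truncated \<sigma> j)"
  unfolding truncated_def using filtration[of j n] var_level_set[of j "\<sigma> j"]
  by (intro bounded_adapted_intros) auto

lemma exp_truncated_upper:
  assumes g: "bounded_adapted n g" "\<And>w. w \<in> space M \<Longrightarrow> 0 \<le> g w"
    and y: "\<bar>\<theta>\<bar> * c n \<le> y" "y \<le> 1" and \<sigma>: "0 \<le> \<sigma> n"
  shows "(\<integral>w. g w * exp (\<theta> * truncated \<sigma> n w) \<partial>M) \<le> exp (\<theta>\<^sup>2 / 2 * (1 + y) * \<sigma> n) * (\<integral>w. g w \<partial>M)"
proof -
  define k where "k = exp (\<theta>\<^sup>2 / 2 * (1 + y) * \<sigma> n)"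
  have "0 \<le> \<bar>\<theta>\<bar> * c n" using c_nonneg[of n] by simp
  then have "0 \<le> y" using y by linarith
  then have k1: "1 \<le> k" using \<sigma> by (simp add: k_def)
  define a where "a w = (if s n w \<le> \<sigma> n then g w else 0)" for w
  define b where "b w = (if s n w \<le> \<sigma> n then 0 else g w)" for w
  have ba: "bounded_adapted n a" "bounded_adapted n b" unfolding a_def b_def
    by (intro bounded_adapted_intros var_level_set g)+
  have i: "integrable M (\<lambda>w. a w * exp (\<theta> * \<xi> n w))"
    by (rule bounded_adapted_integrable[of "Suc n"])
       (auto intro!: bounded_adapted_intros bounded_adapted_mono[OF ba(1)])
  note ia = bounded_adapted_integrable[OF ba(1)] and ib = bounded_adapted_integrable[OF ba(2)]
  have "(\<integral>w. g w * exp (\<theta> * truncated \<sigma> n w) \<partial>M) = (\<integral>w. a w * exp (\<theta> * \<xi> n w) + b w \<partial>M)"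
    by (intro Bochner_Integration.integral_cong) (auto simp: a_def b_def truncated_def)
  also have "\<dots> = (\<integral>w. a w * exp (\<theta> * \<xi> n w) \<partial>M) + (\<integral>w. b w \<partial>M)"
    by (intro Bochner_Integration.integral_add i ib)
  also have "\<dots> \<le> k * (\<integral>w. a w \<partial>M) + k * (\<integral>w. b w \<partial>M)"
  proof (intro add_mono)
    show "(\<integral>w. a w * exp (\<theta> * \<xi> n w) \<partial>M) \<le> k * (\<integral>w. a w \<partial>M)"
      unfolding k_def by (rule exp_incr_upper[OF ba(1)]) (use g(2) y in \<open>auto simp: a_def split: if_splits\<close>)
    have "0 \<le> (\<integral>w. b w \<partial>M)"
      using g(2) by (intro Bochner_Integration.integral_nonneg) (auto simp: b_def)
    then show "(\<integral>w. b w \<partial>M) \<le> k * (\<integral>w. b w \<partial>M)"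
      using mult_right_mono[OF k1] by simp
  qed
  also have "\<dots> = k * (\<integral>w. a w + b w \<partial>M)" using ia ib by (simp add: distrib_left)
  also have "(\<integral>w. a w + b w \<partial>M) = (\<integral>w. g w \<partial>M)"
    by (intro Bochner_Integration.integral_cong) (auto simp: a_def b_def)
  finally show ?thesis by (simp add: k_def)
qed

text \<open>
  Doob's maximal inequality for the supermartingale \<open>Z\<close>, the exponential of
  \<open>\<theta>\<close> times the partial sum minus its compensator. The invariant of the induction follows the
  supermartingale until the level \<open>x\<close> is reached and freezes it there: at that moment \<open>Z\<close> is at
  least \<open>L\<close>.
\<close>

lemma maximal_inequality_finite:
  assumes "n \<le> m" and \<theta>: "0 \<le> \<theta>" and y: "\<And>j. n \<le> j \<Longrightarrow> \<theta> * c j \<le> y" "y \<le> 1"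
    and \<sigma>: "\<And>j. 0 \<le> \<sigma> j" and x: "0 < x"
  shows "prob {w \<in> space M. \<exists>N\<in>{n..m}. x \<le> (\<Sum>j\<in>{n..<N}. truncated \<sigma> j w)}
    \<le> exp (- \<theta> * x + \<theta>\<^sup>2 / 2 * (1 + y) * (\<Sum>j\<in>{n..<m}. \<sigma> j))"
proof -
  define S where "S N w = (\<Sum>j\<in>{n..<N}. truncated \<sigma> j w)" for N w
  define q where "q N = \<theta>\<^sup>2 / 2 * (1 + y) * (\<Sum>j\<in>{n..<N}. \<sigma> j)" for N
  define Z where "Z N w = exp (\<theta> * S N w - q N)" for N w
  define L where "L = exp (\<theta> * x - q m)"
  define H where "H N w \<longleftrightarrow> (\<forall>i\<in>{n..N}. S i w < x)" for N w
  have "0 \<le> \<theta> * c n" using c_nonneg[of n] \<theta> by simp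
  then have y0: "0 \<le> y" using y(1)[of n] by linarith
  have S_ba: "bounded_adapted N (S i)" if "i \<le> N" for i N
    unfolding S_def using that by (intro bounded_adapted_intros truncated_adapted) auto
  have H_sets: "{w \<in> space M. H N w} \<in> sets (F N)" for N
  proof -
    have "{w \<in> space M. S i w < x} \<in> sets (F N)" if "i \<le> N" for i
      using bounded_adapted_meas[OF S_ba[OF that]] by (auto simp: borel_measurable_iff_less)
    then show ?thesis unfolding H_def
      using sets.sets_Collect_finite_All[of "{n..N}" "F N" "\<lambda>i w. S i w < x"] by auto
  qed
  have q_mono: "q i \<le> q N" if "i \<le> N" for i N
    unfolding q_def using y0 \<sigma> that by (intro mult_left_mono sum_mono2) auto
  have Z_ba: "bounded_adapted i (Z N)" if "N \<le> i" for N i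
    unfolding Z_def diff_conv_add_uminus using that by (intro bounded_adapted_intros S_ba) auto
  have HZ_ba: "bounded_adapted i (\<lambda>w. if H N w then Z N w else 0)" if "N \<le> i" for N i
    using bounded_adapted_mono[OF bounded_adapted_if[OF H_sets Z_ba[OF order_refl] bounded_adapted_const] that] .
  have nH_ba: "bounded_adapted i (\<lambda>w. if H N w then 0 else 1)" if "N \<le> i" for N i
    using bounded_adapted_mono[OF bounded_adapted_if[OF H_sets bounded_adapted_const bounded_adapted_const] that] .
  \<comment> \<open>The supermartingale on the paths below \<open>x\<close>, plus \<open>L\<close> times the mass of the stopped paths, has mean
    at most 1.\<close>
  have "(\<integral>w. (if H N w then Z N w else 0) \<partial>M) + L * (\<integral>w. (if H N w then 0 else 1) \<partial>M) \<le> 1"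
    if "n \<le> N" "N \<le> m" for N
    using that
  proof (induction N rule: dec_induct)
    case base
    have "H n w" "Z n w = 1" for w using x by (auto simp: H_def S_def Z_def q_def)
    then show ?case by (simp add: prob_space)
  next
    case (step N)
    define g where "g w = (if H N w then Z N w else 0)" for w
    define k where "k = exp (\<theta>\<^sup>2 / 2 * (1 + y) * \<sigma> N)"
    have "\<theta> * S (Suc N) w - q (Suc N)
        = (\<theta> * S N w - q N) + \<theta> * truncated \<sigma> N w - \<theta>\<^sup>2 / 2 * (1 + y) * \<sigma> N" for w
      using step.hyps by (simp add: S_def q_def distrib_left)
    then have Z_Suc: "Z (Suc N) w = Z N w * exp (\<theta> * truncated \<sigma> N w) / k" for w
      by (simp add: Z_def k_def exp_diff exp_add)
    have g_ba: "bounded_adapted i g" if "N \<le> i" for i unfolding g_def by (rule HZ_ba[OF that])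
    have gt: "integrable M (\<lambda>w. g w * exp (\<theta> * truncated \<sigma> N w))"
      by (rule bounded_adapted_integrable[of "Suc N"])
         (auto intro!: bounded_adapted_intros g_ba truncated_adapted)
    note i = bounded_adapted_integrable[OF HZ_ba[OF order_refl]]
      bounded_adapted_integrable[OF nH_ba[OF order_refl]]
    have "(\<integral>w. (if H (Suc N) w then Z (Suc N) w else 0) \<partial>M) + L * (\<integral>w. (if H (Suc N) w then 0 else 1) \<partial>M)
      = (\<integral>w. (if H (Suc N) w then Z (Suc N) w else 0) + L * (if H (Suc N) w then 0 else 1) \<partial>M)"
      using i by simp
    also have "\<dots> \<le> (\<integral>w. g w * exp (\<theta> * truncated \<sigma> N w) / k + L * (if H N w then 0 else 1) \<partial>M)"
    proof (rule integral_mono)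
      fix w assume "w \<in> space M"
      have Hs: "H (Suc N) w \<longleftrightarrow> H N w \<and> S (Suc N) w < x"
        using step.hyps by (auto simp: H_def atLeastAtMostSuc_conv)
      have L: "L \<le> Z (Suc N) w" if "x \<le> S (Suc N) w"
        unfolding L_def Z_def using mult_left_mono[OF that \<theta>] q_mono[of "Suc N" m] step.prems by simp
      show "(if H (Suc N) w then Z (Suc N) w else 0) + L * (if H (Suc N) w then 0 else 1)
        \<le> g w * exp (\<theta> * truncated \<sigma> N w) / k + L * (if H N w then 0 else 1)"
        using L by (auto simp: Hs g_def Z_Suc)
    qed (use i gt in auto)
    also have "\<dots> = (\<integral>w. g w * exp (\<theta> * truncated \<sigma> N w) \<partial>M) / k + L * (\<integral>w. (if H N w then 0 else 1) \<partial>M)"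
      using i gt by simp
    also have "(\<integral>w. g w * exp (\<theta> * truncated \<sigma> N w) \<partial>M) / k \<le> (\<integral>w. g w \<partial>M)"
    proof -
      have "(\<integral>w. g w * exp (\<theta> * truncated \<sigma> N w) \<partial>M) \<le> k * (\<integral>w. g w \<partial>M)"
        unfolding k_def
      proof (rule exp_truncated_upper[OF g_ba[OF order_refl]])
        show "0 \<le> g w" for w by (simp add: g_def Z_def)
        show "\<bar>\<theta>\<bar> * c N \<le> y" using y(1)[of N] step.hyps \<theta> by simp
      qed (use y \<sigma> in auto)
      moreover have "0 < k" by (simp add: k_def)
      ultimately show ?thesis by (simp add: divide_le_eq mult.commute)
    qed
    finally show ?case using step.IH step.prems by (simp add: g_def)
  qed
  moreover have "0 \<le> (\<integral>w. (if H m w then Z m w else 0) \<partial>M)"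
    by (intro Bochner_Integration.integral_nonneg) (simp add: Z_def)
  ultimately have "L * (\<integral>w. (if H m w then 0 else 1) \<partial>M) \<le> 1"
    using \<open>n \<le> m\<close> by (meson add_increasing order_refl order_trans)
  moreover have "(\<integral>w. (if H m w then 0 else 1) \<partial>M) = prob {w \<in> space M. \<exists>N\<in>{n..m}. x \<le> S N w}"
  proof -
    have "{w \<in> space M. \<exists>N\<in>{n..m}. x \<le> S N w} = space M - {w \<in> space M. H m w}"
      by (auto simp: H_def not_less)
    then have ev: "{w \<in> space M. \<exists>N\<in>{n..m}. x \<le> S N w} \<in> events"
      using sets_F_in_M[OF H_sets[of m]] by simp
    have "(\<integral>w. (if H m w then 0 else 1) \<partial>M) = (\<integral>w. indicat_real {w \<in> space M. \<exists>N\<in>{n..m}. x \<le> S N w} w \<partial>M)"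
      by (intro Bochner_Integration.integral_cong) (auto simp: H_def not_less indicator_def)
    then show ?thesis using ev by simp
  qed
  ultimately have "prob {w \<in> space M. \<exists>N\<in>{n..m}. x \<le> S N w} \<le> inverse L"
    by (simp add: L_def field_simps)
  also have "inverse L = exp (- \<theta> * x + q m)"
    by (simp add: L_def flip: exp_minus)
  finally show ?thesis by (simp add: S_def q_def)
qed

text \<open>
  Since only the largest index of a finite set \<open>J\<close> enters the bound, it extends to infinite sets
  of indices by monotone continuity of the measure.
\<close>

lemma maximal_inequality:
  assumes J: "J \<subseteq> {n..}" and Q: "\<And>N. N \<in> J \<Longrightarrow> (\<Sum>j\<in>{n..<N}. \<sigma> j) \<le> Q"
    and \<theta>: "0 \<le> \<theta>" and y: "\<And>j. n \<le> j \<Longrightarrow> \<theta> * c j \<le> y" "y \<le> 1"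
    and \<sigma>: "\<And>j. 0 \<le> \<sigma> j" and x: "0 < x"
  shows "{w \<in> space M. \<exists>N\<in>J. x \<le> (\<Sum>j\<in>{n..<N}. truncated \<sigma> j w)} \<in> events"
    "prob {w \<in> space M. \<exists>N\<in>J. x \<le> (\<Sum>j\<in>{n..<N}. truncated \<sigma> j w)}
    \<le> exp (- \<theta> * x + \<theta>\<^sup>2 / 2 * (1 + y) * Q)"
proof -
  define S where "S N w = (\<Sum>j\<in>{n..<N}. truncated \<sigma> j w)" for N w
  have [measurable]: "truncated \<sigma> j \<in> borel_measurable M" for j
    by (rule bounded_adapted_meas_M[OF truncated_adapted[of j "Suc j"]]) simp
  have [measurable]: "S N \<in> borel_measurable M" for N unfolding S_def by measurable
  define A where "A I = {w \<in> space M. \<exists>N\<in>I. x \<le> S N w}" for I :: "nat set"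
  have ev: "A I \<in> events" for I unfolding A_def by measurable
  have y0: "0 \<le> y" using y(1)[of n] c_nonneg[of n] \<theta> mult_nonneg_nonneg[of \<theta> "c n"] by linarith
  have fin: "prob (A (J \<inter> {..m})) \<le> exp (- \<theta> * x + \<theta>\<^sup>2 / 2 * (1 + y) * Q)" for m
  proof (cases "J \<inter> {..m} = {}")
    case True
    have "prob (A (J \<inter> {..m})) = 0" unfolding True by (simp add: A_def)
    then show ?thesis by simp
  next
    case False
    define m' where "m' = Max (J \<inter> {..m})"
    have m': "m' \<in> J" "n \<le> m'" using Max_in[OF _ False] J by (auto simp: m'_def)
    have "N \<in> {n..m'}" if "N \<in> J \<inter> {..m}" for N using that J by (auto simp: m'_def intro!: Max_ge)
    then have "A (J \<inter> {..m}) \<subseteq> A {n..m'}" unfolding A_def by blast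
    then have "prob (A (J \<inter> {..m})) \<le> prob (A {n..m'})"
      by (intro finite_measure_mono ev)
    also have "\<dots> \<le> exp (- \<theta> * x + \<theta>\<^sup>2 / 2 * (1 + y) * (\<Sum>j\<in>{n..<m'}. \<sigma> j))"
      unfolding A_def S_def by (rule maximal_inequality_finite) (use m' \<theta> y \<sigma> x in auto)
    also have "\<dots> \<le> exp (- \<theta> * x + \<theta>\<^sup>2 / 2 * (1 + y) * Q)"
      using Q[OF m'(1)] y0 by (auto intro!: mult_left_mono)
    finally show ?thesis .
  qed
  have "(\<lambda>m. prob (A (J \<inter> {..m}))) \<longlonglongrightarrow> prob (\<Union>m. A (J \<inter> {..m}))"
    using ev by (intro finite_Lim_measure_incseq) (auto simp: incseq_def A_def intro: order_trans)
  moreover have "(\<Union>m. A (J \<inter> {..m})) = A J" by (auto simp: A_def)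
  ultimately have "prob (A J) \<le> exp (- \<theta> * x + \<theta>\<^sup>2 / 2 * (1 + y) * Q)"
    using fin by (auto intro: LIMSEQ_le_const2)
  then show "prob {w \<in> space M. \<exists>N\<in>J. x \<le> (\<Sum>j\<in>{n..<N}. truncated \<sigma> j w)}
    \<le> exp (- \<theta> * x + \<theta>\<^sup>2 / 2 * (1 + y) * Q)" by (simp add: A_def S_def)
  show "{w \<in> space M. \<exists>N\<in>J. x \<le> (\<Sum>j\<in>{n..<N}. truncated \<sigma> j w)} \<in> events"
    using ev[of J] by (simp add: A_def S_def)
qed

end

section \<open>Remainders of a convergent martingale: the central limit theorem\<close>

text \<open>
  A martingale that converges to \<open>W\<close> and whose remainder after \<open>n\<close> steps has asymptotic variance
  \<open>V n\<close>. The assumption \<open>incr_small\<close> is the smallness of the increments under which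
  exponential moments behave as in the Gaussian case up to the scale of the iterated logarithm.
\<close>

locale tail_martingale = bounded_martingale_differences M F \<xi> s c
  for M :: "'a measure" and F \<xi> s c +
  fixes V :: "nat \<Rightarrow> real" and K :: real and W :: "'a \<Rightarrow> real"
  assumes V_pos: "\<And>n. 0 < V n"
    and V_less: "\<And>n. V (Suc n) < V n"
    and V_lim: "V \<longlonglongrightarrow> 0"
    and V_ratio: "(\<lambda>n. V (Suc n) / V n) \<longlonglongrightarrow> 1"
    and var_asymp: "AE w in M. (\<lambda>n. s n w / (V n - V (Suc n))) \<longlonglongrightarrow> 1"
    and var_dom: "\<And>n. AE w in M. s n w \<le> K * (V n - V (Suc n))"
    and incr_small: "(\<lambda>n. (c n)\<^sup>2 / V n * ln \<bar>ln (V n)\<bar>) \<longlonglongrightarrow> 0"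
    and limit_meas [measurable]: "W \<in> borel_measurable M"
    and partial_sums: "AE w in M. (\<lambda>n. \<Sum>j<n. \<xi> j w) \<longlonglongrightarrow> W w"
begin

definition v :: "nat \<Rightarrow> real" where "v n = V n - V (Suc n)"

definition tail :: "nat \<Rightarrow> 'a \<Rightarrow> real" where "tail n w = W w - (\<Sum>j<n. \<xi> j w)"

lemma v_pos: "0 < v n" using V_less[of n] by (simp add: v_def)

lemma sum_v: "n \<le> m \<Longrightarrow> (\<Sum>j\<in>{n..<m}. v j) = V n - V m"
  by (induction m rule: dec_induct) (auto simp: v_def)

lemma V_antimono: "n \<le> m \<Longrightarrow> V m \<le> V n"
  by (rule lift_Suc_antimono_le[of V]) (simp_all add: less_imp_le[OF V_less])

lemma tail_meas [measurable]: "tail n \<in> borel_measurable M"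
  unfolding tail_def by measurable

lemma tail_split: "n \<le> m \<Longrightarrow> tail n w = (\<Sum>j\<in>{n..<m}. \<xi> j w) + tail m w"
  unfolding tail_def using sum.atLeastLessThan_concat[of 0 n m "\<lambda>j. \<xi> j w"]
  by (simp add: lessThan_atLeast0)

lemma tail_lim:
  "AE w in M. \<forall>n. (\<lambda>m. \<Sum>j\<in>{n..<m}. \<xi> j w) \<longlonglongrightarrow> tail n w"
  using partial_sums
proof eventually_elim
  case (elim w)
  show ?case
  proof
    fix n
    have "(\<lambda>m. (\<Sum>j<m. \<xi> j w) - (\<Sum>j<n. \<xi> j w)) \<longlonglongrightarrow> tail n w"
      unfolding tail_def by (intro tendsto_intros elim)
    moreover have "\<forall>\<^sub>F m in sequentially.
        (\<Sum>j<m. \<xi> j w) - (\<Sum>j<n. \<xi> j w) = (\<Sum>j\<in>{n..<m}. \<xi> j w)"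
      using eventually_ge_at_top[of n]
      by eventually_elim (simp add: lessThan_atLeast0 sum_diff_nat_ivl)
    ultimately show "(\<lambda>m. \<Sum>j\<in>{n..<m}. \<xi> j w) \<longlonglongrightarrow> tail n w"
      by (rule Lim_transform_eventually)
  qed
qed

lemma neg_ln_V: "filterlim (\<lambda>n. - ln (V n)) at_top sequentially"
proof -
  have "filterlim V (at_right 0) sequentially"
    using V_lim V_pos by (simp add: tendsto_imp_filterlim_at_right)
  then have "filterlim (\<lambda>n. ln (V n)) at_bot sequentially"
    by (rule filterlim_compose[OF ln_at_0])
  then show ?thesis by (simp add: filterlim_uminus_at_bot)
qed

lemma ln_ln_V: "filterlim (\<lambda>n. ln \<bar>ln (V n)\<bar>) at_top sequentially"
  by (rule filterlim_compose[OF ln_at_top filterlim_at_top_mono[OF neg_ln_V]])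
     (intro always_eventually allI abs_ge_minus_self)

lemma incr_sq_over_V: "(\<lambda>n. (c n)\<^sup>2 / V n) \<longlonglongrightarrow> 0"
proof (rule tendsto_sandwich[OF _ _ tendsto_const incr_small])
  show "\<forall>\<^sub>F n in sequentially. 0 \<le> (c n)\<^sup>2 / V n" using V_pos by (auto simp: less_imp_le)
  have "\<forall>\<^sub>F n in sequentially. 1 \<le> ln \<bar>ln (V n)\<bar>"
    using ln_ln_V by (simp add: filterlim_at_top)
  then show "\<forall>\<^sub>F n in sequentially. (c n)\<^sup>2 / V n \<le> (c n)\<^sup>2 / V n * ln \<bar>ln (V n)\<bar>"
  proof eventually_elim
    case (elim n)
    have "0 \<le> (c n)\<^sup>2 / V n" using V_pos[of n] by simp
    from mult_left_mono[OF elim this] show ?case by simp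
  qed
qed

lemma incr_over_sqrt_V: "(\<lambda>n. c n / sqrt (V n)) \<longlonglongrightarrow> 0"
  using tendsto_real_sqrt[OF incr_sq_over_V] c_nonneg by (simp add: real_sqrt_divide)

lemma v_over_V: "(\<lambda>n. v n / V n) \<longlonglongrightarrow> 0"
proof -
  have "v n / V n = 1 - V (Suc n) / V n" for n
    using V_pos[of n] by (simp add: v_def field_simps)
  then show ?thesis using tendsto_diff[OF tendsto_const V_ratio, of 1] by simp
qed

text \<open>
  The mean deviation of the conditional variance from the deterministic increment \<open>v n\<close> of the
  variance scale.
\<close>

definition var_err :: "nat \<Rightarrow> real" where
  "var_err n = (\<integral>w. \<bar>s n w - v n\<bar> \<partial>M)"

lemma var_err_nonneg: "0 \<le> var_err n"
  unfolding var_err_def by (rule Bochner_Integration.integral_nonneg) auto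

text \<open>
  Almost sure convergence of the conditional variances improves to convergence in mean by
  domination; the central limit theorem requires no rate.
\<close>

lemma var_err_lim: "(\<lambda>n. var_err n / v n) \<longlonglongrightarrow> 0"
proof -
  have eq: "var_err n / v n = (\<integral>w. \<bar>s n w / v n - 1\<bar> \<partial>M)" for n
  proof -
    have "\<bar>s n w / v n - 1\<bar> = \<bar>s n w - v n\<bar> / v n" for w
      using v_pos[of n] by (simp add: field_simps abs_if)
    then show ?thesis by (simp add: var_err_def)
  qed
  have "(\<lambda>n. \<integral>w. \<bar>s n w / v n - 1\<bar> \<partial>M) \<longlonglongrightarrow> (\<integral>w. 0 \<partial>M)"
  proof (rule integral_dominated_convergence[where w = "\<lambda>_. \<bar>K\<bar> + 1"])
    show "AE w in M. (\<lambda>n. \<bar>s n w / v n - 1\<bar>) \<longlonglongrightarrow> 0"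
      using var_asymp
    proof eventually_elim
      case (elim w)
      then show ?case
        using tendsto_rabs[OF tendsto_diff[OF elim tendsto_const, of 1]] by (simp add: v_def)
    qed
    show "AE w in M. norm \<bar>s n w / v n - 1\<bar> \<le> \<bar>K\<bar> + 1" for n
      using var_bounds[of n] var_dom[of n]
    proof eventually_elim
      case (elim w)
      have "s n w / v n \<le> K" using elim v_pos[of n] by (simp add: divide_le_eq v_def)
      moreover have "0 \<le> s n w / v n" using elim v_pos[of n] by simp
      ultimately show ?case by simp
    qed
  qed auto
  then show ?thesis by (simp add: eq)
qed

text \<open>
  Replacing the increments from the last one backwards telescopes, because the factor
  \<open>exp (- \<tau>\<^sup>2 V m / 2)\<close> is the characteristic function of a Gaussian that stands for everything after
  time \<open>m\<close>.
\<close>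

lemma iexp_block:
  assumes "n \<le> m"
  shows "cmod ((\<integral>w. iexp (\<tau> * (\<Sum>j\<in>{n..<m}. \<xi> j w)) \<partial>M) * complex_of_real (exp (- (\<tau>\<^sup>2 * V m / 2)))
      - complex_of_real (exp (- (\<tau>\<^sup>2 * V n / 2))))
    \<le> (\<Sum>j\<in>{n..<m}. \<bar>\<tau>\<bar> ^ 3 * c j * (v j + var_err j) + \<tau>\<^sup>2 * var_err j + \<tau> ^ 4 * (v j)\<^sup>2)"
  using assms
proof (induction m rule: dec_induct)
  case base
  then show ?case by (simp add: prob_space flip: of_real_exp)
next
  case (step m)
  define h where "h w = iexp (\<tau> * (\<Sum>j\<in>{n..<m}. \<xi> j w))" for w
  define err where "err = \<bar>\<tau>\<bar> ^ 3 * c m * (v m + var_err m) + \<tau>\<^sup>2 * var_err m + \<tau> ^ 4 * (v m)\<^sup>2"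
  have S: "bounded_adapted m (\<lambda>w. \<Sum>j\<in>{n..<m}. \<xi> j w)"
    by (intro bounded_adapted_intros) auto
  note [measurable] = bounded_adapted_meas[OF S]
  have "bounded_adapted m (\<lambda>w. Re (h w))" "bounded_adapted m (\<lambda>w. Im (h w))"
    by (auto intro!: bounded_adaptedI[of _ _ 1] simp: h_def Re_exp Im_exp)
  note * = iexp_incr[OF this, of "v m" \<tau>, folded var_err_def]
  have "cmod ((\<integral>w. h w * iexp (\<tau> * \<xi> m w) \<partial>M) - complex_of_real (exp (- (\<tau>\<^sup>2 * v m / 2))) * (\<integral>w. h w \<partial>M)) \<le> err"
    unfolding err_def by (rule *) (use v_pos[of m] in \<open>auto simp: h_def\<close>)
  moreover have "h w * iexp (\<tau> * \<xi> m w) = iexp (\<tau> * (\<Sum>j\<in>{n..<Suc m}. \<xi> j w))" for w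
    using step.hyps by (simp add: h_def algebra_simps flip: exp_add)
  ultimately have 1: "cmod ((\<integral>w. iexp (\<tau> * (\<Sum>j\<in>{n..<Suc m}. \<xi> j w)) \<partial>M)
      - complex_of_real (exp (- (\<tau>\<^sup>2 * v m / 2))) * (\<integral>w. h w \<partial>M)) \<le> err" (is "cmod (?A - ?B) \<le> _") by simp
  have ex: "exp (- (\<tau>\<^sup>2 * v m / 2)) * exp (- (\<tau>\<^sup>2 * V (Suc m) / 2)) = exp (- (\<tau>\<^sup>2 * V m / 2))"
    by (simp add: v_def field_simps flip: exp_add)
  have "cmod (?A * complex_of_real (exp (- (\<tau>\<^sup>2 * V (Suc m) / 2))) - (\<integral>w. h w \<partial>M) * complex_of_real (exp (- (\<tau>\<^sup>2 * V m / 2))))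
      = cmod ((?A - ?B) * of_real (exp (- (\<tau>\<^sup>2 * V (Suc m) / 2))))"
    by (subst ex[symmetric]) (simp add: algebra_simps)
  also have "\<dots> = cmod (?A - ?B) * exp (- (\<tau>\<^sup>2 * V (Suc m) / 2))" by (simp only: norm_mult norm_of_real abs_exp_cancel)
  also have "\<dots> \<le> err * 1"
    using V_pos[of "Suc m"] by (intro mult_mono 1) (auto intro: order_trans[OF _ 1])
  finally have 2: "cmod (?A * complex_of_real (exp (- (\<tau>\<^sup>2 * V (Suc m) / 2))) - (\<integral>w. h w \<partial>M) * complex_of_real (exp (- (\<tau>\<^sup>2 * V m / 2)))) \<le> err"
    by simp
  show ?case
    using step.hyps norm_triangle_mono[OF 2 step.IH[folded h_def]] by (simp add: err_def)
qed

text \<open>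
  With \<open>\<tau> = t / sqrt (V n)\<close> every term of the error in \<open>iexp_block\<close> is at most \<open>v j / V n\<close> times a
  null sequence, and the weights \<open>v j / V n\<close> sum to at most 1. So the estimate is uniform in the
  upper end \<open>m\<close> of the block, and \<open>m\<close> may tend to infinity.
\<close>

lemma char_tail:
  "(\<lambda>n. \<integral>w. iexp (t * (tail n w / sqrt (V n))) \<partial>M) \<longlonglongrightarrow> complex_of_real (exp (- t\<^sup>2 / 2))"
proof -
  define E where "E j = \<bar>t\<bar> ^ 3 * (c j / sqrt (V j)) * (1 + var_err j / v j)
      + t\<^sup>2 * (var_err j / v j) + t ^ 4 * (v j / V j)" for j
  have "E \<longlonglongrightarrow> \<bar>t\<bar> ^ 3 * 0 * (1 + 0) + t\<^sup>2 * 0 + t ^ 4 * 0"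
    unfolding E_def by (intro tendsto_intros incr_over_sqrt_V var_err_lim v_over_V)
  then have E: "E \<longlonglongrightarrow> 0" by simp
  have bound: "cmod ((\<integral>w. iexp (t * (tail n w / sqrt (V n))) \<partial>M) - complex_of_real (exp (- t\<^sup>2 / 2))) \<le> e"
    if e: "\<And>j. n \<le> j \<Longrightarrow> E j \<le> e" "0 \<le> e" for n e
  proof -
    define \<tau> where "\<tau> = t / sqrt (V n)"
    have \<tau>2: "\<tau>\<^sup>2 = t\<^sup>2 / V n" using V_pos[of n] by (simp add: \<tau>_def power_divide)
    have \<tau>4: "\<tau> ^ 4 = t ^ 4 / (V n)\<^sup>2"
      using arg_cong[OF \<tau>2, of "\<lambda>x. x\<^sup>2"] by (simp add: power_divide flip: power_mult)
    have \<tau>3: "\<bar>\<tau>\<bar> ^ 3 = \<bar>t\<bar> ^ 3 / (V n * sqrt (V n))"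
      using V_pos[of n] by (simp add: \<tau>_def abs_divide power_divide power3_eq_cube)
    have summand: "\<bar>\<tau>\<bar> ^ 3 * c j * (v j + var_err j) + \<tau>\<^sup>2 * var_err j + \<tau> ^ 4 * (v j)\<^sup>2 \<le> v j / V n * e"
      if j: "n \<le> j" for j
    proof -
      have Vj: "V j \<le> V n" "0 < V j" "0 < V n" "0 < v j"
        using V_antimono[OF j] V_pos v_pos by auto
      have "\<bar>\<tau>\<bar> ^ 3 * c j * (v j + var_err j)
          = v j / V n * (\<bar>t\<bar> ^ 3 * (c j / sqrt (V n)) * (1 + var_err j / v j))"
        using Vj by (simp add: \<tau>3 field_simps)
      also have "\<dots> \<le> v j / V n * (\<bar>t\<bar> ^ 3 * (c j / sqrt (V j)) * (1 + var_err j / v j))"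
        using Vj c_nonneg[of j] var_err_nonneg[of j]
        by (intro mult_left_mono mult_right_mono divide_left_mono) (auto simp: less_imp_le)
      finally have a: "\<bar>\<tau>\<bar> ^ 3 * c j * (v j + var_err j)
          \<le> v j / V n * (\<bar>t\<bar> ^ 3 * (c j / sqrt (V j)) * (1 + var_err j / v j))" .
      have b: "\<tau>\<^sup>2 * var_err j = v j / V n * (t\<^sup>2 * (var_err j / v j))"
        using Vj by (simp add: \<tau>2)
      have "\<tau> ^ 4 * (v j)\<^sup>2 = v j / V n * (t ^ 4 * (v j / V n))"
        by (simp add: \<tau>4 power2_eq_square)
      also have "\<dots> \<le> v j / V n * (t ^ 4 * (v j / V j))"
        using Vj by (intro mult_left_mono divide_left_mono) auto
      finally have d: "\<tau> ^ 4 * (v j)\<^sup>2 \<le> v j / V n * (t ^ 4 * (v j / V j))" .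
      have "\<bar>\<tau>\<bar> ^ 3 * c j * (v j + var_err j) + \<tau>\<^sup>2 * var_err j + \<tau> ^ 4 * (v j)\<^sup>2 \<le> v j / V n * E j"
        using a b d unfolding E_def by (simp add: distrib_left)
      also have "\<dots> \<le> v j / V n * e" using Vj e(1)[OF j] by (intro mult_left_mono) auto
      finally show ?thesis .
    qed
    have fin: "cmod ((\<integral>w. iexp (\<tau> * (\<Sum>j\<in>{n..<m}. \<xi> j w)) \<partial>M) * complex_of_real (exp (- (\<tau>\<^sup>2 * V m / 2)))
      - complex_of_real (exp (- (\<tau>\<^sup>2 * V n / 2)))) \<le> e" if "n \<le> m" for m
    proof -
      note iexp_block[OF that]
      also have "(\<Sum>j\<in>{n..<m}. \<bar>\<tau>\<bar> ^ 3 * c j * (v j + var_err j) + \<tau>\<^sup>2 * var_err j + \<tau> ^ 4 * (v j)\<^sup>2)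
          \<le> (\<Sum>j\<in>{n..<m}. v j / V n * e)"
        by (intro sum_mono summand) auto
      also have "\<dots> = (V n - V m) / V n * e"
        using sum_v[OF that] by (simp flip: sum_distrib_right sum_divide_distrib)
      also have "\<dots> \<le> 1 * e"
        using V_pos[of n] V_pos[of m] e(2) by (intro mult_right_mono) (auto simp: field_simps)
      finally show ?thesis by simp
    qed
    have "(\<lambda>m. \<integral>w. iexp (\<tau> * (\<Sum>j\<in>{n..<m}. \<xi> j w)) \<partial>M) \<longlonglongrightarrow> (\<integral>w. iexp (\<tau> * tail n w) \<partial>M)"
    proof (rule integral_dominated_convergence[where w = "\<lambda>_. 1"])
      show "AE w in M. (\<lambda>m. iexp (\<tau> * (\<Sum>j\<in>{n..<m}. \<xi> j w))) \<longlonglongrightarrow> iexp (\<tau> * tail n w)"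
        using tail_lim by eventually_elim (intro tendsto_intros, blast)
    qed auto
    then have "(\<lambda>m. cmod ((\<integral>w. iexp (\<tau> * (\<Sum>j\<in>{n..<m}. \<xi> j w)) \<partial>M) * complex_of_real (exp (- (\<tau>\<^sup>2 * V m / 2)))
      - complex_of_real (exp (- (\<tau>\<^sup>2 * V n / 2))))) \<longlonglongrightarrow> cmod ((\<integral>w. iexp (\<tau> * tail n w) \<partial>M) * complex_of_real (exp (- (\<tau>\<^sup>2 * 0 / 2)))
      - complex_of_real (exp (- (\<tau>\<^sup>2 * V n / 2))))"
      by (intro tendsto_intros V_lim) auto
    then have "cmod ((\<integral>w. iexp (\<tau> * tail n w) \<partial>M) * complex_of_real (exp (- (\<tau>\<^sup>2 * 0 / 2)))
      - complex_of_real (exp (- (\<tau>\<^sup>2 * V n / 2)))) \<le> e"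
      by (rule LIMSEQ_le_const2) (use fin in blast)
    moreover have "\<tau>\<^sup>2 * V n / 2 = t\<^sup>2 / 2" using V_pos[of n] by (simp add: \<tau>2)
    moreover have "\<tau> * tail n w = t * (tail n w / sqrt (V n))" for w by (simp add: \<tau>_def)
    ultimately show ?thesis by simp
  qed
  show ?thesis
  proof (rule LIMSEQ_I)
    fix r :: real assume r: "0 < r"
    then have "\<forall>\<^sub>F n in sequentially. E n < r / 2"
      using order_tendstoD(2)[OF E, of "r / 2"] by simp
    then obtain n0 where n0: "\<And>n. n0 \<le> n \<Longrightarrow> E n \<le> r / 2"
      by (auto simp: eventually_sequentially intro: less_imp_le)
    show "\<exists>n0. \<forall>n\<ge>n0. cmod ((\<integral>w. iexp (t * (tail n w / sqrt (V n))) \<partial>M) - of_real (exp (- t\<^sup>2 / 2))) < r"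
    proof (intro exI allI impI)
      fix n assume "n0 \<le> n"
      then have "cmod ((\<integral>w. iexp (t * (tail n w / sqrt (V n))) \<partial>M) - complex_of_real (exp (- t\<^sup>2 / 2))) \<le> r / 2"
        using n0 r by (intro bound) auto
      then show "cmod ((\<integral>w. iexp (t * (tail n w / sqrt (V n))) \<partial>M) - of_real (exp (- t\<^sup>2 / 2))) < r"
        using r by simp
    qed
  qed
qed

theorem tail_clt:
  "weak_conv_m (\<lambda>n. distr M borel (\<lambda>w. tail n w / sqrt (V n))) std_normal_distribution"
proof (rule levy_continuity)
  show "real_distribution (distr M borel (\<lambda>w. tail n w / sqrt (V n)))" for n
    by (rule real_distribution_distr) measurable
  show "real_distribution std_normal_distribution" by (rule real_dist_normal_dist)
  show "(\<lambda>n. char (distr M borel (\<lambda>w. tail n w / sqrt (V n))) t) \<longlonglongrightarrow> char std_normal_distribution t" for t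
    using char_tail[of t] by (simp add: char_def integral_distr char_std_normal_distribution)
qed

end

section \<open>The upper bound in the law of the iterated logarithm\<close>

context tail_martingale
begin

text \<open>
  The first time at which the variance scale is at most \<open>r\<close> to the power \<open>-k\<close>. Blocks are cut by the
  values of \<open>V\<close>, not of \<open>n\<close>, so that \<open>V\<close> is known at their ends however it depends on \<open>n\<close>.
\<close>

definition block :: "real \<Rightarrow> nat \<Rightarrow> nat" where
  "block r k = (LEAST n. V n * r ^ k \<le> 1)"

text \<open>
  The size of the law of the iterated logarithm at the \<open>k\<close>-th block, where the double logarithm of
  \<open>r\<close> to the power \<open>k\<close> is replaced by \<open>ln k\<close>.
\<close>

definition lil_scale :: "real \<Rightarrow> nat \<Rightarrow> real" where
  "lil_scale r k = sqrt (2 * ln (real k) / r ^ k)"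

context
  fixes r :: real
  assumes r: "1 < r"
begin

lemma r_power_pos: "0 < r ^ k" using r by simp

lemma block_exists: "\<exists>n. V n * r ^ k \<le> 1"
proof -
  have "\<forall>\<^sub>F n in sequentially. V n < 1 / r ^ k"
    using r_power_pos[of k] by (intro order_tendstoD(2)[OF V_lim]) auto
  then obtain n where "V n < 1 / r ^ k" by (auto simp: eventually_sequentially)
  then show ?thesis using r_power_pos[of k] by (auto simp: field_simps intro: exI[of _ n])
qed

lemma V_block_le: "V (block r k) * r ^ k \<le> 1"
  unfolding block_def by (rule LeastI_ex[OF block_exists])

lemma V_below_block: "n < block r k \<Longrightarrow> 1 < V n * r ^ k"
  unfolding block_def using not_less_Least by fastforce

lemma V_from_block: "block r k \<le> n \<Longrightarrow> V n * r ^ k \<le> 1"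
  using r by (intro order_trans[OF mult_right_mono V_block_le] V_antimono) auto

lemma block_mono: "block r k \<le> block r (Suc k)"
proof (rule ccontr)
  assume "\<not> ?thesis"
  then have "1 < V (block r (Suc k)) * r ^ k" by (intro V_below_block) auto
  moreover have "V (block r (Suc k)) * r ^ k \<le> V (block r (Suc k)) * r ^ Suc k"
    using r V_pos[of "block r (Suc k)"] by (intro mult_left_mono power_increasing) auto
  ultimately show False using V_block_le[of "Suc k"] by simp
qed

lemma block_at_top: "filterlim (block r) at_top sequentially"
  unfolding filterlim_at_top
proof
  fix m
  have "filterlim (\<lambda>k. r ^ k) at_top sequentially"
    using filterlim_realpow_sequentially_gt1[of r] r by (simp add: filterlim_at_infinity_imp_filterlim_at_top)
  then have "\<forall>\<^sub>F k in sequentially. 2 / V m \<le> r ^ k" by (simp add: filterlim_at_top)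
  then show "\<forall>\<^sub>F k in sequentially. m \<le> block r k"
  proof eventually_elim
    case (elim k)
    show ?case
    proof (rule ccontr)
      assume "\<not> m \<le> block r k"
      then have "V m * r ^ k \<le> 1" by (intro V_from_block) auto
      then show False using elim V_pos[of m] by (simp add: field_simps)
    qed
  qed
qed

text \<open>
  The scale \<open>V\<close> does not jump over its levels: just before the block its value exceeds the level,
  and consecutive values of \<open>V\<close> have a ratio tending to 1.
\<close>

lemma V_block_lim: "(\<lambda>k. V (block r k) * r ^ k) \<longlonglongrightarrow> 1"
proof (rule tendsto_sandwich[OF _ _ _ tendsto_const])
  have "filterlim (\<lambda>k. block r k - 1) at_top sequentially"
    by (rule filterlim_compose[OF filterlim_minus_const_nat_at_top block_at_top])
  then show "(\<lambda>k. V (Suc (block r k - 1)) / V (block r k - 1)) \<longlonglongrightarrow> 1"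
    by (rule filterlim_compose[OF V_ratio])
  have "\<forall>\<^sub>F k in sequentially. 1 \<le> block r k" using block_at_top by (simp add: filterlim_at_top)
  then show "\<forall>\<^sub>F k in sequentially. V (Suc (block r k - 1)) / V (block r k - 1) \<le> V (block r k) * r ^ k"
  proof eventually_elim
    case (elim k)
    then have "1 < V (block r k - 1) * r ^ k" by (intro V_below_block) auto
    then have "V (block r k) * 1 \<le> V (block r k) * (V (block r k - 1) * r ^ k)"
      using V_pos[of "block r k"] by (intro mult_left_mono) auto
    then show ?case using elim V_pos[of "block r k - 1"] by (simp add: field_simps)
  qed
  show "\<forall>\<^sub>F k in sequentially. V (block r k) * r ^ k \<le> 1" using V_block_le by simp
qed

lemma block_search:
  assumes "block r k0 \<le> n"
  shows "\<exists>k\<ge>k0. block r k \<le> n \<and> n < block r (Suc k)"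
proof -
  have "\<exists>m. n < block r m"
    using block_at_top[unfolded filterlim_at_top, rule_format, of "Suc n"]
    by (auto simp: eventually_sequentially Suc_le_eq)
  define m where "m = (LEAST m. n < block r m)"
  have m: "n < block r m" unfolding m_def by (rule LeastI_ex) fact
  have below: "block r i \<le> n" if "i < m" for i using not_less_Least[OF that[unfolded m_def]] by simp
  have "k0 < m"
  proof (rule ccontr)
    assume "\<not> k0 < m"
    then have "block r m \<le> block r k0" by (simp add: lift_Suc_mono_le[of "block r", OF block_mono])
    then show False using m assms by simp
  qed
  then show ?thesis using m below[of "m - 1"] by (intro exI[of _ "m - 1"]) auto
qed

lemma neg_ln_V_block: "block r k \<le> n \<Longrightarrow> k * ln r \<le> - ln (V n)"
proof -
  assume "block r k \<le> n"
  then have "ln (V n * r ^ k) \<le> 0" using V_pos[of n] r by (simp add: V_from_block)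
  then show ?thesis using V_pos[of n] r by (simp add: ln_mult ln_realpow)
qed

lemma incr_small_block:
  assumes "0 < a"
  shows "\<forall>\<^sub>F k in sequentially. \<forall>j\<ge>block r k. (c j)\<^sup>2 * r ^ k * ln k \<le> a"
proof -
  have "\<forall>\<^sub>F n in sequentially. (c n)\<^sup>2 / V n * ln \<bar>ln (V n)\<bar> < a / 2"
    using assms by (intro order_tendstoD(2)[OF incr_small]) auto
  then obtain n0 where n0: "\<And>n. n0 \<le> n \<Longrightarrow> (c n)\<^sup>2 / V n * ln \<bar>ln (V n)\<bar> < a / 2"
    by (auto simp: eventually_sequentially)
  have "\<forall>\<^sub>F k in sequentially. n0 \<le> block r k" using block_at_top by (simp add: filterlim_at_top)
  moreover have "\<forall>\<^sub>F k in sequentially. ln (real k) \<le> 2 * ln (real k * ln r)"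
    using r by real_asymp
  ultimately show ?thesis
    using eventually_gt_at_top[of 1]
  proof eventually_elim
    case (elim k)
    show ?case
    proof (intro allI impI)
      fix j assume j: "block r k \<le> j"
      have kr: "0 < real k * ln r" using elim r by simp
      have 1: "r ^ k \<le> 1 / V j" using V_from_block[OF j] V_pos[of j] by (simp add: field_simps)
      have "ln (real k * ln r) \<le> ln \<bar>ln (V j)\<bar>"
        using neg_ln_V_block[OF j] kr by (subst ln_le_cancel_iff) auto
      then have 2: "ln k \<le> 2 * ln \<bar>ln (V j)\<bar>" using elim by simp
      have "(c j)\<^sup>2 * (r ^ k * ln k) \<le> (c j)\<^sup>2 * (1 / V j * (2 * ln \<bar>ln (V j)\<bar>))"
        using 1 2 elim r V_pos[of j] by (intro mult_left_mono mult_mono) (auto simp: less_imp_le)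
      also have "\<dots> = 2 * ((c j)\<^sup>2 / V j * ln \<bar>ln (V j)\<bar>)" by simp
      also have "\<dots> \<le> a" using n0[of j] order_trans[OF elim(1) j] by linarith
      finally show "(c j)\<^sup>2 * r ^ k * ln k \<le> a" by (simp add: mult.assoc)
    qed
  qed
qed

text \<open>
  The Gaussian tail at \<open>\<kappa> sqrt q\<close> times the scale of the block is \<open>k\<close> to the power \<open>-\<kappa>\<close>, which
  is summable, so the Borel-Cantelli lemma applies to the truncated sums. Along almost every path only
  finitely many increments are truncated. The index sets \<open>J k\<close> may be infinite
  (for the whole remainder) or end with the block (where \<open>q\<close> is small).
\<close>

lemma block_maximum_bound:
  assumes \<kappa>: "1 < \<kappa>" and q: "0 < q"
    and J: "\<And>k. J k \<subseteq> {block r k..}"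
    and JV: "\<forall>\<^sub>F k in sequentially. \<forall>N\<in>J k. (V (block r k) - V N) * r ^ k \<le> q"
  shows "AE w in M. \<forall>\<^sub>F k in sequentially. \<forall>N\<in>J k.
    (\<Sum>j\<in>{block r k..<N}. \<xi> j w) < \<kappa> * sqrt q * lil_scale r k"
proof -
  \<comment> \<open>One factor \<open>1 + \<eta>\<close> is lost to the truncation and one to the exponential estimate; together they
    cost at most \<open>\<kappa>\<close>.\<close>
  define \<eta> where "\<eta> = min 1 (sqrt \<kappa> - 1)"
  have \<eta>: "0 < \<eta>" "\<eta> \<le> 1" "1 + \<eta> \<le> sqrt \<kappa>" using \<kappa> by (auto simp: \<eta>_def min_def)
  have "(1 + \<eta>) * (1 + \<eta>) \<le> sqrt \<kappa> * sqrt \<kappa>" using \<eta> \<kappa> by (intro mult_mono) auto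
  then have \<eta>\<kappa>: "(1 + \<eta>) * (1 + \<eta>) \<le> \<kappa>" using \<kappa> by simp
  define \<sigma> where "\<sigma> j = (1 + \<eta>) * v j" for j
  define A where "A k = {w \<in> space M. \<exists>N\<in>J k. \<kappa> * sqrt q * lil_scale r k \<le> (\<Sum>j\<in>{block r k..<N}. truncated \<sigma> j w)}" for k
  have \<sigma>0: "0 \<le> \<sigma> j" for j using \<eta> v_pos[of j] by (simp add: \<sigma>_def)
  have "0 < \<eta>\<^sup>2 * q / 2" using \<eta> q by simp
  from incr_small_block[OF this] JV eventually_gt_at_top[of 1]
  have ev: "\<forall>\<^sub>F k in sequentially. A k \<in> events \<and> prob (A k) \<le> real k powr (- \<kappa>)"
  proof eventually_elim
    case (elim k)
    define u where "u = lil_scale r k"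
    have k1: "0 < ln (real k)" using elim by simp
    have u: "0 < u" "u\<^sup>2 * r ^ k = 2 * ln k"
      using k1 r by (simp_all add: u_def lil_scale_def)
    \<comment> \<open>The minimiser of the exponent for the variance \<open>\<kappa> q / r ^ k\<close>.\<close>
    define \<theta> where "\<theta> = u * r ^ k / sqrt q"
    have \<theta>: "0 \<le> \<theta>" using u q r_power_pos[of k] by (simp add: \<theta>_def less_imp_le)
    have \<theta>q: "\<theta> * sqrt q = u * r ^ k" using q by (simp add: \<theta>_def)
    have "\<theta>\<^sup>2 = (u\<^sup>2 * r ^ k) * r ^ k / q"
      unfolding \<theta>_def power_divide power_mult_distrib using q by (simp add: power2_eq_square)
    then have \<theta>2: "\<theta>\<^sup>2 = 2 * ln k * r ^ k / q" by (simp only: u(2))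
    have cj: "\<theta> * c j \<le> \<eta>" if j: "block r k \<le> j" for j
    proof (rule power2_le_imp_le)
      have "(\<theta> * c j)\<^sup>2 = 2 / q * ((c j)\<^sup>2 * r ^ k * ln k)" by (simp add: power_mult_distrib \<theta>2)
      also have "\<dots> \<le> 2 / q * (\<eta>\<^sup>2 * q / 2)" using elim j q by (intro mult_left_mono) auto
      finally show "(\<theta> * c j)\<^sup>2 \<le> \<eta>\<^sup>2" using q by simp
    qed (use \<eta> in auto)
    have Q: "(\<Sum>j\<in>{block r k..<N}. \<sigma> j) \<le> (1 + \<eta>) * (q / r ^ k)" if N: "N \<in> J k" for N
    proof -
      have "(\<Sum>j\<in>{block r k..<N}. \<sigma> j) = (1 + \<eta>) * (V (block r k) - V N)"
        using J[of k] N sum_v[of "block r k" N] by (auto simp: \<sigma>_def simp flip: sum_distrib_left)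
      also have "\<dots> \<le> (1 + \<eta>) * (q / r ^ k)"
      proof (intro mult_left_mono)
        have "(V (block r k) - V N) * r ^ k \<le> q" using elim N by simp
        then show "V (block r k) - V N \<le> q / r ^ k"
          using r_power_pos[of k] by (simp only: pos_le_divide_eq)
      qed (use \<eta> in simp)
      finally show ?thesis .
    qed
    have x: "0 < \<kappa> * sqrt q * u" using \<kappa> q u by simp
    note max = maximal_inequality[where J = "J k" and n = "block r k" and \<sigma> = \<sigma> and \<theta> = \<theta> and y = \<eta>
        and x = "\<kappa> * sqrt q * u" and Q = "(1 + \<eta>) * (q / r ^ k)", OF J Q \<theta> cj \<eta>(2) \<sigma>0 x]
    have "\<theta> * (\<kappa> * sqrt q * u) = \<kappa> * ((\<theta> * sqrt q) * u)" by (simp only: mult_ac)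
    also have "\<dots> = \<kappa> * (u\<^sup>2 * r ^ k)" unfolding \<theta>q power2_eq_square by (simp only: mult_ac)
    finally have 1: "\<theta> * (\<kappa> * sqrt q * u) = \<kappa> * (2 * ln k)" by (simp only: u(2))
    have "\<theta>\<^sup>2 * (q / r ^ k) = 2 * ln k"
      using q r by (simp add: \<theta>2)
    moreover have "\<theta>\<^sup>2 / 2 * (1 + \<eta>) * ((1 + \<eta>) * (q / r ^ k))
        = (1 + \<eta>) * (1 + \<eta>) * (\<theta>\<^sup>2 * (q / r ^ k)) / 2" by (simp add: mult_ac)
    ultimately have "\<theta>\<^sup>2 / 2 * (1 + \<eta>) * ((1 + \<eta>) * (q / r ^ k)) = (1 + \<eta>) * (1 + \<eta>) * ln k"
      by simp
    with 1 have "- \<theta> * (\<kappa> * sqrt q * u) + \<theta>\<^sup>2 / 2 * (1 + \<eta>) * ((1 + \<eta>) * (q / r ^ k))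
      = - \<kappa> * (2 * ln k) + (1 + \<eta>) * (1 + \<eta>) * ln k" by simp
    also have "\<dots> \<le> - \<kappa> * (2 * ln k) + \<kappa> * ln k"
      using \<eta>\<kappa> k1 by (intro add_left_mono mult_right_mono) auto
    finally have "exp (- \<theta> * (\<kappa> * sqrt q * u) + \<theta>\<^sup>2 / 2 * (1 + \<eta>) * ((1 + \<eta>) * (q / r ^ k))) \<le> exp (- \<kappa> * ln k)"
      by simp
    also have "\<dots> = real k powr (- \<kappa>)" using elim by (simp add: powr_def)
    finally show ?case
      using max(1) order_trans[OF max(2)] unfolding A_def u_def by blast
  qed
  then obtain k0 where k0: "\<And>k. k0 \<le> k \<Longrightarrow> A k \<in> events" "\<And>k. k0 \<le> k \<Longrightarrow> prob (A k) \<le> real k powr (- \<kappa>)"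
    by (auto simp: eventually_sequentially)
  have "AE w in M. \<forall>\<^sub>F k in sequentially. w \<in> space M - A (k + k0)"
  proof (rule borel_cantelli_AE1)
    have "summable (\<lambda>k. real (k + k0) powr (- \<kappa>))"
      using \<kappa> by (subst summable_iff_shift) (simp add: summable_real_powr_iff)
    then show "summable (\<lambda>k. prob (A (k + k0)))"
    proof (rule summable_comparison_test')
      show "norm (prob (A (k + k0))) \<le> real (k + k0) powr (- \<kappa>)" for k
        using k0(2)[of "k + k0"] by simp
    qed
  qed (use k0(1) in \<open>simp_all add: emeasure_eq_measure\<close>)
  then show ?thesis using var_asymp AE_space
  proof eventually_elim
    case (elim w)
    have "\<forall>\<^sub>F j in sequentially. s j w / (V j - V (Suc j)) < 1 + \<eta>"
      using \<eta> by (intro order_tendstoD(2)[OF elim(2)]) auto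
    then obtain j0 where j0: "\<And>j. j0 \<le> j \<Longrightarrow> s j w / v j < 1 + \<eta>"
      by (auto simp: eventually_sequentially v_def)
    have tr: "truncated \<sigma> j w = \<xi> j w" if "j0 \<le> j" for j
      using j0[OF that] v_pos[of j] by (simp add: truncated_def \<sigma>_def field_simps)
    have "\<forall>\<^sub>F k in sequentially. w \<in> space M - A k"
      using elim(1) by (subst eventually_sequentially_seg[symmetric])
    moreover have "\<forall>\<^sub>F k in sequentially. j0 \<le> block r k" using block_at_top by (simp add: filterlim_at_top)
    ultimately show ?case
    proof eventually_elim
      case (elim k)
      have "(\<Sum>j\<in>{block r k..<N}. \<xi> j w) = (\<Sum>j\<in>{block r k..<N}. truncated \<sigma> j w)" for N
        using elim(2) by (intro sum.cong) (auto simp: tr)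
      then show ?case using elim(1) by (auto simp: A_def not_le)
    qed
  qed
qed

end

end

context tail_martingale
begin

lemma tail_martingale_negated: "tail_martingale M F (\<lambda>n w. - \<xi> n w) s c V K (\<lambda>w. - W w)"
proof unfold_locales
  fix n
  interpret sub: finite_measure_subalgebra M "F n" by (rule finite_subalgebra)
  have "integrable M (\<xi> n)" by (rule bounded_adapted_integrable[OF bounded_adapted_incr[of n "Suc n"]]) simp
  from sub.real_cond_exp_cmult[OF this, of "- 1"] centred[of n]
  show "AE w in M. real_cond_exp M (F n) (\<lambda>w. - \<xi> n w) w = 0" by auto
  show "AE w in M. real_cond_exp M (F n) (\<lambda>w. (- \<xi> n w)\<^sup>2) w = s n w" using cond_var[of n] by simp
  show "(\<lambda>w. - \<xi> n w) \<in> borel_measurable (F (Suc n))" using incr_meas[of n] by simp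
  show "AE w in M. (\<lambda>n. \<Sum>j<n. - \<xi> j w) \<longlonglongrightarrow> - W w"
    using partial_sums by eventually_elim (simp add: sum_negf tendsto_minus)
qed (use subalg filtration var_meas incr_bound V_pos V_less V_lim V_ratio var_asymp var_dom incr_small
     in auto)

lemma phi_hat_V_pos: "\<forall>\<^sub>F n in sequentially. 0 < phi_hat (V n)"
proof -
  have "\<forall>\<^sub>F n in sequentially. 1 \<le> ln \<bar>ln (V n)\<bar>" using ln_ln_V by (simp add: filterlim_at_top)
  then show ?thesis by eventually_elim (simp add: phi_hat_def V_pos)
qed

lemma lil_scale_le_phi_hat:
  assumes r: "1 < r"
  shows "\<forall>\<^sub>F k in sequentially. \<forall>n. block r k \<le> n \<longrightarrow> n < block r (Suc k) \<longrightarrow>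
    lil_scale r k \<le> r * phi_hat (V n)"
proof -
  have "\<forall>\<^sub>F k in sequentially. ln (real k) \<le> r * ln (real k * ln r)" using r by real_asymp
  then show ?thesis using eventually_gt_at_top[of 1]
  proof eventually_elim
    case (elim k)
    show ?case
    proof (intro allI impI)
      fix n assume n: "block r k \<le> n" "n < block r (Suc k)"
      have kr: "0 < real k * ln r" using elim r by simp
      have lnk: "0 < ln (real k)" using elim by simp
      have L: "ln (real k * ln r) \<le> ln \<bar>ln (V n)\<bar>"
        using neg_ln_V_block[OF r n(1)] kr by (subst ln_le_cancel_iff) auto
      have L0: "ln k \<le> r * ln \<bar>ln (V n)\<bar>"
        using elim(1) mult_left_mono[OF L, of r] r by linarith
      then have L1: "0 < ln \<bar>ln (V n)\<bar>" using lnk r by (smt (verit) mult_nonneg_nonpos)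
      have "1 < V n * r ^ Suc k" by (rule V_below_block[OF r n(2)])
      then have "1 / r ^ k \<le> r * V n" using r by (simp add: field_simps)
      then have "1 / r ^ k * ln k \<le> (r * V n) * (r * ln \<bar>ln (V n)\<bar>)"
        using L0 lnk r V_pos[of n] by (intro mult_mono) (auto simp: less_imp_le)
      then have "2 * ln k / r ^ k \<le> r\<^sup>2 * (2 * V n * ln \<bar>ln (V n)\<bar>)"
        by (simp add: power2_eq_square mult_ac)
      then have "lil_scale r k \<le> sqrt (r\<^sup>2 * (2 * V n * ln \<bar>ln (V n)\<bar>))"
        unfolding lil_scale_def by (rule real_sqrt_le_mono)
      also have "\<dots> = r * phi_hat (V n)" using r by (simp add: phi_hat_def real_sqrt_mult)
      finally show "lil_scale r k \<le> r * phi_hat (V n)" .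
    qed
  qed
qed

text \<open>
  Inside a block, the remainder at time \<open>n\<close> is the remainder at the beginning of the block minus the
  sum over the part of the block before \<open>n\<close>. The first is controlled with \<open>q = 1\<close>, the second with
  \<open>q = 1 - 1 / r\<^sup>2\<close>, which is negligible for \<open>r\<close> close to 1.
\<close>

lemma tail_upper_block:
  assumes r: "1 < r"
  shows "AE w in M. \<forall>\<^sub>F n in sequentially.
    tail n w \<le> r\<^sup>2 * (1 + sqrt (1 - 1 / r\<^sup>2)) * phi_hat (V n)"
proof -
  interpret neg: tail_martingale M F "\<lambda>n w. - \<xi> n w" s c V K "\<lambda>w. - W w" by (rule tail_martingale_negated)
  define q where "q = 1 - 1 / r\<^sup>2"
  have q: "0 < q" using r by (simp add: q_def)
  have "AE w in M. \<forall>\<^sub>F k in sequentially. \<forall>N\<in>{block r k..}.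
    (\<Sum>j\<in>{block r k..<N}. \<xi> j w) < r * sqrt 1 * lil_scale r k"
  proof (rule block_maximum_bound[OF r r])
    have H: "(V (block r k) - V N) * r ^ k \<le> V (block r k) * r ^ k" for k N
      using V_pos[of N] r by (intro mult_right_mono) auto
    show "\<forall>\<^sub>F k in sequentially. \<forall>N\<in>{block r k..}. (V (block r k) - V N) * r ^ k \<le> 1"
      by (intro always_eventually allI ballI order_trans[OF H V_block_le[OF r]])
  qed auto
  moreover have "AE w in M. \<forall>\<^sub>F k in sequentially. \<forall>N\<in>{block r k..block r (Suc k)}.
    (\<Sum>j\<in>{block r k..<N}. - \<xi> j w) < r * sqrt q * lil_scale r k"
  proof (rule neg.block_maximum_bound[OF r r q])
    have "\<forall>\<^sub>F k in sequentially. 1 / r < V (block r (Suc k)) * r ^ Suc k"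
      using r by (intro order_tendstoD(1)[OF LIMSEQ_Suc[OF V_block_lim]]) auto
    then show "\<forall>\<^sub>F k in sequentially. \<forall>N\<in>{block r k..block r (Suc k)}. (V (block r k) - V N) * r ^ k \<le> q"
    proof eventually_elim
      case (elim k)
      show ?case
      proof
        fix N assume N: "N \<in> {block r k..block r (Suc k)}"
        have "1 / r\<^sup>2 \<le> V (block r (Suc k)) * r ^ k"
          using elim r by (simp add: field_simps power2_eq_square)
        also have "\<dots> \<le> V N * r ^ k" using N r by (intro mult_right_mono V_antimono) auto
        finally show "(V (block r k) - V N) * r ^ k \<le> q"
          using V_block_le[OF r, of k] by (simp add: q_def left_diff_distrib)
      qed
    qed
  qed auto
  ultimately show ?thesis using tail_lim
  proof eventually_elim
    case (elim w)
    note lim = elim(3)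
    from elim(1,2) lil_scale_le_phi_hat[OF r]
    have "\<forall>\<^sub>F k in sequentially. \<forall>n. block r k \<le> n \<longrightarrow> n < block r (Suc k) \<longrightarrow>
      tail n w \<le> r\<^sup>2 * (1 + sqrt q) * phi_hat (V n)"
    proof eventually_elim
      case (elim k)
      show ?case
      proof (intro allI impI)
        fix n assume n: "block r k \<le> n" "n < block r (Suc k)"
        have "tail (block r k) w \<le> r * lil_scale r k"
        proof (rule LIMSEQ_le_const2)
          show "(\<lambda>m. \<Sum>j\<in>{block r k..<m}. \<xi> j w) \<longlonglongrightarrow> tail (block r k) w" using lim by blast
          show "\<exists>N. \<forall>m\<ge>N. (\<Sum>j\<in>{block r k..<m}. \<xi> j w) \<le> r * lil_scale r k"
            using elim(1) by (intro exI[of _ "block r k"] allI impI less_imp_le) simp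
        qed
        moreover have "tail (block r k) w = (\<Sum>j\<in>{block r k..<n}. \<xi> j w) + tail n w"
          by (rule tail_split[OF n(1)])
        moreover have "- (\<Sum>j\<in>{block r k..<n}. \<xi> j w) < r * sqrt q * lil_scale r k"
          using bspec[OF elim(2), of n] n by (simp add: sum_negf)
        ultimately have "tail n w \<le> r * (1 + sqrt q) * lil_scale r k" by (simp add: algebra_simps)
        also have "\<dots> \<le> r * (1 + sqrt q) * (r * phi_hat (V n))"
          using elim(3) n r q by (intro mult_left_mono) auto
        finally show "tail n w \<le> r\<^sup>2 * (1 + sqrt q) * phi_hat (V n)"
          by (simp add: power2_eq_square mult_ac)
      qed
    qed
    then obtain k0 where k0: "\<And>k n. k0 \<le> k \<Longrightarrow> block r k \<le> n \<Longrightarrow> n < block r (Suc k) \<Longrightarrow>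
        tail n w \<le> r\<^sup>2 * (1 + sqrt q) * phi_hat (V n)"
      unfolding eventually_sequentially by blast
    show ?case
      using eventually_ge_at_top[of "block r k0"]
    proof eventually_elim
      case (elim n)
      then obtain k where k: "k0 \<le> k" "block r k \<le> n" "n < block r (Suc k)"
        using block_search[OF r] by blast
      from k0[OF this] show ?case by (simp only: q_def)
    qed
  qed
qed

lemma tail_upper:
  assumes "0 < \<delta>"
  shows "AE w in M. \<forall>\<^sub>F n in sequentially. tail n w \<le> (1 + \<delta>) * phi_hat (V n)"
proof -
  have "((\<lambda>r::real. r\<^sup>2 * (1 + sqrt (1 - 1 / r\<^sup>2))) \<longlongrightarrow> 1\<^sup>2 * (1 + sqrt (1 - 1 / 1\<^sup>2))) (at_right 1)"
    by (intro tendsto_intros) auto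
  then have "\<forall>\<^sub>F r::real in at_right 1. r\<^sup>2 * (1 + sqrt (1 - 1 / r\<^sup>2)) < 1 + \<delta>"
    using assms by (intro order_tendstoD(2)) auto
  then have "\<forall>\<^sub>F r::real in at_right 1. 1 < r \<and> r\<^sup>2 * (1 + sqrt (1 - 1 / r\<^sup>2)) < 1 + \<delta>"
    using eventually_at_right_less[of 1] by eventually_elim auto
  then obtain r :: real where r: "1 < r" "r\<^sup>2 * (1 + sqrt (1 - 1 / r\<^sup>2)) < 1 + \<delta>"
    using eventually_happens trivial_limit_at_right_real by blast
  show ?thesis using tail_upper_block[OF r(1)]
  proof eventually_elim
    case (elim w)
    then show ?case using phi_hat_V_pos
    proof eventually_elim
      case (elim n)
      then show ?case using mult_right_mono[of _ "1 + \<delta>" "phi_hat (V n)"] r(2)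
        by (meson less_imp_le order_trans)
    qed
  qed
qed

lemma phi_hat_block_lim:
  assumes r: "1 < r"
  shows "(\<lambda>k. phi_hat (V (block r k)) / lil_scale r k) \<longlonglongrightarrow> 1"
proof -
  have y: "(\<lambda>k. V (block r k) * r ^ k) \<longlonglongrightarrow> 1" by (rule V_block_lim[OF r])
  have l: "(\<lambda>k. ln (V (block r k) * r ^ k)) \<longlonglongrightarrow> ln 1" by (intro tendsto_intros y) auto
  have "(\<lambda>k. ln r - ln (V (block r k) * r ^ k) * (1 / real k)) \<longlonglongrightarrow> ln r - ln 1 * 0"
    by (intro tendsto_diff tendsto_mult tendsto_const l lim_inverse_n')
  then have "(\<lambda>k. ln (ln r - ln (V (block r k) * r ^ k) * (1 / real k))) \<longlonglongrightarrow> ln (ln r)"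
    using r by (intro tendsto_ln) auto
  moreover have "((\<lambda>k. 1 / ln (real k)) \<longlonglongrightarrow> 0)" by real_asymp
  ultimately have "(\<lambda>k. 1 + ln (ln r - ln (V (block r k) * r ^ k) * (1 / real k)) * (1 / ln (real k))) \<longlonglongrightarrow> 1 + ln (ln r) * 0"
    by (intro tendsto_add tendsto_mult tendsto_const)
  then have "(\<lambda>k. sqrt ((V (block r k) * r ^ k) *
      (1 + ln (ln r - ln (V (block r k) * r ^ k) * (1 / real k)) * (1 / ln (real k))))) \<longlonglongrightarrow> sqrt (1 * (1 + ln (ln r) * 0))"
    by (intro tendsto_real_sqrt tendsto_mult y)
  then have "(\<lambda>k. sqrt ((V (block r k) * r ^ k) *
      (1 + ln (ln r - ln (V (block r k) * r ^ k) * (1 / real k)) * (1 / ln (real k))))) \<longlonglongrightarrow> 1" by simp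
  moreover have "\<forall>\<^sub>F k in sequentially. sqrt ((V (block r k) * r ^ k) *
      (1 + ln (ln r - ln (V (block r k) * r ^ k) * (1 / real k)) * (1 / ln (real k))))
      = phi_hat (V (block r k)) / lil_scale r k"
    using eventually_gt_at_top[of 1]
  proof eventually_elim
    case (elim k)
    define A where "A = V (block r k)"
    have A: "0 < A" by (simp add: A_def V_pos)
    have k: "1 < real k" "0 < ln (real k)" using elim by auto
    have nl: "k * ln r \<le> - ln A" using neg_ln_V_block[OF r order_refl] by (simp add: A_def)
    have "0 < k * ln r" using k r by simp
    then have abs: "\<bar>ln A\<bar> = - ln A" "0 < - ln A" using nl by auto
    have e: "ln r - ln (A * r ^ k) * (1 / real k) = \<bar>ln A\<bar> / k"
      using A r k by (simp add: ln_mult ln_realpow abs field_simps)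
    have "ln (ln r - ln (A * r ^ k) * (1 / real k)) = ln \<bar>ln A\<bar> - ln k"
      unfolding e abs(1) using abs(2) k(1) ln_div[of "- ln A" "real k"] by simp
    then have 1: "1 + ln (ln r - ln (A * r ^ k) * (1 / real k)) * (1 / ln (real k)) = ln \<bar>ln A\<bar> / ln k"
      using k by (simp add: field_simps)
    show ?case
      unfolding phi_hat_def lil_scale_def A_def[symmetric] 1 real_sqrt_divide[symmetric]
      using k r by (simp add: field_simps)
  qed
  ultimately show ?thesis by (rule Lim_transform_eventually)
qed

lemma lil_scale_Suc_lim:
  assumes r: "1 < r"
  shows "(\<lambda>k. lil_scale r (Suc k) / lil_scale r k) \<longlonglongrightarrow> 1 / sqrt r"
proof -
  have "(\<lambda>k. ln (real (Suc k)) / ln (real k)) \<longlonglongrightarrow> 1" by real_asymp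
  then have "(\<lambda>k. sqrt (ln (real (Suc k)) / ln (real k) / r)) \<longlonglongrightarrow> sqrt (1 / r)"
    using r by (intro tendsto_intros) auto
  moreover have "sqrt (ln (real (Suc k)) / ln (real k) / r) = lil_scale r (Suc k) / lil_scale r k" for k
    unfolding lil_scale_def real_sqrt_divide[symmetric] using r by simp
  ultimately show ?thesis by (simp add: real_sqrt_divide)
qed

end

section \<open>The lower bound in the law of the iterated logarithm\<close>

text \<open>
  The numerical core of Kolmogorov's lower bound. In units of \<open>a\<^sup>2\<close>, the right-hand sides are the
  exponent of the exponential moment at the tilt \<open>1 + \<delta>\<close>; the first two left-hand sides, without
  \<open>\<delta>\<^sup>2 / 4\<close>, are those of its parts below \<open>a\<close> and above \<open>(1 + 2 \<delta>) a\<close>, obtained from the tilts \<open>1\<close>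
  and \<open>1 + 2 \<delta>\<close>. The gap is \<open>\<delta>\<^sup>2 / 2\<close> in the exact Gaussian case, and \<open>\<eta> = \<delta>\<^sup>2 / 80\<close> is small enough
  to keep half of it. The last inequality gives the exponent that is left after division by the
  maximal density of the tilt.
\<close>

lemma tilting_exponents:
  fixes \<delta> \<eta> :: real
  assumes \<delta>: "0 < \<delta>" "\<delta> \<le> 1" and \<eta>: "\<eta> = \<delta>\<^sup>2 / 80"
  shows "\<delta> + (1 + \<eta>)\<^sup>2 / 2 + \<delta>\<^sup>2 / 4 \<le> (1 + \<delta>)\<^sup>2 / 2 * ((1 - 2 * \<eta>) * (1 - \<eta>))"
    "- \<delta> * (1 + 2 * \<delta>) + (1 + 2 * \<delta>)\<^sup>2 / 2 * (1 + \<eta>)\<^sup>2 + \<delta>\<^sup>2 / 4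
      \<le> (1 + \<delta>)\<^sup>2 / 2 * ((1 - 2 * \<eta>) * (1 - \<eta>))"
    "(1 + \<delta>) * (1 + 2 * \<delta>) - (1 / 2 + 4 * \<delta>) \<le> (1 + \<delta>)\<^sup>2 / 2 * ((1 - 2 * \<eta>) * (1 - \<eta>))"
proof -
  have d2: "\<delta>\<^sup>2 \<le> \<delta>" using \<delta> by (simp add: power2_eq_square mult_left_le)
  have h: "0 \<le> \<eta>" "\<eta> \<le> 1 / 80" using d2 \<delta> by (auto simp: \<eta>)
  have h2: "\<eta>\<^sup>2 \<le> \<eta>" using h by (simp add: power2_eq_square mult_left_le)
  have up: "(1 + \<eta>)\<^sup>2 \<le> 1 + 3 * \<eta>" using h2 by (simp add: power2_eq_square algebra_simps)
  have lo: "1 - 3 * \<eta> \<le> (1 - 2 * \<eta>) * (1 - \<eta>)" using h by (simp add: algebra_simps)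
  have "(1 + \<delta>)\<^sup>2 \<le> 2\<^sup>2" using \<delta> by (intro power_mono) auto
  then have s1: "(1 + \<delta>)\<^sup>2 / 2 * (3 * \<eta>) \<le> 4 / 2 * (3 * \<eta>)" using h by (intro mult_right_mono) auto
  have "(1 + \<delta>)\<^sup>2 / 2 * (1 - 3 * \<eta>) \<le> (1 + \<delta>)\<^sup>2 / 2 * ((1 - 2 * \<eta>) * (1 - \<eta>))"
    by (intro mult_left_mono lo) auto
  moreover have "1 / 2 + \<delta> + \<delta>\<^sup>2 / 2 - 6 * \<eta> \<le> (1 + \<delta>)\<^sup>2 / 2 * (1 - 3 * \<eta>)"
    using s1 by (simp add: power2_eq_square algebra_simps)
  ultimately have main: "1 / 2 + \<delta> + \<delta>\<^sup>2 / 2 - 6 * \<eta> \<le> (1 + \<delta>)\<^sup>2 / 2 * ((1 - 2 * \<eta>) * (1 - \<eta>))"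
    by linarith
  show "\<delta> + (1 + \<eta>)\<^sup>2 / 2 + \<delta>\<^sup>2 / 4 \<le> (1 + \<delta>)\<^sup>2 / 2 * ((1 - 2 * \<eta>) * (1 - \<eta>))"
  proof (rule order_trans[OF _ main])
    show "\<delta> + (1 + \<eta>)\<^sup>2 / 2 + \<delta>\<^sup>2 / 4 \<le> 1 / 2 + \<delta> + \<delta>\<^sup>2 / 2 - 6 * \<eta>"
      using up \<eta> h by linarith
  qed
  have "(1 + 2 * \<delta>)\<^sup>2 \<le> 3\<^sup>2" using \<delta> by (intro power_mono) auto
  then have "(1 + 2 * \<delta>)\<^sup>2 / 2 * (3 * \<eta>) \<le> 9 / 2 * (3 * \<eta>)" using h by (intro mult_right_mono) auto
  moreover have "(1 + 2 * \<delta>)\<^sup>2 / 2 * (1 + \<eta>)\<^sup>2 \<le> (1 + 2 * \<delta>)\<^sup>2 / 2 * (1 + 3 * \<eta>)"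
    by (intro mult_left_mono up) auto
  moreover have "(1 + 2 * \<delta>)\<^sup>2 / 2 * (1 + 3 * \<eta>) = (1 + 2 * \<delta>)\<^sup>2 / 2 + (1 + 2 * \<delta>)\<^sup>2 / 2 * (3 * \<eta>)"
    by (simp only: distrib_left mult_1_right)
  moreover have "(1 + 2 * \<delta>)\<^sup>2 / 2 = 1 / 2 + 2 * \<delta> + 2 * \<delta>\<^sup>2"
    by (simp add: power2_eq_square field_simps)
  moreover have "- \<delta> * (1 + 2 * \<delta>) = - \<delta> - 2 * \<delta>\<^sup>2" by (simp add: power2_eq_square algebra_simps)
  ultimately show "- \<delta> * (1 + 2 * \<delta>) + (1 + 2 * \<delta>)\<^sup>2 / 2 * (1 + \<eta>)\<^sup>2 + \<delta>\<^sup>2 / 4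
      \<le> (1 + \<delta>)\<^sup>2 / 2 * ((1 - 2 * \<eta>) * (1 - \<eta>))"
    using main \<eta> h by linarith
  have "(1 + \<delta>) * (1 + 2 * \<delta>) = 1 + 3 * \<delta> + 2 * \<delta>\<^sup>2" by (simp add: power2_eq_square algebra_simps)
  then show "(1 + \<delta>) * (1 + 2 * \<delta>) - (1 / 2 + 4 * \<delta>) \<le> (1 + \<delta>)\<^sup>2 / 2 * ((1 - 2 * \<eta>) * (1 - \<eta>))"
    using main \<eta> d2 \<delta> by linarith
qed

context tail_martingale
begin

definition typical :: "real \<Rightarrow> nat \<Rightarrow> 'a \<Rightarrow> bool" where
  "typical \<eta> j w \<longleftrightarrow> (1 - \<eta>) * v j \<le> s j w \<and> s j w \<le> (1 + \<eta>) * v j"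

text \<open>
  For lower bounds an atypical increment cannot be dropped, since its variance would be missing. It is
  replaced by \<open>\<theta> v j\<close>, the mean that a Gaussian increment of variance \<open>v j\<close> has
  after exponential tilting by \<open>\<theta>\<close>.
\<close>

definition patched :: "real \<Rightarrow> real \<Rightarrow> nat \<Rightarrow> 'a \<Rightarrow> real" where
  "patched \<eta> \<theta> j w = (if typical \<eta> j w then \<xi> j w else \<theta> * v j)"

definition patch_var :: "real \<Rightarrow> nat \<Rightarrow> 'a \<Rightarrow> real" where
  "patch_var \<eta> j w = (if typical \<eta> j w then 0 else v j)"

lemma typical_set: "{w \<in> space M. typical \<eta> j w} \<in> sets (F j)"
proof -
  have "{w \<in> space M. typical \<eta> j w} =
    {w \<in> space (F j). (1 - \<eta>) * v j \<le> s j w} \<inter> {w \<in> space (F j). s j w \<le> (1 + \<eta>) * v j}"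
    by (auto simp: typical_def)
  then show ?thesis
    using var_meas[of j] borel_measurable_iff_ge[of "s j" "F j"] borel_measurable_iff_le[of "s j" "F j"]
    by auto
qed

lemma patched_adapted: "j < n \<Longrightarrow> bounded_adapted n (patched \<eta> \<theta> j)"
  unfolding patched_def using typical_set[of \<eta> j] filtration[of j n]
  by (intro bounded_adapted_intros) auto

lemma patch_var_adapted: "j < n \<Longrightarrow> bounded_adapted n (patch_var \<eta> j)"
  unfolding patch_var_def using typical_set[of \<eta> j] filtration[of j n]
  by (intro bounded_adapted_intros) auto

text \<open>
  The exponential moment at \<open>l\<close> of the patched sum, where every patched step is weighted by
  \<open>exp (- \<theta>\<^sup>2 v j / 2)\<close>. A patched step then contributes \<open>exp ((l \<theta> - \<theta>\<^sup>2 / 2) v j)\<close>, at most the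
  Gaussian value \<open>exp (l\<^sup>2 v j / 2)\<close>, with equality for \<open>l = \<theta>\<close>.
\<close>

definition tilt :: "real \<Rightarrow> real \<Rightarrow> nat \<Rightarrow> nat \<Rightarrow> real \<Rightarrow> 'a \<Rightarrow> real" where
  "tilt \<eta> \<theta> n m l w = exp (l * (\<Sum>j\<in>{n..<m}. patched \<eta> \<theta> j w)
     - \<theta>\<^sup>2 / 2 * (\<Sum>j\<in>{n..<m}. patch_var \<eta> j w))"

lemma tilt_adapted: "m \<le> i \<Longrightarrow> bounded_adapted i (tilt \<eta> \<theta> n m l)"
  unfolding tilt_def diff_conv_add_uminus mult_minus_left[symmetric]
  by (intro bounded_adapted_intros patched_adapted patch_var_adapted) auto

lemma tilt_step:
  assumes g: "bounded_adapted n g" "\<And>w. w \<in> space M \<Longrightarrow> 0 \<le> g w"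
    and \<eta>: "0 \<le> \<eta>" "\<eta> \<le> 1 / 2" and l: "\<bar>l\<bar> * c n \<le> \<eta>" "l\<^sup>2 / 2 * v n \<le> \<eta>"
  shows "(\<integral>w. g w * exp (l * patched \<eta> \<theta> n w - \<theta>\<^sup>2 / 2 * patch_var \<eta> n w) \<partial>M)
      \<le> exp (l\<^sup>2 / 2 * (1 + \<eta>)\<^sup>2 * v n) * (\<integral>w. g w \<partial>M)" (is "?I \<le> ?up * _")
    and "l = \<theta> \<Longrightarrow> exp (l\<^sup>2 / 2 * ((1 - 2 * \<eta>) * (1 - \<eta>)) * v n) * (\<integral>w. g w \<partial>M)
      \<le> (\<integral>w. g w * exp (l * patched \<eta> \<theta> n w - \<theta>\<^sup>2 / 2 * patch_var \<eta> n w) \<partial>M)"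
proof -
  note v = v_pos[of n]
  define a where "a w = (if typical \<eta> n w then g w else 0)" for w
  define b where "b w = (if typical \<eta> n w then 0 else g w)" for w
  have ba: "bounded_adapted n a" "bounded_adapted n b" unfolding a_def b_def
    by (intro bounded_adapted_intros typical_set g)+
  have i: "integrable M (\<lambda>w. a w * exp (l * \<xi> n w))"
    by (rule bounded_adapted_integrable[of "Suc n"])
       (auto intro!: bounded_adapted_intros bounded_adapted_mono[OF ba(1)])
  note ia = bounded_adapted_integrable[OF ba(1)] and ib = bounded_adapted_integrable[OF ba(2)]
  have b0: "0 \<le> (\<integral>w. b w \<partial>M)" using g(2) by (intro Bochner_Integration.integral_nonneg) (auto simp: b_def)
  have a0: "0 \<le> (\<integral>w. a w \<partial>M)" using g(2) by (intro Bochner_Integration.integral_nonneg) (auto simp: a_def)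
  define E where "E = exp ((l * \<theta> - \<theta>\<^sup>2 / 2) * v n)"
  have "?I = (\<integral>w. a w * exp (l * \<xi> n w) + E * b w \<partial>M)"
    by (intro Bochner_Integration.integral_cong)
       (auto simp: a_def b_def E_def patched_def patch_var_def algebra_simps)
  also have "\<dots> = (\<integral>w. a w * exp (l * \<xi> n w) \<partial>M) + E * (\<integral>w. b w \<partial>M)"
    using i ib by simp
  finally have I: "?I = (\<integral>w. a w * exp (l * \<xi> n w) \<partial>M) + E * (\<integral>w. b w \<partial>M)" .
  have "(\<integral>w. g w \<partial>M) = (\<integral>w. a w + b w \<partial>M)"
    by (intro Bochner_Integration.integral_cong) (auto simp: a_def b_def)
  then have G: "(\<integral>w. g w \<partial>M) = (\<integral>w. a w \<partial>M) + (\<integral>w. b w \<partial>M)" using ia ib by simp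
  have "l\<^sup>2 / 2 * (1 + \<eta>) * ((1 + \<eta>) * v n) = l\<^sup>2 / 2 * (1 + \<eta>)\<^sup>2 * v n"
    by (simp add: power2_eq_square mult_ac)
  moreover have "(\<integral>w. a w * exp (l * \<xi> n w) \<partial>M) \<le> exp (l\<^sup>2 / 2 * (1 + \<eta>) * ((1 + \<eta>) * v n)) * (\<integral>w. a w \<partial>M)"
    by (rule exp_incr_upper[OF ba(1)]) (use g(2) l \<eta> in \<open>auto simp: a_def typical_def split: if_splits\<close>)
  ultimately have "(\<integral>w. a w * exp (l * \<xi> n w) \<partial>M) \<le> ?up * (\<integral>w. a w \<partial>M)" by (simp only:)
  moreover have "E \<le> ?up"
  proof -
    have "0 \<le> (l - \<theta>)\<^sup>2" by simp
    then have "l * \<theta> - \<theta>\<^sup>2 / 2 \<le> l\<^sup>2 / 2" by (simp add: power2_eq_square algebra_simps)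
    also have "\<dots> \<le> l\<^sup>2 / 2 * (1 + \<eta>)\<^sup>2" using \<eta> by (simp add: mult_le_cancel_left1)
    finally show ?thesis unfolding E_def using v by simp
  qed
  ultimately show "?I \<le> ?up * (\<integral>w. g w \<partial>M)"
    unfolding I G distrib_left using b0 by (intro add_mono mult_right_mono) auto
  assume l\<theta>: "l = \<theta>"
  let ?lo = "exp (l\<^sup>2 / 2 * ((1 - 2 * \<eta>) * (1 - \<eta>)) * v n)"
  have "exp (l\<^sup>2 / 2 * (1 - 2 * \<eta>) * ((1 - \<eta>) * v n)) * (\<integral>w. a w \<partial>M) \<le> (\<integral>w. a w * exp (l * \<xi> n w) \<partial>M)"
  proof (rule exp_incr_lower[OF ba(1)])
    have "l\<^sup>2 / 2 * ((1 - \<eta>) * v n) \<le> l\<^sup>2 / 2 * (1 * v n)"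
      using \<eta> v by (intro mult_left_mono mult_right_mono) auto
    then show "l\<^sup>2 / 2 * ((1 - \<eta>) * v n) \<le> \<eta>" using l(2) by simp
  qed (use g(2) l \<eta> v in \<open>auto simp: a_def typical_def split: if_splits\<close>)
  moreover have "l\<^sup>2 / 2 * (1 - 2 * \<eta>) * ((1 - \<eta>) * v n) = l\<^sup>2 / 2 * ((1 - 2 * \<eta>) * (1 - \<eta>)) * v n"
    by (simp only: mult_ac)
  ultimately have "?lo * (\<integral>w. a w \<partial>M) \<le> (\<integral>w. a w * exp (l * \<xi> n w) \<partial>M)" by (simp only:)
  moreover have "?lo \<le> E"
  proof -
    have "(1 - 2 * \<eta>) * (1 - \<eta>) \<le> 1 * 1" using \<eta> by (intro mult_mono) auto
    then have "l\<^sup>2 / 2 * ((1 - 2 * \<eta>) * (1 - \<eta>)) \<le> l\<^sup>2 / 2 * 1" by (intro mult_left_mono) auto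
    also have "\<dots> = l * \<theta> - \<theta>\<^sup>2 / 2" by (simp add: l\<theta> power2_eq_square)
    finally show ?thesis unfolding E_def using v by simp
  qed
  ultimately show "?lo * (\<integral>w. g w \<partial>M) \<le> ?I"
    unfolding I G distrib_left using b0 by (intro add_mono mult_right_mono) auto
qed

lemma tilt_bounds:
  assumes "n \<le> m" and g: "bounded_adapted n g" "\<And>w. w \<in> space M \<Longrightarrow> 0 \<le> g w"
    and \<eta>: "0 \<le> \<eta>" "\<eta> \<le> 1 / 2"
    and l: "\<And>j. n \<le> j \<Longrightarrow> \<bar>l\<bar> * c j \<le> \<eta>" "\<And>j. n \<le> j \<Longrightarrow> l\<^sup>2 / 2 * v j \<le> \<eta>"
  shows "(\<integral>w. g w * tilt \<eta> \<theta> n m l w \<partial>M)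
      \<le> exp (l\<^sup>2 / 2 * (1 + \<eta>)\<^sup>2 * (V n - V m)) * (\<integral>w. g w \<partial>M)"
    and "l = \<theta> \<Longrightarrow> exp (l\<^sup>2 / 2 * ((1 - 2 * \<eta>) * (1 - \<eta>)) * (V n - V m)) * (\<integral>w. g w \<partial>M)
      \<le> (\<integral>w. g w * tilt \<eta> \<theta> n m l w \<partial>M)"
proof -
  let ?A = "l\<^sup>2 / 2 * (1 + \<eta>)\<^sup>2" and ?B = "l\<^sup>2 / 2 * ((1 - 2 * \<eta>) * (1 - \<eta>))"
  have "(\<integral>w. g w * tilt \<eta> \<theta> n m l w \<partial>M) \<le> exp (?A * (V n - V m)) * (\<integral>w. g w \<partial>M)
    \<and> (l = \<theta> \<longrightarrow> exp (?B * (V n - V m)) * (\<integral>w. g w \<partial>M) \<le> (\<integral>w. g w * tilt \<eta> \<theta> n m l w \<partial>M))"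
    using \<open>n \<le> m\<close>
  proof (induction m rule: dec_induct)
    case base
    then show ?case by (simp add: tilt_def)
  next
    case (step m)
    define h where "h w = g w * tilt \<eta> \<theta> n m l w" for w
    have h1: "bounded_adapted m h"
      unfolding h_def using step.hyps
      by (intro bounded_adapted_mult bounded_adapted_mono[OF g(1)] tilt_adapted) auto
    have h2: "\<And>w. w \<in> space M \<Longrightarrow> 0 \<le> h w" using g(2) by (simp add: h_def tilt_def)
    have eq: "g w * tilt \<eta> \<theta> n (Suc m) l w
      = h w * exp (l * patched \<eta> \<theta> m w - \<theta>\<^sup>2 / 2 * patch_var \<eta> m w)" for w
    proof -
      have "l * (\<Sum>j\<in>{n..<Suc m}. patched \<eta> \<theta> j w) - \<theta>\<^sup>2 / 2 * (\<Sum>j\<in>{n..<Suc m}. patch_var \<eta> j w)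
        = (l * (\<Sum>j\<in>{n..<m}. patched \<eta> \<theta> j w) - \<theta>\<^sup>2 / 2 * (\<Sum>j\<in>{n..<m}. patch_var \<eta> j w))
          + (l * patched \<eta> \<theta> m w - \<theta>\<^sup>2 / 2 * patch_var \<eta> m w)"
        using step.hyps by (simp only: sum.atLeastLessThan_Suc distrib_left)
      then show ?thesis unfolding h_def tilt_def by (simp only: exp_add mult.assoc)
    qed
    have V: "V n - V (Suc m) = v m + (V n - V m)" by (simp add: v_def)
    let ?I = "\<integral>w. h w * exp (l * patched \<eta> \<theta> m w - \<theta>\<^sup>2 / 2 * patch_var \<eta> m w) \<partial>M"
    have st1: "?I \<le> exp (?A * v m) * (\<integral>w. h w \<partial>M)"
      by (rule tilt_step(1)[OF h1 h2 \<eta>]) (use l step.hyps in auto)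
    have st2: "exp (?B * v m) * (\<integral>w. h w \<partial>M) \<le> ?I" if "l = \<theta>"
      by (rule tilt_step(2)[OF h1 h2 \<eta> _ _ that]) (use l step.hyps in auto)
    have up: "exp (?A * (V n - V (Suc m))) = exp (?A * v m) * exp (?A * (V n - V m))"
      unfolding V distrib_left exp_add ..
    have lo: "exp (?B * (V n - V (Suc m))) = exp (?B * v m) * exp (?B * (V n - V m))"
      unfolding V distrib_left exp_add ..
    have u: "exp (?A * v m) * (\<integral>w. h w \<partial>M) \<le> exp (?A * (V n - V (Suc m))) * (\<integral>w. g w \<partial>M)"
      using mult_left_mono[OF conjunct1[OF step.IH], of "exp (?A * v m)"]
      unfolding up h_def by (simp only: mult.assoc exp_ge_zero simp_thms)
    have d: "exp (?B * (V n - V (Suc m))) * (\<integral>w. g w \<partial>M) \<le> exp (?B * v m) * (\<integral>w. h w \<partial>M)" if "l = \<theta>"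
      using mult_left_mono[OF mp[OF conjunct2[OF step.IH] that], of "exp (?B * v m)"]
      unfolding lo h_def by (simp only: mult.assoc exp_ge_zero simp_thms)
    show ?case
      unfolding eq using order_trans[OF st1 u] order_trans[OF d st2] by blast
  qed
  then show "(\<integral>w. g w * tilt \<eta> \<theta> n m l w \<partial>M) \<le> exp (?A * (V n - V m)) * (\<integral>w. g w \<partial>M)"
    "l = \<theta> \<Longrightarrow> exp (?B * (V n - V m)) * (\<integral>w. g w \<partial>M) \<le> (\<integral>w. g w * tilt \<eta> \<theta> n m l w \<partial>M)"
    by auto
qed

text \<open>
  Kolmogorov's lower exponential bound, conditionally on the past of the block. Under the tilt
  \<open>\<theta>\<close> the patched sum \<open>U\<close> concentrates between \<open>a b\<close> and \<open>(1 + 2 \<delta>) a b\<close>: the parts of the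
  exponential moment from the other values are dominated by the exponential moments at \<open>l1\<close> and \<open>l3\<close>,
  which are much smaller. On the remaining interval the density of the tilt is at most \<open>e0\<close>, so the
  probability of the interval is at least half of the exponential moment divided by \<open>e0\<close>.
\<close>

lemma block_lower_tail:
  assumes nm: "n < m" and g: "bounded_adapted n g" "\<And>w. w \<in> space M \<Longrightarrow> 0 \<le> g w"
    and \<delta>: "0 < \<delta>" "\<delta> \<le> 1" and \<eta>: "\<eta> = \<delta>\<^sup>2 / 80" and a: "0 < a" "8 \<le> a\<^sup>2 * \<delta>\<^sup>2"
    and b: "b = sqrt (V n - V m)"
    and small: "\<And>j. n \<le> j \<Longrightarrow> (1 + 2 * \<delta>) * a / b * c j \<le> \<eta>"
      "\<And>j. n \<le> j \<Longrightarrow> ((1 + 2 * \<delta>) * a / b)\<^sup>2 / 2 * v j \<le> \<eta>"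
    and \<theta>: "\<theta> = (1 + \<delta>) * a / b"
  shows "exp (- a\<^sup>2 * (1 / 2 + 4 * \<delta>)) / 2 * (\<integral>w. g w \<partial>M)
    \<le> (\<integral>w. g w * (if a * b < (\<Sum>j\<in>{n..<m}. patched \<eta> \<theta> j w) then 1 else 0) \<partial>M)"
proof -
  define U where "U w = (\<Sum>j\<in>{n..<m}. patched \<eta> \<theta> j w)" for w
  define Z where "Z = tilt \<eta> \<theta> n m"
  define G where "G = (\<integral>w. g w \<partial>M)"
  define P where "P = (\<integral>w. g w * (if a * b < U w then 1 else 0) \<partial>M)"
  define l1 l3 where "l1 = a / b" and "l3 = (1 + 2 * \<delta>) * a / b"
  have "V m < V n" using sum_v[of n m] nm v_pos sum_pos[of "{n..<m}" v] by auto
  then have b0: "0 < b" "b\<^sup>2 = V n - V m" by (auto simp: b)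
  have d2: "\<delta>\<^sup>2 \<le> 1" using \<delta> by (simp add: power2_eq_square mult_le_one)
  then have \<eta>0: "0 \<le> \<eta>" "\<eta> \<le> 1 / 2" by (auto simp: \<eta>)
  have G0: "0 \<le> G" unfolding G_def using g(2) by (intro Bochner_Integration.integral_nonneg) auto
  have ord: "0 < l1" "l1 \<le> \<theta>" "\<theta> \<le> l3"
    unfolding l1_def l3_def \<theta> using a \<delta> b0 by (auto intro!: divide_right_mono simp: mult_le_cancel_right1)
  have sm: "\<bar>l\<bar> * c j \<le> \<eta>" "l\<^sup>2 / 2 * v j \<le> \<eta>" if "n \<le> j" "0 < l" "l \<le> l3" for l j
  proof -
    have "\<bar>l\<bar> * c j \<le> l3 * c j" using that c_nonneg[of j] by (intro mult_right_mono) auto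
    then show "\<bar>l\<bar> * c j \<le> \<eta>" using small(1)[OF that(1)] by (simp add: l3_def)
    have "l\<^sup>2 / 2 * v j \<le> l3\<^sup>2 / 2 * v j" using that v_pos[of j]
      by (intro mult_right_mono divide_right_mono power_mono) auto
    then show "l\<^sup>2 / 2 * v j \<le> \<eta>" using small(2)[OF that(1)] by (simp add: l3_def)
  qed
  have l2: "l1\<^sup>2 * (V n - V m) = a\<^sup>2" "\<theta>\<^sup>2 * (V n - V m) = (1 + \<delta>)\<^sup>2 * a\<^sup>2" "l3\<^sup>2 * (V n - V m) = (1 + 2 * \<delta>)\<^sup>2 * a\<^sup>2"
    using b0(1) by (simp_all add: l1_def l3_def \<theta> power_divide power_mult_distrib flip: b0(2))
  note bounds = tilt_bounds[where n = n and m = m and g = g and \<eta> = \<eta> and \<theta> = \<theta>, OF less_imp_le[OF nm] g \<eta>0, folded Z_def G_def]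
  have up1: "(\<integral>w. g w * Z l1 w \<partial>M) \<le> exp (a\<^sup>2 * ((1 + \<eta>)\<^sup>2 / 2)) * G"
  proof -
    have "l1\<^sup>2 / 2 * (1 + \<eta>)\<^sup>2 * (V n - V m) = (l1\<^sup>2 * (V n - V m)) * ((1 + \<eta>)\<^sup>2 / 2)" by simp
    then show ?thesis using bounds(1)[of l1] sm ord by (simp only: l2)
  qed
  have up3: "(\<integral>w. g w * Z l3 w \<partial>M) \<le> exp (a\<^sup>2 * ((1 + 2 * \<delta>)\<^sup>2 / 2 * (1 + \<eta>)\<^sup>2)) * G"
  proof -
    have "l3\<^sup>2 / 2 * (1 + \<eta>)\<^sup>2 * (V n - V m) = (l3\<^sup>2 * (V n - V m)) * ((1 + \<eta>)\<^sup>2 / 2)" by simp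
    also have "\<dots> = a\<^sup>2 * ((1 + 2 * \<delta>)\<^sup>2 / 2 * (1 + \<eta>)\<^sup>2)" unfolding l2 by simp
    finally have eq: "l3\<^sup>2 / 2 * (1 + \<eta>)\<^sup>2 * (V n - V m) = a\<^sup>2 * ((1 + 2 * \<delta>)\<^sup>2 / 2 * (1 + \<eta>)\<^sup>2)" .
    have "(\<integral>w. g w * Z l3 w \<partial>M) \<le> exp (l3\<^sup>2 / 2 * (1 + \<eta>)\<^sup>2 * (V n - V m)) * G"
      by (rule bounds(1)) (use sm ord in auto)
    then show ?thesis by (simp only: eq)
  qed
  define \<mu> where "\<mu> = (1 + \<delta>)\<^sup>2 / 2 * ((1 - 2 * \<eta>) * (1 - \<eta>))"
  have lo: "exp (a\<^sup>2 * \<mu>) * G \<le> (\<integral>w. g w * Z \<theta> w \<partial>M)"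
  proof -
    have "\<theta>\<^sup>2 / 2 * ((1 - 2 * \<eta>) * (1 - \<eta>)) * (V n - V m)
      = (\<theta>\<^sup>2 * (V n - V m)) * ((1 - 2 * \<eta>) * (1 - \<eta>) / 2)" by simp
    also have "\<dots> = a\<^sup>2 * \<mu>" unfolding l2 \<mu>_def by simp
    finally have eq: "\<theta>\<^sup>2 / 2 * ((1 - 2 * \<eta>) * (1 - \<eta>)) * (V n - V m) = a\<^sup>2 * \<mu>" .
    have "exp (\<theta>\<^sup>2 / 2 * ((1 - 2 * \<eta>) * (1 - \<eta>)) * (V n - V m)) * G \<le> (\<integral>w. g w * Z \<theta> w \<partial>M)"
      by (rule bounds(2)) (use sm ord in auto)
    then show ?thesis by (simp only: eq)
  qed
  have gm: "bounded_adapted m g" using g(1) nm by (auto intro: bounded_adapted_mono)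
  have U_ba: "bounded_adapted m U" unfolding U_def by (intro bounded_adapted_intros patched_adapted) auto
  have "{w \<in> space M. a * b < U w} \<in> sets (F m)"
    using bounded_adapted_meas[OF U_ba] borel_measurable_iff_greater[of U "F m"] by auto
  then have iP: "integrable M (\<lambda>w. g w * (if a * b < U w then 1 else 0))"
    by (intro bounded_adapted_integrable[of m] bounded_adapted_intros gm)
  have iZ: "integrable M (\<lambda>w. g w * Z l w)" for l
    unfolding Z_def by (intro bounded_adapted_integrable[of m] bounded_adapted_intros gm tilt_adapted) auto
  define e0 e1 e3 where "e0 = exp (a\<^sup>2 * ((1 + \<delta>) * (1 + 2 * \<delta>)))" and "e1 = exp (a\<^sup>2 * \<delta>)"
    and "e3 = exp (a\<^sup>2 * (- \<delta> * (1 + 2 * \<delta>)))"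
  have "(\<integral>w. g w * Z \<theta> w \<partial>M) \<le> (\<integral>w. e0 * (g w * (if a * b < U w then 1 else 0))
      + e1 * (g w * Z l1 w) + e3 * (g w * Z l3 w) \<partial>M)"
  proof (rule integral_mono)
    fix w assume w: "w \<in> space M"
    have Zsplit: "Z \<theta> w = Z l w * exp ((\<theta> - l) * U w)" for l
      by (simp add: Z_def tilt_def U_def left_diff_distrib flip: exp_add)
    have Zpos: "0 < Z l w" for l by (simp add: Z_def tilt_def)
    have pv: "0 \<le> (\<Sum>j\<in>{n..<m}. patch_var \<eta> j w)"
      by (intro sum_nonneg) (auto simp: patch_var_def less_imp_le[OF v_pos])
    have "Z \<theta> w \<le> e0 * (if a * b < U w then 1 else 0) + e1 * Z l1 w + e3 * Z l3 w"
    proof -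
      consider "U w \<le> a * b" | "(1 + 2 * \<delta>) * (a * b) \<le> U w" | "a * b < U w" "U w < (1 + 2 * \<delta>) * (a * b)"
        by linarith
      then show ?thesis
      proof cases
        case 1
        have "(\<theta> - l1) * U w \<le> (\<theta> - l1) * (a * b)" using 1 ord by (intro mult_left_mono) auto
        also have "\<dots> = a\<^sup>2 * \<delta>" using b0(1) by (simp add: \<theta> l1_def field_simps power2_eq_square)
        finally have "Z \<theta> w \<le> Z l1 w * e1" unfolding Zsplit[of l1] e1_def using Zpos[of l1] by simp
        moreover have "0 \<le> e3 * Z l3 w" using Zpos[of l3] by (simp add: e3_def)
        ultimately show ?thesis using 1 by (simp add: mult.commute)
      next
        case 2
        have "(\<theta> - l3) * U w \<le> (\<theta> - l3) * ((1 + 2 * \<delta>) * (a * b))" using 2 ord by (intro mult_left_mono_neg) auto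
        also have "\<dots> = a\<^sup>2 * (- \<delta> * (1 + 2 * \<delta>))" using b0(1) by (simp add: \<theta> l3_def field_simps power2_eq_square)
        finally have "Z \<theta> w \<le> Z l3 w * e3" unfolding Zsplit[of l3] e3_def using Zpos[of l3] by simp
        moreover have "0 \<le> e1 * Z l1 w" "0 \<le> e0" using Zpos[of l1] by (simp_all add: e1_def e0_def)
        ultimately show ?thesis by (simp add: mult.commute)
      next
        case 3
        have "Z \<theta> w \<le> exp (\<theta> * U w)" using pv by (simp add: Z_def tilt_def U_def)
        also have "\<theta> * U w \<le> \<theta> * ((1 + 2 * \<delta>) * (a * b))" using 3 ord by (intro mult_left_mono) auto
        also have "\<dots> = a\<^sup>2 * ((1 + \<delta>) * (1 + 2 * \<delta>))" using b0(1) by (simp add: \<theta> field_simps power2_eq_square)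
        finally have "Z \<theta> w \<le> e0" by (simp add: e0_def)
        moreover have "0 \<le> e1 * Z l1 w" "0 \<le> e3 * Z l3 w"
          using Zpos[of l1] Zpos[of l3] by (simp_all add: e1_def e3_def)
        ultimately show ?thesis using 3 by simp
      qed
    qed
    from mult_left_mono[OF this g(2)[OF w]]
    show "g w * Z \<theta> w \<le> e0 * (g w * (if a * b < U w then 1 else 0))
      + e1 * (g w * Z l1 w) + e3 * (g w * Z l3 w)"
      by (simp add: distrib_left mult_ac)
  qed (use iP iZ in auto)
  also have "\<dots> = e0 * P + e1 * (\<integral>w. g w * Z l1 w \<partial>M) + e3 * (\<integral>w. g w * Z l3 w \<partial>M)"
    using iP iZ by (simp add: P_def)
  also have "\<dots> \<le> e0 * P + e1 * (exp (a\<^sup>2 * ((1 + \<eta>)\<^sup>2 / 2)) * G)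
      + e3 * (exp (a\<^sup>2 * ((1 + 2 * \<delta>)\<^sup>2 / 2 * (1 + \<eta>)\<^sup>2)) * G)"
    using up1 up3 by (intro add_mono mult_left_mono order_refl) (auto simp: e1_def e3_def)
  also have "\<dots> = e0 * P + exp (a\<^sup>2 * (\<delta> + (1 + \<eta>)\<^sup>2 / 2)) * G
      + exp (a\<^sup>2 * (- \<delta> * (1 + 2 * \<delta>) + (1 + 2 * \<delta>)\<^sup>2 / 2 * (1 + \<eta>)\<^sup>2)) * G"
    by (simp only: e1_def e3_def distrib_left[of "a\<^sup>2"] exp_add mult.assoc)
  also have "\<dots> \<le> e0 * P + exp (a\<^sup>2 * \<mu>) / 4 * G + exp (a\<^sup>2 * \<mu>) / 4 * G"
  proof -
    \<comment> \<open>The gap \<open>a\<^sup>2 \<delta>\<^sup>2 / 4\<close> is at least 2, and \<open>exp 2\<close> exceeds 4.\<close>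
    have quarter: "exp (a\<^sup>2 * p) \<le> exp (a\<^sup>2 * \<mu>) / 4" if "p + \<delta>\<^sup>2 / 4 \<le> \<mu>" for p
    proof -
      have "a\<^sup>2 * p + a\<^sup>2 * \<delta>\<^sup>2 / 4 \<le> a\<^sup>2 * \<mu>"
        using mult_left_mono[OF that, of "a\<^sup>2"] by (simp add: distrib_left)
      then have "a\<^sup>2 * p \<le> a\<^sup>2 * \<mu> - 2" using a(2) by linarith
      then have "exp (a\<^sup>2 * p) \<le> exp (a\<^sup>2 * \<mu>) / exp 2" by (simp flip: exp_diff)
      also have "\<dots> \<le> exp (a\<^sup>2 * \<mu>) / 4"
        using exp_lower_Taylor_quadratic[of "2::real"] by (intro divide_left_mono) auto
      finally show ?thesis .
    qed
    show ?thesis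
      using tilting_exponents(1,2)[OF \<delta> \<eta>, folded \<mu>_def] G0
      by (intro add_mono mult_right_mono quarter order_refl)
  qed
  finally have "exp (a\<^sup>2 * \<mu>) * G \<le> e0 * P + exp (a\<^sup>2 * \<mu>) * G / 4 + exp (a\<^sup>2 * \<mu>) * G / 4"
    using lo by simp
  then have "exp (a\<^sup>2 * \<mu>) / 2 * G \<le> e0 * P" by (simp add: field_simps)
  then have "exp (a\<^sup>2 * \<mu>) / e0 / 2 * G \<le> P" by (simp add: e0_def field_simps)
  moreover have "exp (- a\<^sup>2 * (1 / 2 + 4 * \<delta>)) / 2 * G \<le> exp (a\<^sup>2 * \<mu>) / e0 / 2 * G"
  proof (intro mult_right_mono divide_right_mono G0)
    have "a\<^sup>2 * ((1 + \<delta>) * (1 + 2 * \<delta>) - (1 / 2 + 4 * \<delta>)) \<le> a\<^sup>2 * \<mu>"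
      using tilting_exponents(3)[OF \<delta> \<eta>, folded \<mu>_def] by (intro mult_left_mono) auto
    then have "- a\<^sup>2 * (1 / 2 + 4 * \<delta>) \<le> a\<^sup>2 * \<mu> - a\<^sup>2 * ((1 + \<delta>) * (1 + 2 * \<delta>))"
      by (simp add: right_diff_distrib)
    then show "exp (- a\<^sup>2 * (1 / 2 + 4 * \<delta>)) \<le> exp (a\<^sup>2 * \<mu>) / e0"
      by (simp add: e0_def flip: exp_diff)
  qed auto
  ultimately have "exp (- a\<^sup>2 * (1 / 2 + 4 * \<delta>)) / 2 * G \<le> P" by (rule order_trans[rotated])
  then show ?thesis by (simp only: P_def U_def G_def)
qed

end

context tail_martingale
begin

text \<open>
  The conditional variance is at most \<open>(c n)\<^sup>2\<close> and asymptotic to \<open>v n\<close>, so the smallness of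
  the increments is inherited by the variance steps.
\<close>

lemma var_le_incr_sq: "\<forall>\<^sub>F n in sequentially. v n \<le> 2 * (c n)\<^sup>2"
proof -
  have "AE w in M. \<forall>n. 0 \<le> s n w \<and> s n w \<le> (c n)\<^sup>2" using var_bounds by (simp add: AE_all_countable)
  with var_asymp have ae: "AE w in M. (\<lambda>n. s n w / v n) \<longlonglongrightarrow> 1 \<and> (\<forall>n. s n w \<le> (c n)\<^sup>2)"
    by eventually_elim (simp add: v_def)
  obtain w where w: "(\<lambda>n. s n w / v n) \<longlonglongrightarrow> 1" "\<And>n. s n w \<le> (c n)\<^sup>2"
    using eventually_happens[OF ae] by (auto simp: ae_filter_eq_bot_iff emeasure_space_1)
  have "\<forall>\<^sub>F n in sequentially. 1 / 2 < s n w / v n" by (intro order_tendstoD(1)[OF w(1)]) auto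
  then show ?thesis
  proof eventually_elim
    case (elim n)
    then show ?case using w(2)[of n] v_pos[of n] by (simp add: field_simps)
  qed
qed

lemma block_variance_lim:
  assumes r: "1 < r"
  shows "(\<lambda>k. (V (block r k) - V (block r (Suc k))) * r ^ k) \<longlonglongrightarrow> 1 - 1 / r"
proof -
  have "(\<lambda>k. V (block r k) * r ^ k - V (block r (Suc k)) * r ^ Suc k / r) \<longlonglongrightarrow> 1 - 1 / r"
    using r by (intro tendsto_intros V_block_lim LIMSEQ_Suc[OF V_block_lim]) auto
  moreover have "V (block r k) * r ^ k - V (block r (Suc k)) * r ^ Suc k / r
      = (V (block r k) - V (block r (Suc k))) * r ^ k" for k
    using r by (simp add: field_simps)
  ultimately show ?thesis by simp
qed

definition block_sd :: "real \<Rightarrow> nat \<Rightarrow> real" where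
  "block_sd r k = sqrt (V (block r k) - V (block r (Suc k)))"

text \<open>
  Chosen so that the lower bound \<open>exp (- a\<^sup>2 (1 / 2 + 4 \<delta>)) / 2\<close> for the level \<open>a\<close> is exactly
  \<open>1 / (2 k)\<close>, the general term of a divergent series.
\<close>

definition level :: "real \<Rightarrow> nat \<Rightarrow> real" where
  "level \<delta> k = sqrt (2 * ln (real k) / (1 + 8 * \<delta>))"

text \<open>
  For large \<open>k\<close>, the \<open>k\<close>-th patched block sum is large with conditional probability at least
  \<open>1 / (2 k)\<close> given the past. Iterating, the probability that none of the blocks from \<open>m\<close> to \<open>L\<close> is
  large is at most \<open>sqrt (m / L)\<close>, which tends to 0. Along almost every path only finitely many
  increments are patched.
\<close>

lemma block_sum_frequently:
  assumes r: "1 < r" and \<delta>: "0 < \<delta>" "\<delta> \<le> 1"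
  shows "AE w in M. \<exists>\<^sub>F k in sequentially.
    level \<delta> k * block_sd r k < (\<Sum>j\<in>{block r k..<block r (Suc k)}. \<xi> j w)"
proof -
  define \<eta> where "\<eta> = \<delta>\<^sup>2 / 80"
  have \<eta>: "0 < \<eta>" "\<eta> < 1" using \<delta> power_mono[of \<delta> 1 2] by (auto simp: \<eta>_def)
  define \<theta> where "\<theta> k = (1 + \<delta>) * level \<delta> k / block_sd r k" for k
  define U where "U k w = (\<Sum>j\<in>{block r k..<block r (Suc k)}. patched \<eta> (\<theta> k) j w)" for k w
  define B where "B k w \<longleftrightarrow> level \<delta> k * block_sd r k < U k w" for k w
  have bm: "block r k \<le> block r m" if "k \<le> m" for k m
    using that by (simp add: lift_Suc_mono_le[of "block r", OF block_mono[OF r]])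
  have U_ba: "bounded_adapted (block r (Suc k)) (U k)" for k
    unfolding U_def by (intro bounded_adapted_intros patched_adapted) auto
  have B_set: "{w \<in> space M. B k w} \<in> sets (F (block r (Suc k)))" for k
    using bounded_adapted_meas[OF U_ba[of k]] borel_measurable_iff_greater[of "U k" "F (block r (Suc k))"]
    by (auto simp: B_def)
  \<comment> \<open>The largest tilt has a square of at most \<open>36 / (1 - 1 / r) * r ^ k * ln k\<close>, so this threshold makes
    its product with the squared increments at most \<open>\<eta>\<^sup>2 / 8\<close>.\<close>
  define a0 where "a0 = \<eta>\<^sup>2 * (1 - 1 / r) / 2 / 144"
  have a0: "0 < a0" using \<eta> r by (simp add: a0_def)
  have "\<forall>\<^sub>F k in sequentially. (1 - 1 / r) / 2 < (V (block r k) - V (block r (Suc k))) * r ^ k"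
  proof (rule order_tendstoD(1)[OF block_variance_lim[OF r]])
    have half: "z / 2 < z" if "0 < z" for z :: real using that by simp
    show "(1 - 1 / r) / 2 < 1 - 1 / r" using r by (intro half) simp
  qed
  moreover have "\<forall>\<^sub>F k in sequentially. \<forall>j\<ge>block r k. v j \<le> 2 * (c j)\<^sup>2"
    using block_at_top[OF r] var_le_incr_sq unfolding filterlim_at_top eventually_sequentially
    by (meson order_trans)
  moreover have "\<forall>\<^sub>F k in sequentially. 8 * (1 + 8 * \<delta>) / \<delta>\<^sup>2 \<le> 2 * ln (real k)" by real_asymp
  ultimately have step: "\<forall>\<^sub>F k in sequentially. 1 < k \<and>
      (\<forall>g. bounded_adapted (block r k) g \<longrightarrow> (\<forall>w\<in>space M. 0 \<le> g w) \<longrightarrow>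
        1 / (2 * real k) * (\<integral>w. g w \<partial>M) \<le> (\<integral>w. g w * (if B k w then 1 else 0) \<partial>M))"
    using incr_small_block[OF r a0] eventually_gt_at_top[of 1]
  proof eventually_elim
    case (elim k)
    define a b where "a = level \<delta> k" and "b = block_sd r k"
    have lnk: "0 < ln (real k)" using elim by simp
    have a: "0 < a" "a\<^sup>2 = 2 * ln k / (1 + 8 * \<delta>)" using lnk \<delta> by (simp_all add: a_def level_def)
    have R: "0 < r ^ k" using r by simp
    have var: "(1 - 1 / r) / 2 / r ^ k < V (block r k) - V (block r (Suc k))"
      using elim(1) R by (simp add: pos_divide_less_eq)
    moreover have "0 < (1 - 1 / r) / 2 / r ^ k" using r by simp
    ultimately have bpos: "0 < V (block r k) - V (block r (Suc k))" by linarith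
    then have b: "0 < b" "b\<^sup>2 = V (block r k) - V (block r (Suc k))" by (simp_all add: b_def block_sd_def)
    have lt: "block r k < block r (Suc k)"
      using bpos V_antimono[of "block r (Suc k)" "block r k"] by (cases "block r k < block r (Suc k)") auto
    define l where "l = (1 + 2 * \<delta>) * a / b"
    have l0: "0 \<le> l" using a b \<delta> by (simp add: l_def)
    have l2: "l\<^sup>2 * (c j)\<^sup>2 \<le> \<eta>\<^sup>2 / 2" if j: "block r k \<le> j" for j
    proof -
      have "l\<^sup>2 = (1 + 2 * \<delta>)\<^sup>2 * (2 * ln k / (1 + 8 * \<delta>)) / b\<^sup>2"
        by (simp add: l_def power_divide power_mult_distrib a)
      also have "\<dots> \<le> 3\<^sup>2 * (2 * ln k / 1) / ((1 - 1 / r) / 2 / r ^ k)"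
        using var r lnk \<delta> b by (intro frac_le mult_mono power_mono divide_left_mono) auto
      also have "\<dots> = 36 / (1 - 1 / r) * (r ^ k * ln k)" using r by simp
      finally have "l\<^sup>2 * (c j)\<^sup>2 \<le> 36 / (1 - 1 / r) * (r ^ k * ln k) * (c j)\<^sup>2"
        by (rule mult_right_mono) auto
      also have "\<dots> = 36 / (1 - 1 / r) * ((c j)\<^sup>2 * r ^ k * ln k)" by simp
      also have "\<dots> \<le> 36 / (1 - 1 / r) * a0"
        using elim j r by (intro mult_left_mono) auto
      also have "\<dots> = \<eta>\<^sup>2 / 8" using r by (simp add: a0_def)
      also have "\<dots> \<le> \<eta>\<^sup>2 / 2" by simp
      finally show ?thesis .
    qed
    have small1: "(1 + 2 * \<delta>) * a / b * c j \<le> \<eta>" if j: "block r k \<le> j" for j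
    proof (rule power2_le_imp_le)
      show "((1 + 2 * \<delta>) * a / b * c j)\<^sup>2 \<le> \<eta>\<^sup>2"
        unfolding l_def[symmetric] power_mult_distrib using l2[OF j] by (rule order_trans) simp
    qed (use \<eta> in simp)
    have small2: "((1 + 2 * \<delta>) * a / b)\<^sup>2 / 2 * v j \<le> \<eta>" if j: "block r k \<le> j" for j
    proof -
      have "l\<^sup>2 / 2 * v j \<le> l\<^sup>2 / 2 * (2 * (c j)\<^sup>2)" using elim(2) j by (intro mult_left_mono) auto
      also have "\<dots> \<le> \<eta>\<^sup>2 / 2" using l2[OF j] by simp
      also have "\<dots> \<le> \<eta>" using \<eta> by (simp add: power2_eq_square mult_left_le)
      finally show ?thesis by (simp add: l_def)
    qed
    have ad: "8 \<le> a\<^sup>2 * \<delta>\<^sup>2"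
      using elim(3) \<delta> by (simp add: a(2) field_simps)
    have "exp (- a\<^sup>2 * (1 / 2 + 4 * \<delta>)) = exp (- ln k)"
      using \<delta> by (simp add: a(2) field_simps)
    also have "\<dots> = 1 / k" using elim by (simp add: exp_minus field_simps)
    finally have p: "exp (- a\<^sup>2 * (1 / 2 + 4 * \<delta>)) / 2 = 1 / (2 * real k)" by simp
    have "1 / (2 * real k) * (\<integral>w. g w \<partial>M) \<le> (\<integral>w. g w * (if B k w then 1 else 0) \<partial>M)"
      if g: "bounded_adapted (block r k) g" "\<forall>w\<in>space M. 0 \<le> g w" for g
      unfolding p[symmetric] B_def U_def \<theta>_def a_def[symmetric] b_def[symmetric]
      by (rule block_lower_tail[OF lt g(1) _ \<delta> \<eta>_def a(1) ad _ small1 small2 refl])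
         (use g(2) in \<open>auto simp: b_def block_sd_def\<close>)
    then show ?case using elim by auto
  qed
  then obtain k0 where k0: "\<And>k. k0 \<le> k \<Longrightarrow> 1 < k"
    "\<And>k g. k0 \<le> k \<Longrightarrow> bounded_adapted (block r k) g \<Longrightarrow> (\<And>w. w \<in> space M \<Longrightarrow> 0 \<le> g w) \<Longrightarrow>
      1 / (2 * real k) * (\<integral>w. g w \<partial>M) \<le> (\<integral>w. g w * (if B k w then 1 else 0) \<partial>M)"
    unfolding eventually_sequentially by blast
  have null: "AE w in M. \<not> (\<forall>k\<ge>m. \<not> B k w)" if m: "k0 \<le> m" for m
  proof -
    define G where "G L w = (if \<forall>k\<in>{m..<L}. \<not> B k w then 1 else 0 :: real)" for L w
    have G_set: "{w \<in> space M. \<forall>k\<in>{m..<L}. \<not> B k w} \<in> sets (F (block r L))" for L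
    proof -
      have "{w \<in> space M. \<not> B k w} \<in> sets (F (block r L))" if "k < L" for k
      proof -
        have "{w \<in> space M. B k w} \<in> sets (F (block r L))"
          using B_set[of k] filtration[OF bm[of "Suc k" L]] that by auto
        then have "space (F (block r L)) - {w \<in> space M. B k w} \<in> sets (F (block r L))"
          by (rule sets.compl_sets)
        moreover have "space (F (block r L)) - {w \<in> space M. B k w} = {w \<in> space M. \<not> B k w}" by auto
        ultimately show ?thesis by simp
      qed
      then show ?thesis
        using sets.sets_Collect_finite_All[of "{m..<L}" "F (block r L)" "\<lambda>k w. \<not> B k w"] by auto
    qed
    have G_ba: "bounded_adapted (block r L) (G L)" for L
      unfolding G_def by (intro bounded_adapted_intros G_set)
    have m1: "1 < m" using k0(1)[OF m] .
    have bound: "(\<integral>w. G L w \<partial>M) \<le> sqrt (m / L)" if "m \<le> L" for L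
      using that
    proof (induction L rule: dec_induct)
      case base
      then show ?case using m1 by (simp add: G_def prob_space)
    next
      case (step L)
      have L: "1 < L" "k0 \<le> L" using step.hyps m m1 by auto
      note iG = bounded_adapted_integrable[OF G_ba]
      have "bounded_adapted (block r (Suc L)) (\<lambda>w. G L w * (if B L w then 1 else 0))"
        using bm[of L "Suc L"] by (intro bounded_adapted_intros B_set bounded_adapted_mono[OF G_ba]) auto
      note iB = bounded_adapted_integrable[OF this]
      have "G (Suc L) w = G L w - G L w * (if B L w then 1 else 0)" for w
        using step.hyps by (auto simp: G_def atLeastLessThanSuc)
      then have "(\<integral>w. G (Suc L) w \<partial>M) = (\<integral>w. G L w \<partial>M) - (\<integral>w. G L w * (if B L w then 1 else 0) \<partial>M)"
        using iG iB by simp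
      also have "\<dots> \<le> (\<integral>w. G L w \<partial>M) - 1 / (2 * real L) * (\<integral>w. G L w \<partial>M)"
        by (intro diff_left_mono k0(2) G_ba L) (auto simp: G_def)
      also have "\<dots> = (1 - 1 / (2 * real L)) * (\<integral>w. G L w \<partial>M)" by (simp add: algebra_simps)
      also have "\<dots> \<le> (1 - 1 / (2 * real L)) * sqrt (m / L)"
        using step.IH L by (intro mult_left_mono) (auto simp: field_simps)
      also have "\<dots> \<le> sqrt (m / Suc L)"
      proof (rule real_le_rsqrt)
        \<comment> \<open>Here the probability \<open>1 / (2 L)\<close> is converted into one factor of the telescoping product for
          \<open>sqrt (m / L)\<close>.\<close>
        have "(1 - 1 / (2 * real L))\<^sup>2 \<le> real L / (real L + 1)"
          using L by (simp add: field_simps power2_eq_square)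
        then have "(1 - 1 / (2 * real L))\<^sup>2 * (m / L) \<le> real L / (real L + 1) * (m / L)"
          by (intro mult_right_mono) auto
        also have "\<dots> = m / Suc L" using L by (simp add: field_simps)
        finally show "((1 - 1 / (2 * real L)) * sqrt (m / L))\<^sup>2 \<le> m / Suc L"
          by (simp add: power_mult_distrib)
      qed
      finally show ?case .
    qed
    define A where "A L = {w \<in> space M. \<forall>k\<in>{m..<L}. \<not> B k w}" for L
    have A_ev: "A L \<in> events" for L unfolding A_def by (rule sets_F_in_M[OF G_set])
    have A_prob: "prob (A L) = (\<integral>w. G L w \<partial>M)" for L
    proof -
      have "(\<integral>w. G L w \<partial>M) = (\<integral>w. indicat_real (A L) w \<partial>M)"
        by (intro Bochner_Integration.integral_cong) (auto simp: G_def A_def indicator_def)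
      then show ?thesis using A_ev by simp
    qed
    define N where "N = (\<Inter>L. A L)"
    have N_ev: "N \<in> events" unfolding N_def using A_ev by auto
    have "(\<lambda>L. sqrt (real m / real L)) \<longlonglongrightarrow> sqrt 0" by (intro tendsto_real_sqrt lim_const_over_n)
    moreover have "\<forall>\<^sub>F L in sequentially. prob N \<le> sqrt (real m / real L)"
      using eventually_ge_at_top[of m]
    proof eventually_elim
      case (elim L)
      have "prob N \<le> prob (A L)" by (intro finite_measure_mono A_ev) (auto simp: N_def)
      also have "\<dots> \<le> sqrt (m / L)" unfolding A_prob by (rule bound[OF elim])
      finally show ?case .
    qed
    ultimately have "prob N \<le> sqrt 0" by (intro tendsto_lowerbound) auto
    then have "N \<in> null_sets M"
      using N_ev measure_nonneg[of M N] by (auto simp: null_sets_def emeasure_eq_measure)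
    moreover have "{w \<in> space M. \<not> \<not> (\<forall>k\<ge>m. \<not> B k w)} \<subseteq> N"
      by (auto simp: N_def A_def)
    ultimately show ?thesis by (rule AE_I')
  qed
  have "AE w in M. \<forall>m. k0 \<le> m \<longrightarrow> \<not> (\<forall>k\<ge>m. \<not> B k w)"
    using null by (simp add: AE_all_countable)
  then show ?thesis using var_asymp
  proof eventually_elim
    case (elim w)
    have often: "\<exists>\<^sub>F k in sequentially. B k w"
      unfolding frequently_def eventually_sequentially
      using elim(1) by (metis max.bounded_iff max.cobounded1 nle_le)
    have U: "\<forall>\<^sub>F k in sequentially. U k w = (\<Sum>j\<in>{block r k..<block r (Suc k)}. \<xi> j w)"
    proof -
      have "\<forall>\<^sub>F j in sequentially. 1 - \<eta> < s j w / v j \<and> s j w / v j < 1 + \<eta>"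
        using \<eta> elim(2) unfolding v_def by (intro eventually_conj order_tendstoD) auto
      then obtain j0 where j0: "\<And>j. j0 \<le> j \<Longrightarrow> 1 - \<eta> < s j w / v j \<and> s j w / v j < 1 + \<eta>"
        by (auto simp: eventually_sequentially)
      have p: "patched \<eta> t j w = \<xi> j w" if "j0 \<le> j" for j t
        using j0[OF that] v_pos[of j] by (auto simp: patched_def typical_def field_simps)
      have "\<forall>\<^sub>F k in sequentially. j0 \<le> block r k" using block_at_top[OF r] by (simp add: filterlim_at_top)
      then show ?thesis
        by eventually_elim (auto simp: U_def p intro!: sum.cong)
    qed
    show ?case
      by (rule frequently_rev_mp[OF often]) (use U in \<open>auto elim!: eventually_mono simp: B_def\<close>)
  qed
qed

text \<open>
  The remainder at the beginning of a block is the block sum plus the remainder after the block. The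
  latter is at least \<open>-2\<close> times its own scale, by the upper bound for the negated martingale, and this
  scale is smaller by the factor \<open>1 / sqrt r\<close>.
\<close>

lemma tail_lower_block:
  assumes r: "1 < r" and \<rho>: "\<rho> < sqrt ((1 - 1 / r) / (1 + 8 / r)) - 2 / sqrt r"
  shows "AE w in M. \<exists>\<^sub>F n in sequentially. \<rho> * phi_hat (V n) < tail n w"
proof -
  interpret neg: tail_martingale M F "\<lambda>n w. - \<xi> n w" s c V K "\<lambda>w. - W w" by (rule tail_martingale_negated)
  have negtail: "neg.tail n w = - tail n w" for n w by (simp add: neg.tail_def tail_def sum_negf)
  let ?u = "lil_scale r" and ?\<phi> = "\<lambda>k. phi_hat (V (block r k))"
  have upos: "0 < ?u k" if "1 < k" for k using that r by (simp add: lil_scale_def)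
  have lim1: "(\<lambda>k. level (1 / r) k * block_sd r k / ?u k) \<longlonglongrightarrow> sqrt ((1 - 1 / r) / (1 + 8 / r))"
  proof -
    have "(\<lambda>k. sqrt ((V (block r k) - V (block r (Suc k))) * r ^ k / (1 + 8 / r))) \<longlonglongrightarrow> sqrt ((1 - 1 / r) / (1 + 8 / r))"
      using r by (intro tendsto_real_sqrt tendsto_divide block_variance_lim tendsto_const)
        (auto simp: field_simps)
    moreover have "\<forall>\<^sub>F k in sequentially. sqrt ((V (block r k) - V (block r (Suc k))) * r ^ k / (1 + 8 / r))
        = level (1 / r) k * block_sd r k / ?u k"
      using eventually_gt_at_top[of 1]
    proof eventually_elim
      case (elim k)
      have "0 < ln (real k)" using elim by simp
      moreover have "0 < 1 + 8 / r" using r by (simp add: field_simps)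
      ultimately show ?case
        unfolding level_def block_sd_def lil_scale_def real_sqrt_mult[symmetric] real_sqrt_divide[symmetric]
        using r by (intro arg_cong[of _ _ sqrt]) (simp add: divide_simps)
    qed
    ultimately show ?thesis by (rule Lim_transform_eventually)
  qed
  have lim2: "(\<lambda>k. ?\<phi> (Suc k) / ?u k) \<longlonglongrightarrow> 1 * (1 / sqrt r)"
  proof -
    have "(\<lambda>k. (?\<phi> (Suc k) / ?u (Suc k)) * (?u (Suc k) / ?u k)) \<longlonglongrightarrow> 1 * (1 / sqrt r)"
      by (intro tendsto_mult LIMSEQ_Suc[OF phi_hat_block_lim[OF r]] lil_scale_Suc_lim[OF r])
    moreover have "\<forall>\<^sub>F k in sequentially. (?\<phi> (Suc k) / ?u (Suc k)) * (?u (Suc k) / ?u k) = ?\<phi> (Suc k) / ?u k"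
      using eventually_gt_at_top[of 1]
      by eventually_elim (use upos in \<open>auto simp: less_imp_neq[THEN not_sym]\<close>)
    ultimately show ?thesis by (rule Lim_transform_eventually)
  qed
  have "(\<lambda>k. level (1 / r) k * block_sd r k / ?u k - 2 * (?\<phi> (Suc k) / ?u k) - \<rho> * (?\<phi> k / ?u k))
      \<longlonglongrightarrow> sqrt ((1 - 1 / r) / (1 + 8 / r)) - 2 * (1 * (1 / sqrt r)) - \<rho> * 1"
    by (intro tendsto_intros lim1 lim2 phi_hat_block_lim[OF r])
  then have "\<forall>\<^sub>F k in sequentially. 0 < level (1 / r) k * block_sd r k / ?u k - 2 * (?\<phi> (Suc k) / ?u k) - \<rho> * (?\<phi> k / ?u k)"
    using \<rho> by (intro order_tendstoD(1)) auto
  then have gap: "\<forall>\<^sub>F k in sequentially. \<rho> * ?\<phi> k < level (1 / r) k * block_sd r k - 2 * ?\<phi> (Suc k)"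
    using eventually_gt_at_top[of 1]
  proof eventually_elim
    case (elim k)
    have "0 < (level (1 / r) k * block_sd r k - 2 * ?\<phi> (Suc k) - \<rho> * ?\<phi> k) / ?u k"
      using elim(1) by (simp add: diff_divide_distrib)
    then show ?case using upos[OF elim(2)] by (simp add: zero_less_divide_iff)
  qed
  have "AE w in M. \<exists>\<^sub>F k in sequentially.
    level (1 / r) k * block_sd r k < (\<Sum>j\<in>{block r k..<block r (Suc k)}. \<xi> j w)"
    using r by (intro block_sum_frequently) auto
  moreover have "AE w in M. \<forall>\<^sub>F n in sequentially. - tail n w \<le> 2 * phi_hat (V n)"
    using neg.tail_upper[of 1] by (simp add: negtail)
  ultimately show ?thesis
  proof eventually_elim
    case (elim w)
    have b2: "filterlim (\<lambda>k. block r (Suc k)) at_top sequentially"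
      using block_at_top[OF r] by (simp add: filterlim_sequentially_Suc)
    have "\<forall>\<^sub>F k in sequentially. - tail (block r (Suc k)) w \<le> 2 * ?\<phi> (Suc k)"
      by (rule eventually_compose_filterlim[OF elim(2) b2])
    with gap have "\<forall>\<^sub>F k in sequentially.
      level (1 / r) k * block_sd r k < (\<Sum>j\<in>{block r k..<block r (Suc k)}. \<xi> j w) \<longrightarrow>
      \<rho> * ?\<phi> k < tail (block r k) w"
    proof eventually_elim
      case (elim k)
      show ?case using elim tail_split[OF block_mono[OF r, of k], of w] by auto
    qed
    from frequently_mp[OF this elim(1)] have "\<exists>\<^sub>F k in sequentially. \<rho> * ?\<phi> k < tail (block r k) w" .
    then show ?case
      using eventually_compose_filterlim[OF _ block_at_top[OF r], of "\<lambda>n. \<not> \<rho> * phi_hat (V n) < tail n w"]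
      unfolding frequently_def by blast
  qed
qed

lemma tail_lower:
  assumes "0 < \<delta>"
  shows "AE w in M. \<exists>\<^sub>F n in sequentially. (1 - \<delta>) * phi_hat (V n) < tail n w"
proof -
  have "((\<lambda>r::real. sqrt ((1 - 1 / r) / (1 + 8 / r)) - 2 / sqrt r) \<longlongrightarrow> 1) at_top" by real_asymp
  then have "\<forall>\<^sub>F r in at_top. 1 - \<delta> < sqrt ((1 - 1 / r) / (1 + 8 / r)) - 2 / sqrt (r::real)"
    using assms by (intro order_tendstoD(1)) auto
  then have "\<forall>\<^sub>F r in at_top. 1 < r \<and> 1 - \<delta> < sqrt ((1 - 1 / r) / (1 + 8 / r)) - 2 / sqrt (r::real)"
    using eventually_gt_at_top[of "1::real"] by eventually_elim auto
  then obtain r :: real where "1 < r" "1 - \<delta> < sqrt ((1 - 1 / r) / (1 + 8 / r)) - 2 / sqrt r"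
    using eventually_happens[of _ "at_top :: real filter"] by auto
  then show ?thesis by (rule tail_lower_block)
qed

theorem tail_lil: "AE w in M. limsup (\<lambda>n. ereal (tail n w / phi_hat (V n))) = 1"
proof -
  have "AE w in M. \<forall>i. \<forall>\<^sub>F n in sequentially. tail n w \<le> (1 + 1 / Suc i) * phi_hat (V n)"
    unfolding AE_all_countable by (intro allI tail_upper) simp
  moreover have "AE w in M. \<forall>i. \<exists>\<^sub>F n in sequentially. (1 - 1 / Suc i) * phi_hat (V n) < tail n w"
    unfolding AE_all_countable by (intro allI tail_lower) simp
  ultimately show ?thesis
  proof eventually_elim
    case (elim w)
    let ?l = "limsup (\<lambda>n. ereal (tail n w / phi_hat (V n)))"
    have up: "?l \<le> ereal (1 + 1 / Suc i)" for i
    proof (rule Limsup_bounded)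
      from elim(1) have "\<forall>\<^sub>F n in sequentially. tail n w \<le> (1 + 1 / Suc i) * phi_hat (V n)" by blast
      then show "\<forall>\<^sub>F n in sequentially. ereal (tail n w / phi_hat (V n)) \<le> ereal (1 + 1 / Suc i)"
        using phi_hat_V_pos by eventually_elim (simp add: divide_le_eq)
    qed
    have lo: "ereal (1 - 1 / Suc i) \<le> ?l" for i
    proof (rule ccontr)
      assume "\<not> ?thesis"
      then have "?l < ereal (1 - 1 / Suc i)" by simp
      from Limsup_lessD[OF this] phi_hat_V_pos
      have "\<forall>\<^sub>F n in sequentially. \<not> (1 - 1 / Suc i) * phi_hat (V n) < tail n w"
        by eventually_elim (simp add: divide_less_eq)
      moreover from elim(2) have "\<exists>\<^sub>F n in sequentially. (1 - 1 / Suc i) * phi_hat (V n) < tail n w" by blast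
      ultimately show False by (simp add: frequently_def)
    qed
    have "(\<lambda>i. 1 + 1 / real (Suc i)) \<longlonglongrightarrow> 1" "(\<lambda>i. 1 - 1 / real (Suc i)) \<longlonglongrightarrow> 1" by real_asymp+
    then have "(\<lambda>i. ereal (1 + 1 / Suc i)) \<longlonglongrightarrow> ereal 1" "(\<lambda>i. ereal (1 - 1 / Suc i)) \<longlonglongrightarrow> ereal 1"
      by (simp_all only: tendsto_ereal)
    then show ?case
      using LIMSEQ_le_const[of "\<lambda>i. ereal (1 + 1 / Suc i)" "ereal 1" ?l] up
        LIMSEQ_le_const2[of "\<lambda>i. ereal (1 - 1 / Suc i)" "ereal 1" ?l] lo
      by (intro antisym) (auto simp: one_ereal_def)
  qed
qed

end

section \<open>The scaling sequence\<close>

text \<open>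
  Contraction factors \<open>1 - \<kappa> / (n + 1)\<close> multiply to a quantity of order \<open>n\<close> to the power \<open>-\<kappa>\<close>, so
  the initial value is forgotten and only the forcing term \<open>d\<close> matters. Several null sequences of the
  walk satisfy such a recursion.
\<close>

lemma harmonic_contraction_lim:
  fixes z d :: "nat \<Rightarrow> real"
  assumes \<kappa>: "0 < \<kappa>" "\<kappa> \<le> 1" and z: "\<And>n. 0 \<le> z n"
    and rec: "\<And>n. n \<ge> 1 \<Longrightarrow> z (Suc n) \<le> (1 - \<kappa> / Suc n) * z n + \<kappa> / Suc n * d n"
    and d: "d \<longlonglongrightarrow> 0"
  shows "z \<longlonglongrightarrow> 0"
proof (rule LIMSEQ_I)
  fix e :: real assume e: "0 < e"
  have "\<forall>\<^sub>F n in sequentially. d n < e / 2" using e by (intro order_tendstoD(2)[OF d]) auto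
  then obtain N0 where N0: "\<And>n. N0 \<le> n \<Longrightarrow> d n \<le> e / 2"
    by (auto simp: eventually_sequentially intro: less_imp_le)
  define N where "N = max 1 N0"
  \<comment> \<open>The power is chosen to dominate the product of the contraction factors, as
    \<open>1 - \<kappa> x \<le> (1 + x) powr - \<kappa>\<close> for \<open>x = 1 / (n + 1)\<close>.\<close>
  have bound: "z n - e / 2 \<le> z N * (real (Suc N) / real (Suc n)) powr \<kappa>" if "N \<le> n" for n
    using that
  proof (induction n rule: dec_induct)
    case base
    then show ?case using e by simp
  next
    case (step n)
    have n: "1 \<le> n" "N0 \<le> n" using step.hyps by (auto simp: N_def)
    have k: "0 \<le> 1 - \<kappa> / Suc n" using \<kappa> by (simp add: field_simps)
    have "z (Suc n) - e / 2 \<le> (1 - \<kappa> / Suc n) * (z n - e / 2)"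
    proof -
      have "\<kappa> / Suc n * d n \<le> \<kappa> / Suc n * (e / 2)" using N0[OF n(2)] \<kappa> by (intro mult_left_mono) auto
      then show ?thesis using rec[OF n(1)] by (simp add: algebra_simps)
    qed
    also have "\<dots> \<le> (1 - \<kappa> / Suc n) * (z N * (real (Suc N) / real (Suc n)) powr \<kappa>)"
      by (intro mult_left_mono step.IH k)
    also have "\<dots> \<le> (real (Suc n) / real (Suc (Suc n))) powr \<kappa> * (z N * (real (Suc N) / real (Suc n)) powr \<kappa>)"
    proof (intro mult_right_mono)
      have "ln (real (Suc (Suc n)) / real (Suc n)) \<le> 1 / Suc n"
        using ln_le_minus_one[of "real (Suc (Suc n)) / real (Suc n)"] by (simp add: field_simps)
      then have "- (1 / Suc n) \<le> ln (real (Suc n) / real (Suc (Suc n)))"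
        by (simp add: ln_divide_pos)
      then have "\<kappa> * - (1 / Suc n) \<le> \<kappa> * ln (real (Suc n) / real (Suc (Suc n)))"
        using \<kappa> by (intro mult_left_mono) auto
      then have "exp (- (\<kappa> / Suc n)) \<le> (real (Suc n) / real (Suc (Suc n))) powr \<kappa>"
        by (simp add: powr_def)
      moreover have "1 - \<kappa> / Suc n \<le> exp (- (\<kappa> / Suc n))" using exp_ge_add_one_self[of "- (\<kappa> / Suc n)"] by simp
      ultimately show "1 - \<kappa> / Suc n \<le> (real (Suc n) / real (Suc (Suc n))) powr \<kappa>" by linarith
    qed (use z in auto)
    also have "\<dots> = z N * (real (Suc N) / real (Suc (Suc n))) powr \<kappa>"
      by (simp add: powr_divide)
    finally show ?case .
  qed
  have "(\<lambda>n. z N * (real (Suc N) / real (Suc n)) powr \<kappa>) \<longlonglongrightarrow> 0" using \<kappa> by real_asymp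
  then have "\<forall>\<^sub>F n in sequentially. z N * (real (Suc N) / real (Suc n)) powr \<kappa> < e / 2"
    using e by (intro order_tendstoD(2)) auto
  then obtain N1 where N1: "\<And>n. N1 \<le> n \<Longrightarrow> z N * (real (Suc N) / real (Suc n)) powr \<kappa> < e / 2"
    by (auto simp: eventually_sequentially)
  show "\<exists>n0. \<forall>n\<ge>n0. norm (z n - 0) < e"
  proof (intro exI allI impI)
    fix n assume "max N N1 \<le> n"
    then show "norm (z n - 0) < e" using bound[of n] N1[of n] z[of n] by simp
  qed
qed

lemma scaling_Suc: "1 \<le> n \<Longrightarrow> scaling \<alpha> (Suc n) = (1 + \<alpha> / n) * scaling \<alpha> n"
  unfolding scaling_def by (simp add: prod.atLeastLessThan_Suc mult.commute)

lemma scaling_1 [simp]: "scaling \<alpha> (Suc 0) = 1" by (simp add: scaling_def)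

lemma scaling_pos: "0 \<le> \<alpha> \<Longrightarrow> 0 < scaling \<alpha> n"
  unfolding scaling_def by (intro prod_pos) (auto intro: add_pos_nonneg)

lemma scaling_le_Suc: "0 \<le> \<alpha> \<Longrightarrow> 1 \<le> n \<Longrightarrow> scaling \<alpha> n \<le> scaling \<alpha> (Suc n)"
  using scaling_pos[of \<alpha> n] by (simp add: scaling_Suc mult_le_cancel_right1)

lemma scaling_le_self:
  assumes "0 \<le> \<alpha>" "\<alpha> \<le> 1" "1 \<le> n"
  shows "scaling \<alpha> n \<le> n"
  using \<open>1 \<le> n\<close>
proof (induction n rule: dec_induct)
  case (step n)
  have "(1 + \<alpha> / n) * scaling \<alpha> n \<le> (1 + \<alpha> / n) * n"
    using step assms by (intro mult_left_mono) auto
  also have "\<dots> \<le> Suc n" using step.hyps assms by (simp add: field_simps)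
  finally show ?case using step.hyps by (simp add: scaling_Suc)
qed simp

lemma scaling_over_self_lim:
  assumes "0 \<le> \<alpha>" "\<alpha> < 1"
  shows "(\<lambda>n. scaling \<alpha> n / n) \<longlonglongrightarrow> 0"
proof (rule harmonic_contraction_lim[where \<kappa> = "1 - \<alpha>" and d = "\<lambda>_. 0"])
  fix n :: nat assume n: "1 \<le> n"
  have "scaling \<alpha> (Suc n) / real (Suc n) = (1 - (1 - \<alpha>) / real (Suc n)) * (scaling \<alpha> n / real n)"
    using n by (simp add: scaling_Suc field_simps)
  then show "scaling \<alpha> (Suc n) / real (Suc n)
      \<le> (1 - (1 - \<alpha>) / real (Suc n)) * (scaling \<alpha> n / real n) + (1 - \<alpha>) / real (Suc n) * 0"
    by simp
qed (use assms scaling_pos in \<open>auto simp: less_imp_le\<close>)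

definition var_scale :: "real \<Rightarrow> nat \<Rightarrow> real" where
  "var_scale \<alpha> n = real n / (scaling \<alpha> n)\<^sup>2"

lemma var_scale_pos: "0 \<le> \<alpha> \<Longrightarrow> 1 \<le> n \<Longrightarrow> 0 < var_scale \<alpha> n"
  using scaling_pos[of \<alpha> n] by (simp add: var_scale_def)

lemma var_scale_Suc:
  assumes "0 \<le> \<alpha>" "1 \<le> n"
  shows "var_scale \<alpha> (Suc n) = real n * (real n + 1) / (real n + \<alpha>)\<^sup>2 * var_scale \<alpha> n"
  unfolding var_scale_def
  using assms scaling_pos[of \<alpha> n] by (simp add: scaling_Suc field_simps power2_eq_square)

text \<open>
  The exact identity behind the variance scale: its decrements are \<open>2 \<alpha> - 1\<close> divided by the squared
  scaling, up to a relative error of order \<open>1 / n\<close>.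
\<close>

lemma var_scale_diff:
  assumes "0 \<le> \<alpha>" "1 \<le> n"
  shows "var_scale \<alpha> n - var_scale \<alpha> (Suc n) = (2 * \<alpha> - 1 + \<alpha>\<^sup>2 / n) / (scaling \<alpha> (Suc n))\<^sup>2"
proof -
  define A where "A = scaling \<alpha> (Suc n)"
  have "0 < 1 + \<alpha> / n" using assms by (simp add: add_pos_nonneg)
  then have "scaling \<alpha> n = A / (1 + \<alpha> / n)" using assms by (simp add: A_def scaling_Suc)
  then have "var_scale \<alpha> n = n * (1 + \<alpha> / n)\<^sup>2 / A\<^sup>2" by (simp add: var_scale_def power_divide)
  moreover have "n * (1 + \<alpha> / n)\<^sup>2 - Suc n = 2 * \<alpha> - 1 + \<alpha>\<^sup>2 / n"
    using assms by (simp add: power2_eq_square field_simps)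
  ultimately show ?thesis
    by (simp add: var_scale_def A_def diff_divide_distrib[symmetric])
qed

lemma var_scale_lim:
  assumes "1 / 2 < \<alpha>" "\<alpha> < 1"
  shows "var_scale \<alpha> \<longlonglongrightarrow> 0"
proof (rule harmonic_contraction_lim[where \<kappa> = "(2 * \<alpha> - 1) / 2" and d = "\<lambda>_. 0"])
  fix n :: nat assume n: "1 \<le> n"
  let ?\<kappa> = "(2 * \<alpha> - 1) / 2"
  have "?\<kappa> / Suc n \<le> ((2 * \<alpha> - 1) * n) / (real n + 1)\<^sup>2"
  proof -
    have "1 / 2 / (real n + 1) = (real n + 1) / 2 / (real n + 1)\<^sup>2" by (simp add: power2_eq_square)
    also have "\<dots> \<le> n / (real n + 1)\<^sup>2" using n by (intro divide_right_mono) auto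
    finally have "1 / 2 / (real n + 1) \<le> n / (real n + 1)\<^sup>2" .
    from mult_left_mono[OF this, of "2 * \<alpha> - 1"] show ?thesis using assms by (simp add: add.commute)
  qed
  also have "\<dots> \<le> ((2 * \<alpha> - 1) * n + \<alpha>\<^sup>2) / (real n + \<alpha>)\<^sup>2"
    using assms n by (intro frac_le power_mono) auto
  also have "(2 * \<alpha> - 1) * n + \<alpha>\<^sup>2 = (real n + \<alpha>)\<^sup>2 - real n * (real n + 1)"
    by (simp add: power2_eq_square algebra_simps)
  also have "((real n + \<alpha>)\<^sup>2 - real n * (real n + 1)) / (real n + \<alpha>)\<^sup>2
      = 1 - real n * (real n + 1) / (real n + \<alpha>)\<^sup>2"
    using assms by (simp add: diff_divide_distrib)
  finally have "real n * (real n + 1) / (real n + \<alpha>)\<^sup>2 \<le> 1 - ?\<kappa> / Suc n" by linarith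
  from mult_right_mono[OF this, of "var_scale \<alpha> n"] assms n var_scale_pos[of \<alpha> n]
  show "var_scale \<alpha> (Suc n) \<le> (1 - ?\<kappa> / Suc n) * var_scale \<alpha> n + ?\<kappa> / Suc n * 0"
    by (simp add: var_scale_Suc)
qed (use assms in \<open>auto simp: var_scale_def\<close>)

lemma var_scale_ratio_lim:
  assumes "0 \<le> \<alpha>"
  shows "(\<lambda>n. var_scale \<alpha> (Suc n) / var_scale \<alpha> n) \<longlonglongrightarrow> 1"
proof -
  have "(\<lambda>n. real n * (real n + 1) / (real n + \<alpha>)\<^sup>2) \<longlonglongrightarrow> 1" by real_asymp
  moreover have "\<forall>\<^sub>F n in sequentially. real n * (real n + 1) / (real n + \<alpha>)\<^sup>2 = var_scale \<alpha> (Suc n) / var_scale \<alpha> n"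
    using eventually_ge_at_top[of 1]
    by eventually_elim (use var_scale_pos assms in \<open>auto simp: var_scale_Suc less_imp_neq[THEN not_sym]\<close>)
  ultimately show ?thesis by (rule Lim_transform_eventually)
qed

lemma var_scale_ge:
  assumes "0 \<le> \<alpha>" "\<alpha> \<le> 1" "1 \<le> n"
  shows "1 / n \<le> var_scale \<alpha> n"
proof -
  have "(scaling \<alpha> n)\<^sup>2 \<le> (real n)\<^sup>2"
    using scaling_le_self[OF assms] scaling_pos[of \<alpha> n] assms by (intro power_mono) auto
  then have "real n / (real n)\<^sup>2 \<le> real n / (scaling \<alpha> n)\<^sup>2"
    using scaling_pos[of \<alpha> n] assms by (intro divide_left_mono) auto
  then show ?thesis using assms by (simp add: var_scale_def power2_eq_square)
qed

section \<open>The elephant random walk as a martingale\<close>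

context elephant_random_walk
begin

text \<open>
  The conditional mean of the next step given the first \<open>n\<close> steps.
\<close>

definition drift :: "nat \<Rightarrow> 'a \<Rightarrow> real" where
  "drift n w = \<alpha> * (walk X n w / n) + (1 - \<alpha>) * eps n"

lemma natural_sigma_generators:
  "{X i -` A \<inter> space M | i A. i \<in> {1..n} \<and> A \<in> sets borel} \<subseteq> Pow (space M)"
  by auto

lemma space_natural_sigma [simp]: "space (natural_sigma M X n) = space M"
  unfolding natural_sigma_def by (rule space_measure_of[OF natural_sigma_generators])

lemma sets_natural_sigma:
  "sets (natural_sigma M X n) =
    sigma_sets (space M) {X i -` A \<inter> space M | i A. i \<in> {1..n} \<and> A \<in> sets borel}"
  unfolding natural_sigma_def by (rule sets_measure_of[OF natural_sigma_generators])

lemma subalgebra_natural_sigma: "subalgebra M (natural_sigma M X n)"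
proof -
  have "{X i -` A \<inter> space M | i A. i \<in> {1..n} \<and> A \<in> sets borel} \<subseteq> sets M"
    using X_measurable by (auto intro: measurable_sets)
  then show ?thesis
    by (auto simp: subalgebra_def sets_natural_sigma intro: sets.sigma_sets_subset[THEN subsetD])
qed

lemma natural_sigma_mono: "m \<le> n \<Longrightarrow> sets (natural_sigma M X m) \<subseteq> sets (natural_sigma M X n)"
  unfolding sets_natural_sigma by (rule sigma_sets_mono') fastforce

lemma X_adapted: "1 \<le> i \<Longrightarrow> i \<le> n \<Longrightarrow> X i \<in> borel_measurable (natural_sigma M X n)"
  by (rule measurableI) (auto simp: sets_natural_sigma intro!: sigma_sets.Basic)

lemma walk_adapted: "walk X n \<in> borel_measurable (natural_sigma M X n)"
  unfolding walk_def[abs_def] by (intro borel_measurable_sum X_adapted) auto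

lemma drift_adapted: "drift n \<in> borel_measurable (natural_sigma M X n)"
  unfolding drift_def[abs_def] using walk_adapted[of n] by measurable

lemma walk_measurable [measurable]: "walk X n \<in> borel_measurable M"
  by (rule measurable_from_subalg[OF subalgebra_natural_sigma walk_adapted])

lemma drift_measurable [measurable]: "drift n \<in> borel_measurable M"
  by (rule measurable_from_subalg[OF subalgebra_natural_sigma drift_adapted])

lemma X_abs: "1 \<le> n \<Longrightarrow> w \<in> space M \<Longrightarrow> \<bar>X n w\<bar> = 1"
  using X_values[of n w] by auto

lemma walk_bound: "w \<in> space M \<Longrightarrow> \<bar>walk X n w\<bar> \<le> n"
proof -
  assume "w \<in> space M"
  then have "(\<Sum>i = 1..n. \<bar>X i w\<bar>) = n" by (simp add: X_abs)
  then show ?thesis unfolding walk_def using sum_abs[of "\<lambda>i. X i w" "{1..n}"] by simp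
qed

lemma drift_bound:
  assumes "1 \<le> n" "w \<in> space M"
  shows "\<bar>drift n w\<bar> \<le> 1"
proof -
  have "\<bar>walk X n w / n\<bar> \<le> 1" using walk_bound[OF assms(2), of n] assms(1) by (simp add: divide_le_eq)
  then have 1: "\<bar>\<alpha> * (walk X n w / n)\<bar> \<le> \<alpha>" using alpha_range by (simp only: abs_mult abs_of_nonneg mult_left_le)
  have 2: "\<bar>(1 - \<alpha>) * eps n\<bar> \<le> 1 - \<alpha>"
    using eps_range[OF assms(1)] alpha_range by (simp add: abs_mult mult_left_le)
  show ?thesis unfolding drift_def using 1 2 abs_triangle_ineq[of "\<alpha> * (walk X n w / n)" "(1 - \<alpha>) * eps n"]
    by linarith
qed

lemma X_integrable: "1 \<le> n \<Longrightarrow> integrable M (X n)"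
  by (rule integrable_const_bound[of _ 1]) (auto simp: X_abs X_measurable)

lemma walk_integrable: "integrable M (walk X n)"
  by (rule integrable_const_bound[of _ n]) (auto simp: walk_bound)

lemma drift_integrable: "1 \<le> n \<Longrightarrow> integrable M (drift n)"
  by (rule integrable_const_bound[of _ 1]) (auto simp: drift_bound)

lemma count_steps:
  assumes "w \<in> space M" "t \<in> {1, -1}"
  shows "real (card {i \<in> {1..n}. X i w = t}) = (n + t * walk X n w) / 2"
proof -
  have "real (card {i \<in> {1..n}. X i w = t}) = (\<Sum>i\<in>{i \<in> {1..n}. X i w = t}. 1)" by simp
  also have "\<dots> = (\<Sum>i = 1..n. if X i w = t then 1 else 0)"
    by (rule sum.inter_filter) simp
  also have "\<dots> = (\<Sum>i = 1..n. (1 + t * X i w) / 2)"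
    using X_values[OF _ assms(1)] assms(2) by (intro sum.cong refl) fastforce
  also have "\<dots> = (n + t * walk X n w) / 2"
    by (simp add: walk_def sum.distrib sum_distrib_left flip: sum_divide_distrib)
  finally show ?thesis .
qed

lemma cond_exp_X:
  assumes n: "1 \<le> n"
  shows "AE w in M. real_cond_exp M (natural_sigma M X n) (X (Suc n)) w = drift n w"
proof -
  interpret sub: finite_measure_subalgebra M "natural_sigma M X n"
    using subalgebra_natural_sigma by unfold_locales
  define I :: "real \<Rightarrow> 'a \<Rightarrow> real" where "I t = indicator {w \<in> space M. X (Suc n) w = t}" for t
  have [measurable]: "X (Suc n) \<in> borel_measurable M" by (rule X_measurable) simp
  have "{w \<in> space M. X (Suc n) w = t} \<in> events" for t by measurable
  then have I_meas [measurable]: "I t \<in> borel_measurable M" for t unfolding I_def by simp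
  have I_int: "integrable M (I t)" for t
    by (rule integrable_const_bound[of _ 1]) (auto simp: I_def indicator_def)
  have I: "AE w in M. real_cond_exp M (natural_sigma M X n) (I t) w = (1 + t * drift n w) / 2"
    if t: "t \<in> {1, -1}" for t
    using step[OF n t] AE_space
  proof eventually_elim
    case (elim w)
    have "\<alpha> * (real (card {i \<in> {1..n}. X i w = t}) / real n) + (1 - \<alpha>) * ((1 + t * eps n) / 2)
        = (1 + t * drift n w) / 2"
      unfolding count_steps[OF elim(2) t] drift_def using n by (simp add: field_simps)
    then show ?case using elim(1) by (simp only: I_def)
  qed
  have "AE w in M. X (Suc n) w = I 1 w - I (- 1) w"
    using AE_space by eventually_elim (use X_values[of "Suc n"] in \<open>auto simp: I_def indicator_def\<close>)
  then have "AE w in M. real_cond_exp M (natural_sigma M X n) (X (Suc n)) w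
      = real_cond_exp M (natural_sigma M X n) (\<lambda>w. I 1 w - I (- 1) w) w"
    by (rule sub.real_cond_exp_cong) auto
  moreover have "AE w in M. real_cond_exp M (natural_sigma M X n) (\<lambda>w. I 1 w - I (- 1) w) w
      = real_cond_exp M (natural_sigma M X n) (I 1) w - real_cond_exp M (natural_sigma M X n) (I (- 1)) w"
    by (intro sub.real_cond_exp_diff I_int)
  moreover have "AE w in M. real_cond_exp M (natural_sigma M X n) (I 1) w = (1 + 1 * drift n w) / 2"
    by (rule I) simp
  moreover have "AE w in M. real_cond_exp M (natural_sigma M X n) (I (- 1)) w = (1 + - 1 * drift n w) / 2"
    by (rule I) simp
  ultimately show ?thesis by eventually_elim (simp add: field_simps)
qed

definition innovation :: "nat \<Rightarrow> 'a \<Rightarrow> real" where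
  "innovation n w = (X (Suc n) w - drift n w) / scaling \<alpha> (Suc n)"

definition innovation_var :: "nat \<Rightarrow> 'a \<Rightarrow> real" where
  "innovation_var n w = (1 - (drift n w)\<^sup>2) / (scaling \<alpha> (Suc n))\<^sup>2"

lemma innovation_martingale:
  "bounded_martingale_differences M (\<lambda>n. natural_sigma M X (Suc n)) (\<lambda>n. innovation (Suc n))
     (\<lambda>n. innovation_var (Suc n)) (\<lambda>n. 2 / scaling \<alpha> (Suc (Suc n)))"
proof unfold_locales
  show "subalgebra M (natural_sigma M X (Suc n))" for n by (rule subalgebra_natural_sigma)
  show "sets (natural_sigma M X (Suc m)) \<subseteq> sets (natural_sigma M X (Suc n))" if "m \<le> n" for m n
    using that by (intro natural_sigma_mono) simp
  show "innovation (Suc n) \<in> borel_measurable (natural_sigma M X (Suc (Suc n)))" for n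
  proof -
    have "drift (Suc n) \<in> borel_measurable (natural_sigma M X (Suc (Suc n)))"
      by (rule measurable_from_subalg[OF _ drift_adapted])
         (use natural_sigma_mono in \<open>auto simp: subalgebra_def\<close>)
    then show ?thesis
      unfolding innovation_def[abs_def] using X_adapted[of "Suc (Suc n)" "Suc (Suc n)"] by simp
  qed
  show "innovation_var (Suc n) \<in> borel_measurable (natural_sigma M X (Suc n))" for n
    unfolding innovation_var_def[abs_def] using drift_adapted[of "Suc n"] by measurable
  show "\<bar>innovation (Suc n) w\<bar> \<le> 2 / scaling \<alpha> (Suc (Suc n))" if "w \<in> space M" for n w
    using X_abs[of "Suc (Suc n)", OF _ that] drift_bound[of "Suc n", OF _ that] scaling_pos[of \<alpha> "Suc (Suc n)"] alpha_range
    by (auto simp: innovation_def abs_divide intro!: divide_right_mono)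
next
  fix n
  let ?n = "Suc n" and ?a = "scaling \<alpha> (Suc (Suc n))"
  let ?E = "real_cond_exp M (natural_sigma M X ?n)"
  interpret sub: finite_measure_subalgebra M "natural_sigma M X ?n"
    using subalgebra_natural_sigma by unfold_locales
  have [measurable]: "X (Suc ?n) \<in> borel_measurable M" by (rule X_measurable) simp
  note Xi = X_integrable[of "Suc ?n", simplified] and di = drift_integrable[of ?n, simplified]
  have EX: "AE w in M. ?E (X (Suc ?n)) w = drift ?n w" by (rule cond_exp_X) simp
  have "AE w in M. ?E (\<lambda>w. (X (Suc ?n) w - drift ?n w) / ?a) w = ?E (\<lambda>w. X (Suc ?n) w - drift ?n w) w / ?a"
    using Xi di by (intro sub.real_cond_exp_cdiv) auto
  moreover have "AE w in M. ?E (\<lambda>w. X (Suc ?n) w - drift ?n w) w = ?E (X (Suc ?n)) w - ?E (drift ?n) w"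
    using Xi di by (intro sub.real_cond_exp_diff)
  moreover have "AE w in M. ?E (drift ?n) w = drift ?n w"
    using di drift_adapted by (intro sub.real_cond_exp_F_meas)
  ultimately show "AE w in M. ?E (innovation ?n) w = 0"
    using EX unfolding innovation_def[abs_def] by eventually_elim simp
  let ?f = "\<lambda>w. (1 + (drift ?n w)\<^sup>2) / ?a\<^sup>2" and ?g = "\<lambda>w. 2 * drift ?n w / ?a\<^sup>2"
  have d1: "(drift ?n w)\<^sup>2 \<le> 1" if "w \<in> space M" for w
    using drift_bound[of ?n, OF _ that] by (simp add: abs_square_le_1)
  have a: "0 < ?a\<^sup>2" using scaling_pos[of \<alpha> "Suc (Suc n)"] alpha_range by simp
  have fi: "integrable M ?f"
  proof (rule integrable_const_bound[of _ "2 / ?a\<^sup>2"])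
    show "AE w in M. norm (?f w) \<le> 2 / ?a\<^sup>2"
      by (rule AE_I2) (use d1 in \<open>auto intro!: divide_right_mono\<close>)
  qed measurable
  have gi: "integrable M (\<lambda>w. ?g w * X (Suc ?n) w)"
  proof (rule integrable_const_bound[of _ "2 / ?a\<^sup>2"])
    show "AE w in M. norm (?g w * X (Suc ?n) w) \<le> 2 / ?a\<^sup>2"
      by (rule AE_I2) (use drift_bound[of ?n] X_abs[of "Suc ?n"] in \<open>auto simp: abs_mult intro!: divide_right_mono\<close>)
  qed measurable
  have [measurable]: "drift ?n \<in> borel_measurable (natural_sigma M X ?n)" by (rule drift_adapted)
  have "AE w in M. (innovation ?n w)\<^sup>2 = ?f w - ?g w * X (Suc ?n) w"
    using AE_space
  proof eventually_elim
    case (elim w)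
    have "(X (Suc ?n) w)\<^sup>2 = 1" using X_values[of "Suc ?n", OF _ elim] by auto
    then have sq: "(X (Suc ?n) w - drift ?n w)\<^sup>2 = (1 + (drift ?n w)\<^sup>2) - 2 * drift ?n w * X (Suc ?n) w"
      by (simp add: power2_diff)
    show ?case unfolding innovation_def power_divide sq by (simp add: diff_divide_distrib)
  qed
  then have "AE w in M. ?E (\<lambda>w. (innovation ?n w)\<^sup>2) w = ?E (\<lambda>w. ?f w - ?g w * X (Suc ?n) w) w"
    by (rule sub.real_cond_exp_cong) (auto simp: innovation_def[abs_def])
  moreover have "AE w in M. ?E (\<lambda>w. ?f w - ?g w * X (Suc ?n) w) w = ?E ?f w - ?E (\<lambda>w. ?g w * X (Suc ?n) w) w"
    using fi gi by (intro sub.real_cond_exp_diff)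
  moreover have "AE w in M. ?E ?f w = ?f w" using fi by (intro sub.real_cond_exp_F_meas) measurable
  moreover have "AE w in M. ?E (\<lambda>w. ?g w * X (Suc ?n) w) w = ?g w * ?E (X (Suc ?n)) w"
    using gi by (intro sub.real_cond_exp_mult) measurable
  ultimately show "AE w in M. ?E (\<lambda>w. (innovation ?n w)\<^sup>2) w = innovation_var ?n w"
    using EX
  proof eventually_elim
    case (elim w)
    have "?f w - ?g w * drift ?n w = innovation_var ?n w"
      by (simp add: innovation_var_def power2_eq_square diff_divide_distrib[symmetric])
    then show ?case by (simp only: elim)
  qed
qed

lemma expectation_walk_Suc:
  assumes "1 \<le> n"
  shows "expectation (walk X (Suc n)) = (1 + \<alpha> / n) * expectation (walk X n) + (1 - \<alpha>) * eps n"
proof -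
  interpret sub: finite_measure_subalgebra M "natural_sigma M X n"
    using subalgebra_natural_sigma by unfold_locales
  have "expectation (X (Suc n)) = expectation (real_cond_exp M (natural_sigma M X n) (X (Suc n)))"
    by (rule sub.real_cond_exp_int(2)[symmetric]) (simp add: X_integrable)
  also have "\<dots> = expectation (drift n)"
    by (intro integral_cong_AE cond_exp_X assms) auto
  also have "\<dots> = \<alpha> * (expectation (walk X n) / n) + (1 - \<alpha>) * eps n"
    using walk_integrable[of n] by (simp add: drift_def[abs_def] prob_space)
  finally have "expectation (X (Suc n)) = \<alpha> * (expectation (walk X n) / n) + (1 - \<alpha>) * eps n" .
  moreover have "walk X (Suc n) = (\<lambda>w. walk X n w + X (Suc n) w)" by (auto simp: walk_def)
  then have "expectation (walk X (Suc n)) = expectation (walk X n) + expectation (X (Suc n))"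
    using walk_integrable[of n] X_integrable[of "Suc n"] by simp
  ultimately show ?thesis by (simp add: algebra_simps)
qed

definition fluctuation :: "nat \<Rightarrow> 'a \<Rightarrow> real" where
  "fluctuation n w = (walk X n w - expectation (walk X n)) / scaling \<alpha> n"

lemma fluctuation_Suc:
  assumes "1 \<le> n"
  shows "fluctuation (Suc n) w = fluctuation n w + innovation n w"
proof -
  have a: "0 < scaling \<alpha> n" "0 < 1 + \<alpha> / n"
    using scaling_pos alpha_range assms by (auto simp: add_pos_nonneg)
  have "walk X (Suc n) w = walk X n w + X (Suc n) w" by (simp add: walk_def)
  then have "walk X (Suc n) w - expectation (walk X (Suc n))
      = (1 + \<alpha> / n) * (walk X n w - expectation (walk X n)) + (X (Suc n) w - drift n w)"
    by (simp add: expectation_walk_Suc[OF assms] drift_def algebra_simps diff_divide_distrib)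
  then show ?thesis
    using a by (simp add: fluctuation_def innovation_def scaling_Suc[OF assms] add_divide_distrib)
qed

lemma sum_innovation: "(\<Sum>j<n. innovation (Suc j) w) = fluctuation (Suc n) w - fluctuation 1 w"
  by (induction n) (simp_all add: fluctuation_Suc)

lemma expectation_walk_lim:
  assumes eps: "eps \<longlonglongrightarrow> \<epsilon>"
  shows "(\<lambda>n. expectation (walk X n) / n) \<longlonglongrightarrow> \<epsilon>"
proof -
  define e where "e n = expectation (walk X n) - \<epsilon> * n" for n :: nat
  have "(\<lambda>n. \<bar>e n\<bar> / n) \<longlonglongrightarrow> 0"
  proof (rule harmonic_contraction_lim[where \<kappa> = "1 - \<alpha>" and d = "\<lambda>n. \<bar>eps n - \<epsilon>\<bar>"])
    fix n :: nat assume n: "1 \<le> n"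
    have "e (Suc n) = (1 + \<alpha> / n) * e n + (1 - \<alpha>) * (eps n - \<epsilon>)"
      using n by (simp add: e_def expectation_walk_Suc field_simps)
    then have "\<bar>e (Suc n)\<bar> \<le> (1 + \<alpha> / n) * \<bar>e n\<bar> + (1 - \<alpha>) * \<bar>eps n - \<epsilon>\<bar>"
      using abs_triangle_ineq[of "(1 + \<alpha> / n) * e n" "(1 - \<alpha>) * (eps n - \<epsilon>)"] alpha_range
      by (simp add: abs_mult)
    then have "\<bar>e (Suc n)\<bar> / Suc n \<le> ((1 + \<alpha> / n) * \<bar>e n\<bar> + (1 - \<alpha>) * \<bar>eps n - \<epsilon>\<bar>) / Suc n"
      by (rule divide_right_mono) simp
    also have "\<dots> = (1 - (1 - \<alpha>) / Suc n) * (\<bar>e n\<bar> / n) + (1 - \<alpha>) / Suc n * \<bar>eps n - \<epsilon>\<bar>"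
    proof -
      have "(1 + \<alpha> / n) * \<bar>e n\<bar> / Suc n = (1 - (1 - \<alpha>) / Suc n) * (\<bar>e n\<bar> / n)"
        using n by (simp add: field_simps)
      then show ?thesis by (simp add: add_divide_distrib)
    qed
    finally show "\<bar>e (Suc n)\<bar> / Suc n \<le> (1 - (1 - \<alpha>) / Suc n) * (\<bar>e n\<bar> / n) + (1 - \<alpha>) / Suc n * \<bar>eps n - \<epsilon>\<bar>" .
  next
    show "(\<lambda>n. \<bar>eps n - \<epsilon>\<bar>) \<longlonglongrightarrow> 0"
      using tendsto_rabs[OF tendsto_diff[OF eps tendsto_const, of \<epsilon>]] by simp
  qed (use alpha_range in auto)
  then have "(\<lambda>n. e n / n) \<longlonglongrightarrow> 0"
    by (intro tendsto_rabs_zero_cancel[where f = "\<lambda>n. e n / real n"]) simp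
  then have "(\<lambda>n. \<epsilon> + e n / n) \<longlonglongrightarrow> \<epsilon> + 0" by (intro tendsto_intros)
  moreover have "\<forall>\<^sub>F n in sequentially. \<epsilon> + e n / n = expectation (walk X n) / n"
    using eventually_gt_at_top[of 0] by eventually_elim (simp add: e_def field_simps)
  ultimately show ?thesis by (auto intro: Lim_transform_eventually)
qed

text \<open>
  The random part of \<open>S\<^sub>n / n\<close> is \<open>a\<^sub>n / n\<close> times a convergent sequence and vanishes, since
  \<open>\<alpha> < 1\<close>; so the drift has the deterministic limit that solves \<open>\<epsilon> = \<alpha> \<epsilon> + (1 - \<alpha>) \<epsilon>\<close>.
\<close>

lemma drift_lim:
  assumes eps: "eps \<longlonglongrightarrow> \<epsilon>" and conv: "(\<lambda>n. fluctuation n w) \<longlonglongrightarrow> l"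
  shows "(\<lambda>n. drift n w) \<longlonglongrightarrow> \<epsilon>"
proof -
  have "(\<lambda>n. \<alpha> * (fluctuation n w * (scaling \<alpha> n / n) + expectation (walk X n) / n) + (1 - \<alpha>) * eps n)
      \<longlonglongrightarrow> \<alpha> * (l * 0 + \<epsilon>) + (1 - \<alpha>) * \<epsilon>"
    using alpha_range by (intro tendsto_intros conv scaling_over_self_lim expectation_walk_lim eps)
  moreover have "\<alpha> * (fluctuation n w * (scaling \<alpha> n / n) + expectation (walk X n) / n) + (1 - \<alpha>) * eps n = drift n w" for n
    using scaling_pos[of \<alpha> n] alpha_range
    by (simp add: fluctuation_def drift_def add_divide_distrib[symmetric])
  ultimately show ?thesis by (simp add: algebra_simps)
qed

text \<open>
  The indices are shifted by one because the martingale structure of the walk starts at time 1.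
\<close>

lemma fluctuation_tail_martingale:
  fixes W :: "'a \<Rightarrow> real"
  assumes alpha: "1/2 < \<alpha>" and eps: "eps \<longlonglongrightarrow> \<epsilon>" and \<epsilon>: "0 \<le> \<epsilon>" "\<epsilon> < 1"
    and W [measurable]: "W \<in> borel_measurable M" and conv: "AE w in M. (\<lambda>n. fluctuation n w) \<longlonglongrightarrow> W w"
  shows "tail_martingale M (\<lambda>n. natural_sigma M X (Suc n)) (\<lambda>n. innovation (Suc n))
     (\<lambda>n. innovation_var (Suc n)) (\<lambda>n. 2 / scaling \<alpha> (Suc (Suc n)))
     (\<lambda>n. (1 - \<epsilon>\<^sup>2) / (2 * \<alpha> - 1) * var_scale \<alpha> (Suc n)) (1 / (1 - \<epsilon>\<^sup>2))
     (\<lambda>w. W w - fluctuation 1 w)"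
proof -
  define C where "C = (1 - \<epsilon>\<^sup>2) / (2 * \<alpha> - 1)"
  have \<epsilon>2: "0 < 1 - \<epsilon>\<^sup>2" using power_strict_mono[of \<epsilon> 1 2] \<epsilon> by simp
  have C: "0 < C" "C * (2 * \<alpha> - 1) = 1 - \<epsilon>\<^sup>2" using \<epsilon>2 alpha by (auto simp: C_def)
  note a0 = alpha_range(1)
  have diff: "C * var_scale \<alpha> (Suc n) - C * var_scale \<alpha> (Suc (Suc n))
      = C * (2 * \<alpha> - 1 + \<alpha>\<^sup>2 / Suc n) / (scaling \<alpha> (Suc (Suc n)))\<^sup>2" for n
    using var_scale_diff[OF a0, of "Suc n"] by (simp add: right_diff_distrib[symmetric])
  have apos: "0 < scaling \<alpha> n" for n by (rule scaling_pos[OF a0])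
  interpret bounded_martingale_differences M "\<lambda>n. natural_sigma M X (Suc n)" "\<lambda>n. innovation (Suc n)"
    "\<lambda>n. innovation_var (Suc n)" "\<lambda>n. 2 / scaling \<alpha> (Suc (Suc n))"
    by (rule innovation_martingale)
  have Vlim: "(\<lambda>n. C * var_scale \<alpha> (Suc n)) \<longlonglongrightarrow> 0"
    using tendsto_mult_right_zero[OF LIMSEQ_Suc[OF var_scale_lim[OF alpha alpha_range(2)]], of C] by simp
  show ?thesis
    unfolding C_def[symmetric]
  proof unfold_locales
    show "0 < C * var_scale \<alpha> (Suc n)" for n using C var_scale_pos[OF a0, of "Suc n"] by simp
    show "C * var_scale \<alpha> (Suc (Suc n)) < C * var_scale \<alpha> (Suc n)" for n
    proof -
      have "0 < 2 * \<alpha> - 1 + \<alpha>\<^sup>2 / Suc n" using alpha by (simp add: add_pos_nonneg)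
      then have "0 < C * (2 * \<alpha> - 1 + \<alpha>\<^sup>2 / Suc n) / (scaling \<alpha> (Suc (Suc n)))\<^sup>2"
        using C apos[of "Suc (Suc n)"] by simp
      then show ?thesis using diff[of n] by linarith
    qed
    show "(\<lambda>n. C * var_scale \<alpha> (Suc n)) \<longlonglongrightarrow> 0" by (rule Vlim)
    show "(\<lambda>n. C * var_scale \<alpha> (Suc (Suc n)) / (C * var_scale \<alpha> (Suc n))) \<longlonglongrightarrow> 1"
      using LIMSEQ_Suc[OF var_scale_ratio_lim[OF a0]] C by simp
    show "AE w in M. (\<lambda>n. innovation_var (Suc n) w /
        (C * var_scale \<alpha> (Suc n) - C * var_scale \<alpha> (Suc (Suc n)))) \<longlonglongrightarrow> 1"
      using conv
    proof eventually_elim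
      case (elim w)
      have "(\<lambda>n. \<alpha>\<^sup>2 / real (Suc n)) \<longlonglongrightarrow> 0" by real_asymp
      then have lim: "(\<lambda>n. (1 - (drift (Suc n) w)\<^sup>2) / (C * (2 * \<alpha> - 1 + \<alpha>\<^sup>2 / Suc n)))
          \<longlonglongrightarrow> (1 - \<epsilon>\<^sup>2) / (C * (2 * \<alpha> - 1 + 0))"
        using C alpha by (intro tendsto_intros LIMSEQ_Suc[OF drift_lim[OF eps elim]]) auto
      have one: "(1 - \<epsilon>\<^sup>2) / (C * (2 * \<alpha> - 1 + 0)) = 1" using C \<epsilon>2 by simp
      show ?case
        unfolding diff innovation_var_def
        using lim[unfolded one] apos by (simp add: less_imp_neq[THEN not_sym])
    qed
    show "AE w in M. innovation_var (Suc n) w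
        \<le> 1 / (1 - \<epsilon>\<^sup>2) * (C * var_scale \<alpha> (Suc n) - C * var_scale \<alpha> (Suc (Suc n)))" for n
    proof (rule AE_I2)
      fix w
      have "1 - \<epsilon>\<^sup>2 \<le> C * (2 * \<alpha> - 1 + \<alpha>\<^sup>2 / Suc n)" using C by (simp add: distrib_left)
      then have "1 \<le> 1 / (1 - \<epsilon>\<^sup>2) * (C * (2 * \<alpha> - 1 + \<alpha>\<^sup>2 / Suc n))"
        using \<epsilon>2 by (simp add: le_divide_eq)
      then have "1 - (drift (Suc n) w)\<^sup>2 \<le> 1 / (1 - \<epsilon>\<^sup>2) * (C * (2 * \<alpha> - 1 + \<alpha>\<^sup>2 / Suc n))"
        by (rule order_trans[rotated]) simp
      from divide_right_mono[OF this, of "(scaling \<alpha> (Suc (Suc n)))\<^sup>2"]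
      show "innovation_var (Suc n) w
        \<le> 1 / (1 - \<epsilon>\<^sup>2) * (C * var_scale \<alpha> (Suc n) - C * var_scale \<alpha> (Suc (Suc n)))"
        unfolding diff innovation_var_def by simp
    qed
    show "(\<lambda>n. (2 / scaling \<alpha> (Suc (Suc n)))\<^sup>2 / (C * var_scale \<alpha> (Suc n)) * ln \<bar>ln (C * var_scale \<alpha> (Suc n))\<bar>) \<longlonglongrightarrow> 0"
    proof (rule tendsto_sandwich[OF _ _ tendsto_const])
      show "(\<lambda>n. 4 / (C * Suc n) * ln (ln (Suc n / C))) \<longlonglongrightarrow> 0" using C by real_asymp
      have "\<forall>\<^sub>F n in sequentially. C * var_scale \<alpha> (Suc n) < exp (- 1)"
        by (rule order_tendstoD(2)[OF Vlim]) simp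
      then have *: "\<forall>\<^sub>F n in sequentially. 0 \<le> ln \<bar>ln (C * var_scale \<alpha> (Suc n))\<bar>
          \<and> ln \<bar>ln (C * var_scale \<alpha> (Suc n))\<bar> \<le> ln (ln (Suc n / C))"
      proof eventually_elim
        case (elim n)
        let ?V = "C * var_scale \<alpha> (Suc n)"
        have V: "0 < ?V" using C var_scale_pos[OF a0, of "Suc n"] by simp
        have "ln ?V < ln (exp (- 1))" using elim V by (subst ln_less_cancel_iff) auto
        then have l: "1 < - ln ?V" by simp
        have "1 / Suc n \<le> var_scale \<alpha> (Suc n)"
          using alpha_range by (intro var_scale_ge) auto
        then have "C * (1 / Suc n) \<le> ?V" using C by (intro mult_left_mono) auto
        then have "ln (C * (1 / Suc n)) \<le> ln ?V" using C V by (subst ln_le_cancel_iff) auto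
        moreover have "ln (C * (1 / Suc n)) = - ln (Suc n / C)"
          using C by (simp add: ln_mult ln_divide_pos)
        ultimately have u: "- ln ?V \<le> ln (Suc n / C)" by linarith
        have abs: "\<bar>ln ?V\<bar> = - ln ?V" using l by simp
        show ?case unfolding abs using l u by (auto simp: ln_ge_zero)
      qed
      then show "\<forall>\<^sub>F n in sequentially. 0 \<le> (2 / scaling \<alpha> (Suc (Suc n)))\<^sup>2 / (C * var_scale \<alpha> (Suc n)) * ln \<bar>ln (C * var_scale \<alpha> (Suc n))\<bar>"
        by eventually_elim (use C var_scale_pos[OF a0] in \<open>auto intro!: mult_nonneg_nonneg divide_nonneg_nonneg simp: less_imp_le\<close>)
      from * show "\<forall>\<^sub>F n in sequentially. (2 / scaling \<alpha> (Suc (Suc n)))\<^sup>2 / (C * var_scale \<alpha> (Suc n)) * ln \<bar>ln (C * var_scale \<alpha> (Suc n))\<bar>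
          \<le> 4 / (C * Suc n) * ln (ln (Suc n / C))"
      proof eventually_elim
        case (elim n)
        let ?a = "scaling \<alpha> (Suc n)" and ?b = "scaling \<alpha> (Suc (Suc n))"
        have "(2 / ?b)\<^sup>2 / (C * var_scale \<alpha> (Suc n)) = 4 / (C * Suc n) * (?a\<^sup>2 / ?b\<^sup>2)"
          by (simp add: var_scale_def power_divide)
        also have "\<dots> \<le> 4 / (C * Suc n) * 1"
        proof (intro mult_left_mono)
          have "?a\<^sup>2 \<le> ?b\<^sup>2" using scaling_le_Suc[OF a0, of "Suc n"] apos[of "Suc n"] by (intro power_mono) auto
          then show "?a\<^sup>2 / ?b\<^sup>2 \<le> 1" using apos[of "Suc (Suc n)"] by simp
        qed (use C in simp)
        finally have "(2 / ?b)\<^sup>2 / (C * var_scale \<alpha> (Suc n)) \<le> 4 / (C * Suc n)" by simp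
        then show ?case using elim C by (intro mult_mono) auto
      qed
    qed
    show "(\<lambda>w. W w - fluctuation 1 w) \<in> borel_measurable M"
      unfolding fluctuation_def by measurable
    show "AE w in M. (\<lambda>n. \<Sum>j<n. innovation (Suc j) w) \<longlonglongrightarrow> W w - fluctuation 1 w"
      using conv
    proof eventually_elim
      case (elim w)
      show ?case unfolding sum_innovation by (intro tendsto_intros LIMSEQ_Suc elim)
    qed
  qed
qed

end

section \<open>Fluctuations of the elephant random walk\<close>

theorem theorem2p3:
  fixes M :: "'a measure" and X :: "nat \<Rightarrow> 'a \<Rightarrow> real"
    and \<alpha> \<beta> \<epsilon> :: real and eps :: "nat \<Rightarrow> real" and W :: "'a \<Rightarrow> real"
  assumes erw: "elephant_random_walk M X \<alpha> \<beta> eps"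
    and alpha: "1/2 < \<alpha>" "\<alpha> < 1"
    and eps_lim: "eps \<longlonglongrightarrow> \<epsilon>"
    and eps_range: "0 \<le> \<epsilon>" "\<epsilon> < 1"
    and W_measurable: "W \<in> borel_measurable M"
    and W_AE: "AE \<omega> in M.
      (\<lambda>n. (walk X n \<omega> - integral\<^sup>L M (walk X n)) / scaling \<alpha> n) \<longlonglongrightarrow> W \<omega>"
    and W_L2: "L2_limit M
      (\<lambda>n \<omega>. (walk X n \<omega> - integral\<^sup>L M (walk X n)) / scaling \<alpha> n) W"
  shows "weak_conv_m
      (\<lambda>n. distr M borel (\<lambda>\<omega>.
        (walk X n \<omega> - integral\<^sup>L M (walk X n) - W \<omega> * scaling \<alpha> n)
          / sqrt ((1 - \<epsilon>\<^sup>2) / (2 * \<alpha> - 1) * real n)))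
      std_normal_distribution
    \<and> (\<forall>s \<in> {1, -1 :: real}. AE \<omega> in M.
        limsup (\<lambda>n. ereal (s *
          ((walk X n \<omega> - integral\<^sup>L M (walk X n) - W \<omega> * scaling \<alpha> n)
            / (scaling \<alpha> n
                * phi_hat ((1 - \<epsilon>\<^sup>2) / (2 * \<alpha> - 1) * (real n / (scaling \<alpha> n)\<^sup>2))))))
        = 1)"
proof -
  note limit_range = eps_range
  interpret elephant_random_walk M X \<alpha> \<beta> eps by (rule erw)
  define C where "C = (1 - \<epsilon>\<^sup>2) / (2 * \<alpha> - 1)"
  define R where "R n w = walk X n w - integral\<^sup>L M (walk X n) - W w * scaling \<alpha> n" for n w
  have conv: "AE w in M. (\<lambda>n. fluctuation n w) \<longlonglongrightarrow> W w"
    using W_AE by (simp add: fluctuation_def)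
  interpret T: tail_martingale M "\<lambda>n. natural_sigma M X (Suc n)" "\<lambda>n. innovation (Suc n)"
    "\<lambda>n. innovation_var (Suc n)" "\<lambda>n. 2 / scaling \<alpha> (Suc (Suc n))"
    "\<lambda>n. C * var_scale \<alpha> (Suc n)" "1 / (1 - \<epsilon>\<^sup>2)" "\<lambda>w. W w - fluctuation 1 w"
    unfolding C_def by (rule fluctuation_tail_martingale[OF alpha(1) eps_lim limit_range W_measurable conv])
  interpret N: tail_martingale M "\<lambda>n. natural_sigma M X (Suc n)" "\<lambda>n w. - innovation (Suc n) w"
    "\<lambda>n. innovation_var (Suc n)" "\<lambda>n. 2 / scaling \<alpha> (Suc (Suc n))"
    "\<lambda>n. C * var_scale \<alpha> (Suc n)" "1 / (1 - \<epsilon>\<^sup>2)" "\<lambda>w. - (W w - fluctuation 1 w)"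
    by (rule T.tail_martingale_negated)
  have a: "0 < scaling \<alpha> n" for n using alpha by (intro scaling_pos) simp
  have Ntail: "N.tail n w = R (Suc n) w / scaling \<alpha> (Suc n)" for n w
    using a[of "Suc n"] unfolding N.tail_def sum_negf sum_innovation
    by (simp add: R_def fluctuation_def diff_divide_distrib)
  have Ttail: "T.tail n w = - N.tail n w" for n w
    unfolding T.tail_def N.tail_def by (simp add: sum_negf)
  have eq: "N.tail n w / sqrt (C * var_scale \<alpha> (Suc n)) = R (Suc n) w / sqrt (C * real (Suc n))" for n w
    unfolding Ntail using a[of "Suc n"] by (simp add: var_scale_def real_sqrt_mult real_sqrt_divide)
  have "weak_conv_m (\<lambda>n. distr M borel (\<lambda>w. R (Suc n) w / sqrt (C * real (Suc n)))) std_normal_distribution"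
    using N.tail_clt unfolding eq .
  then have clt: "weak_conv_m (\<lambda>n. distr M borel (\<lambda>w. R n w / sqrt (C * real n))) std_normal_distribution"
    unfolding weak_conv_m_def weak_conv_def by (auto intro: LIMSEQ_imp_Suc)
  have shift: "limsup (\<lambda>n. ereal (t * (R (Suc n) w / (scaling \<alpha> (Suc n) * phi_hat (C * var_scale \<alpha> (Suc n))))))
      = limsup (\<lambda>n. ereal (t * (R n w / (scaling \<alpha> n * phi_hat (C * var_scale \<alpha> n)))))" for t w
    using limsup_shift[of "\<lambda>n. ereal (t * (R n w / (scaling \<alpha> n * phi_hat (C * var_scale \<alpha> n))))"] by simp
  have plus: "AE w in M. limsup (\<lambda>n. ereal (1 * (R n w / (scaling \<alpha> n * phi_hat (C * var_scale \<alpha> n))))) = 1"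
    unfolding shift[symmetric] using N.tail_lil by (simp only: Ntail divide_divide_eq_left mult_1)
  have "- (x / y) / z = - 1 * (x / (y * z))" for x y z :: real by simp
  then have minus: "AE w in M. limsup (\<lambda>n. ereal (- 1 * (R n w / (scaling \<alpha> n * phi_hat (C * var_scale \<alpha> n))))) = 1"
    unfolding shift[symmetric] using T.tail_lil by (simp only: Ttail Ntail)
  have lil: "\<forall>t\<in>{1, - 1}. AE w in M. limsup (\<lambda>n. ereal (t * (R n w / (scaling \<alpha> n * phi_hat (C * var_scale \<alpha> n))))) = 1"
    using plus minus by blast
  show ?thesis
    by (rule conjI[OF clt[unfolded R_def C_def] lil[unfolded R_def C_def var_scale_def]])
qed

end
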